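(* Let $n\ge1$. The $\mathbb{C}(q)$-algebra $\widehat{\mathcal{H}}_n^-$ has a basis consisting of the elements $$p_1^{k_1} \cdots p_n^{k_n}\, q_1^{\epsilon_1} \cdots q_n^{\epsilon_n}\cdot R_{1,a_1}R_{2,a_2}\cdots R_{n-1,a_{n-1}},$$ where $k_1,\ldots, k_n \in\mathbb{Z}_{\ge0}$, $\epsilon_1,\ldots,\epsilon_n \in \{0,1\}$, and $0 \le a_i\le i$ for $1 \le i \le n-1$.
   Context: Let $q$ be a formal parameter and $\varepsilon=q-q^{-1}$ (the parameter $q$ is not to be confused with the generators $q_i$). The spin affine Hecke algebra $\widehat{\mathcal{H}}_n^-$ is the unital associative $\mathbb{C}(q)$-algebra generated by $R_i$ $(1\le i\le n-1)$ and $p_i,q_i$ $(1\le i\le n)$ subject to: $R_i^2=-\varepsilon^2-2$; $R_iR_j=-R_jR_i$ for $|i-j|>1$; $R_iR_{i+1}R_i-R_{i+1}R_iR_{i+1}=\varepsilon^2(R_{i+1}-R_i)$; $p_ip_j=p_jp_i$ and $q_iq_j=-q_jq_i$ for $i\ne j$; $p_i^2+q_i^2=1$; $p_iq_j=q_jp_i$ for all $i,j$; $R_ip_j=p_jR_i$ and $R_iq_j=-q_jR_i$ for $j\ne i,i+1$; $R_ip_i=p_{i+1}R_i+\varepsilon(q_i-q_{i+1})$; $R_iq_i=-q_{i+1}R_i-\varepsilon(p_i+p_{i+1})$. For $1\le i\le n-1$ and $0\le a\le i$ put $R_{i,a}:=R_iR_{i-1}\cdots R_{i-a+1}$ (a product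 of $a$ generators), with $R_{i,0}=1$. *)

theory Defs
  imports
    "HOL-Computational_Algebra.Fraction_Field"
    "HOL-Computational_Algebra.Polynomial"
    "HOL-Library.Poly_Mapping"
    "HOL-Algebra.QuotRing"
    "Jordan_Normal_Form.VS_Connect"
begin

section \<open>Algebras presented by generators and relations\<close>

text \<open>
  The free monoid is written additively because the multiplication of
  \<^type>\<open>poly_mapping\<close> is convolution over an additive monoid; with keys in
  the free monoid, \<^type>\<open>poly_mapping\<close> is the free associative algebra.
\<close>

datatype 'g free_monoid = Word (letters: "'g list")

instantiation free_monoid :: (type) monoid_add
begin

definition zero_free_monoid :: "'a free_monoid" where
  "0 = Word []"

definition plus_free_monoid :: "'a free_monoid \<Rightarrow> 'a free_monoid \<Rightarrow> 'a free_monoid" where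
  "u + v = Word (letters u @ letters v)"

instance
  by standard (simp_all add: zero_free_monoid_def plus_free_monoid_def)

end

type_synonym ('g, 'k) free_poly = "'g free_monoid \<Rightarrow>\<^sub>0 'k"

definition gen :: "'g \<Rightarrow> ('g, 'k::field) free_poly" where
  "gen x = Poly_Mapping.single (Word [x]) 1"

definition scal :: "'k::field \<Rightarrow> ('g, 'k) free_poly" where
  "scal c = Poly_Mapping.single 0 c"

definition free_algebra :: "'g set \<Rightarrow> ('k::field, ('g, 'k) free_poly) module" where
  "free_algebra X =
    \<lparr>carrier = {f. \<forall>w \<in> Poly_Mapping.keys f. set (letters w) \<subseteq> X},
     mult = (*), one = 1, zero = 0, add = (+),
     smult = (\<lambda>c f. scal c * f)\<rparr>"

text \<open>
  The two-sided ideal generated by \<open>S\<close>; a relation \<open>l = r\<close> is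
  represented in \<open>S\<close> by the element \<open>l - r\<close>.
\<close>

definition rel_ideal :: "'g set \<Rightarrow> ('g, 'k::field) free_poly set \<Rightarrow> ('g, 'k) free_poly set" where
  "rel_ideal X S = Idl\<^bsub>free_algebra X\<^esub> S"

text \<open>
  \<^const>\<open>FactRing\<close> only provides the ring structure on cosets; the scalar
  action \<open>c \<odot> (I + f) = I + c f\<close> is added in the same style as
  \<^const>\<open>rcoset_mult\<close>.
\<close>

definition presented_algebra ::
  "'g set \<Rightarrow> ('g, 'k::field) free_poly set \<Rightarrow> ('k, ('g, 'k) free_poly set) module" where
  "presented_algebra X S = ring.extend (free_algebra X Quot rel_ideal X S)
     \<lparr>smult = (\<lambda>c C. \<Union>f\<in>C. rel_ideal X S +>\<^bsub>free_algebra X\<^esub> (c \<odot>\<^bsub>free_algebra X\<^esub> f))\<rparr>"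

definition presented_class ::
  "'g set \<Rightarrow> ('g, 'k::field) free_poly set \<Rightarrow> ('g, 'k) free_poly \<Rightarrow> ('g, 'k) free_poly set" where
  "presented_class X S f = rel_ideal X S +>\<^bsub>free_algebra X\<^esub> f"


section \<open>The spin affine Hecke algebra\<close>

text \<open>The field \<open>C(q)\<close> is the fraction field of \<open>C[q]\<close>.\<close>

type_synonym cq = "complex poly fract"

definition qpar :: cq where
  "qpar = Fract [:0, 1:] 1"

definition eps :: cq where
  "eps = qpar - inverse qpar"

datatype hecke_gen = GR nat | GP nat | GQ nat

definition hecke_gens :: "nat \<Rightarrow> hecke_gen set" where
  "hecke_gens n = GR ` {1..<n} \<union> GP ` {1..n} \<union> GQ ` {1..n}"

abbreviation fR :: "nat \<Rightarrow> (hecke_gen, cq) free_poly" where "fR i \<equiv> gen (GR i)"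
abbreviation fP :: "nat \<Rightarrow> (hecke_gen, cq) free_poly" where "fP i \<equiv> gen (GP i)"
abbreviation fQ :: "nat \<Rightarrow> (hecke_gen, cq) free_poly" where "fQ i \<equiv> gen (GQ i)"

definition hecke_rels :: "nat \<Rightarrow> (hecke_gen, cq) free_poly set" where
  "hecke_rels n =
     {fR i ^ 2 - scal (- (eps ^ 2) - 2) | i. i \<in> {1..<n}}
   \<union> {fR i * fR j - (- (fR j * fR i)) | i j. i \<in> {1..<n} \<and> j \<in> {1..<n} \<and> \<bar>int i - int j\<bar> > 1}
   \<union> {(fR i * fR (i+1) * fR i - fR (i+1) * fR i * fR (i+1)) - scal (eps ^ 2) * (fR (i+1) - fR i)
       | i. i \<in> {1..<n} \<and> i + 1 \<in> {1..<n}}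
   \<union> {fP i * fP j - fP j * fP i | i j. i \<in> {1..n} \<and> j \<in> {1..n} \<and> i \<noteq> j}
   \<union> {fQ i * fQ j - (- (fQ j * fQ i)) | i j. i \<in> {1..n} \<and> j \<in> {1..n} \<and> i \<noteq> j}
   \<union> {(fP i ^ 2 + fQ i ^ 2) - 1 | i. i \<in> {1..n}}
   \<union> {fP i * fQ j - fQ j * fP i | i j. i \<in> {1..n} \<and> j \<in> {1..n}}
   \<union> {fR i * fP j - fP j * fR i | i j. i \<in> {1..<n} \<and> j \<in> {1..n} \<and> j \<noteq> i \<and> j \<noteq> i + 1}
   \<union> {fR i * fQ j - (- (fQ j * fR i)) | i j. i \<in> {1..<n} \<and> j \<in> {1..n} \<and> j \<noteq> i \<and> j \<noteq> i + 1}
   \<union> {fR i * fP i - (fP (i+1) * fR i + scal eps * (fQ i - fQ (i+1))) | i. i \<in> {1..<n}}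
   \<union> {fR i * fQ i - (- (fQ (i+1) * fR i) - scal eps * (fP i + fP (i+1))) | i. i \<in> {1..<n}}"

definition spin_affine_hecke :: "nat \<Rightarrow> (cq, (hecke_gen, cq) free_poly set) module" where
  "spin_affine_hecke n = presented_algebra (hecke_gens n) (hecke_rels n)"

definition hR :: "nat \<Rightarrow> nat \<Rightarrow> (hecke_gen, cq) free_poly set" where
  "hR n i = presented_class (hecke_gens n) (hecke_rels n) (fR i)"

definition hP :: "nat \<Rightarrow> nat \<Rightarrow> (hecke_gen, cq) free_poly set" where
  "hP n i = presented_class (hecke_gens n) (hecke_rels n) (fP i)"

definition hQ :: "nat \<Rightarrow> nat \<Rightarrow> (hecke_gen, cq) free_poly set" where
  "hQ n i = presented_class (hecke_gens n) (hecke_rels n) (fQ i)"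

definition list_prod :: "('a, 'm) monoid_scheme \<Rightarrow> 'a list \<Rightarrow> 'a" where
  "list_prod G xs = foldr (mult G) xs \<one>\<^bsub>G\<^esub>"

text \<open>
  \<open>R\<^sub>i R\<^sub>i\<^sub>-\<^sub>1 \<dots>\<close> with \<open>a\<close> descending factors; for \<open>a \<le> i\<close> all
  indices stay in \<open>{1..i}\<close>.
\<close>

definition hR_chain :: "nat \<Rightarrow> nat \<Rightarrow> nat \<Rightarrow> (hecke_gen, cq) free_poly set" where
  "hR_chain n i a = list_prod (spin_affine_hecke n) (map (\<lambda>j. hR n (i - j)) [0..<a])"

definition pbw_monomial ::
  "nat \<Rightarrow> (nat \<Rightarrow> nat) \<times> (nat \<Rightarrow> nat) \<times> (nat \<Rightarrow> nat) \<Rightarrow> (hecke_gen, cq) free_poly set" where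
  "pbw_monomial n = (\<lambda>(k, e, a).
     list_prod (spin_affine_hecke n) (map (\<lambda>i. hP n i [^]\<^bsub>spin_affine_hecke n\<^esub> k i) [1..<Suc n])
     \<otimes>\<^bsub>spin_affine_hecke n\<^esub>
     list_prod (spin_affine_hecke n) (map (\<lambda>i. hQ n i [^]\<^bsub>spin_affine_hecke n\<^esub> e i) [1..<Suc n])
     \<otimes>\<^bsub>spin_affine_hecke n\<^esub>
     list_prod (spin_affine_hecke n) (map (\<lambda>i. hR_chain n i (a i)) [1..<n]))"

text \<open>
  Exponent tuples are extensional functions, so that each tuple is represented exactly once
  and injectivity of \<open>pbw_monomial n\<close> on \<open>pbw_index n\<close> says that
  different exponents give different monomials.
\<close>

definition pbw_index :: "nat \<Rightarrow> ((nat \<Rightarrow> nat) \<times> (nat \<Rightarrow> nat) \<times> (nat \<Rightarrow> nat)) set" where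
  "pbw_index n = ({1..n} \<rightarrow>\<^sub>E UNIV) \<times> ({1..n} \<rightarrow>\<^sub>E {0, 1}) \<times> (\<Pi>\<^sub>E i\<in>{1..<n}. {0..i})"


section \<open>Well-formedness\<close>

lemma scal_comm: "scal c * f = f * scal c" for f :: "('g, 'k::field) free_poly"
proof (induction f rule: update_induct)
  case const
  then show ?case by simp
next
  case (update f w d)
  have "Poly_Mapping.update w d f = Poly_Mapping.single w d + f"
    using update.hyps(1)
    by (intro poly_mapping_eqI)
      (auto simp: lookup_update lookup_add lookup_single when_def in_keys_iff)
  moreover have "scal c * Poly_Mapping.single w d = Poly_Mapping.single w d * scal c"
    by (simp add: scal_def Poly_Mapping.mult_single mult.commute)
  ultimately show ?case
    using update.IH by (simp add: distrib_left distrib_right)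
qed

lemma free_algebra_simps [simp]:
  "mult (free_algebra X) = (*)" "one (free_algebra X) = 1" "zero (free_algebra X) = 0"
  "add (free_algebra X) = (+)" "smult (free_algebra X) c f = scal c * f"
  by (simp_all add: free_algebra_def)

lemma free_algebra_carrier:
  "f \<in> carrier (free_algebra X) \<longleftrightarrow> (\<forall>w \<in> Poly_Mapping.keys f. set (letters w) \<subseteq> X)"
  by (simp add: free_algebra_def)

lemma free_algebra_closed:
  assumes "f \<in> carrier (free_algebra X)" "g \<in> carrier (free_algebra X)"
  shows "f + g \<in> carrier (free_algebra X)" "f * g \<in> carrier (free_algebra X)"
    "- f \<in> carrier (free_algebra X)" "f - g \<in> carrier (free_algebra X)"
proof -
  show "f + g \<in> carrier (free_algebra X)"
    using assms Poly_Mapping.keys_add[of f g] unfolding free_algebra_carrier by blast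
  show "- f \<in> carrier (free_algebra X)"
    using assms by (simp add: free_algebra_carrier)
  show "f - g \<in> carrier (free_algebra X)"
    using assms keys_diff[of f g] unfolding free_algebra_carrier by blast
  have "set (letters w) \<subseteq> X" if w: "w \<in> Poly_Mapping.keys (f * g)" for w
  proof -
    obtain u v where "w = u + v" "u \<in> Poly_Mapping.keys f" "v \<in> Poly_Mapping.keys g"
      using w keys_mult[of f g] by blast
    then show ?thesis
      using assms by (auto simp: free_algebra_carrier plus_free_monoid_def)
  qed
  then show "f * g \<in> carrier (free_algebra X)"
    by (simp add: free_algebra_carrier)
qed

lemma scal_closed [simp]: "scal c \<in> carrier (free_algebra X)"
  by (simp add: free_algebra_carrier scal_def zero_free_monoid_def)

lemma zero_one_closed [simp]:
  "0 \<in> carrier (free_algebra X)" "1 \<in> carrier (free_algebra X)"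
  using scal_closed[of 0 X] scal_closed[of 1 X]
  by (simp_all add: scal_def Poly_Mapping.single_one)

lemma gen_closed: "x \<in> X \<Longrightarrow> gen x \<in> carrier (free_algebra X)"
  by (simp add: free_algebra_carrier gen_def)

lemma free_algebra_ring: "ring (free_algebra X)"
proof (rule ringI)
  show "abelian_group (free_algebra X)"
  proof (rule abelian_groupI)
    fix f assume f: "f \<in> carrier (free_algebra X)"
    show "\<exists>g\<in>carrier (free_algebra X). g \<oplus>\<^bsub>free_algebra X\<^esub> f = \<zero>\<^bsub>free_algebra X\<^esub>"
      using free_algebra_closed(3)[OF f f] by (intro bexI[of _ "- f"]) simp_all
  qed (simp_all add: free_algebra_closed add_ac)
  show "Group.monoid (free_algebra X)"
    by (rule monoidI) (simp_all add: free_algebra_closed mult.assoc)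
qed (simp_all add: distrib_left distrib_right)

lemma class_ring_field: "field (class_ring :: 'k::field ring)"
  by (rule class_field.field_axioms)

lemma rel_ideal_ideal:
  assumes "S \<subseteq> carrier (free_algebra X)"
  shows "ideal (rel_ideal X S) (free_algebra X)"
  unfolding rel_ideal_def using ring.genideal_ideal[OF free_algebra_ring assms] .

lemma presented_algebra_simps:
  "carrier (presented_algebra X S) = carrier (free_algebra X Quot rel_ideal X S)"
  "mult (presented_algebra X S) = mult (free_algebra X Quot rel_ideal X S)"
  "one (presented_algebra X S) = one (free_algebra X Quot rel_ideal X S)"
  "zero (presented_algebra X S) = zero (free_algebra X Quot rel_ideal X S)"
  "add (presented_algebra X S) = add (free_algebra X Quot rel_ideal X S)"
  "smult (presented_algebra X S) c C =
     (\<Union>f\<in>C. rel_ideal X S +>\<^bsub>free_algebra X\<^esub> (scal c * f))"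
  by (simp_all add: presented_algebra_def ring.defs)

lemma presented_algebra_ring:
  assumes "S \<subseteq> carrier (free_algebra X)"
  shows "ring (presented_algebra X S)"
proof -
  interpret Q: ring "free_algebra X Quot rel_ideal X S"
    by (rule ideal.quotient_is_ring[OF rel_ideal_ideal[OF assms]])
  show ?thesis
  proof (rule ringI)
    show "abelian_group (presented_algebra X S)"
    proof (rule abelian_groupI)
      fix x assume "x \<in> carrier (presented_algebra X S)"
      then show "\<exists>y\<in>carrier (presented_algebra X S).
          y \<oplus>\<^bsub>presented_algebra X S\<^esub> x = \<zero>\<^bsub>presented_algebra X S\<^esub>"
        unfolding presented_algebra_simps
        using Q.a_inv_closed Q.l_neg by blast
    qed (simp_all only: presented_algebra_simps Q.add.m_closed Q.zero_closed Q.add.m_ac Q.l_zero Q.r_zero)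
    show "Group.monoid (presented_algebra X S)"
      by (rule monoidI)
        (simp_all only: presented_algebra_simps Q.m_closed Q.one_closed Q.m_assoc Q.l_one Q.r_one)
  qed (simp_all only: presented_algebra_simps Q.l_distr Q.r_distr)
qed

lemma presented_class_surj:
  "carrier (presented_algebra X S) = presented_class X S ` carrier (free_algebra X)"
  by (auto simp: presented_algebra_simps FactRing_def A_RCOSETS_def' presented_class_def a_r_coset_def')

lemma presented_class_hom:
  assumes "S \<subseteq> carrier (free_algebra X)"
    and f: "f \<in> carrier (free_algebra X)" and g: "g \<in> carrier (free_algebra X)"
  shows "presented_class X S (f * g) =
      presented_class X S f \<otimes>\<^bsub>presented_algebra X S\<^esub> presented_class X S g"
    and "presented_class X S (f + g) =
      presented_class X S f \<oplus>\<^bsub>presented_algebra X S\<^esub> presented_class X S g"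
    and "presented_class X S (scal c * f) =
      c \<odot>\<^bsub>presented_algebra X S\<^esub> presented_class X S f"
    and "presented_class X S 1 = \<one>\<^bsub>presented_algebra X S\<^esub>"
    and "presented_class X S f = \<zero>\<^bsub>presented_algebra X S\<^esub> \<longleftrightarrow> f \<in> rel_ideal X S"
proof -
  interpret I: ideal "rel_ideal X S" "free_algebra X"
    by (rule rel_ideal_ideal[OF assms(1)])
  show "presented_class X S (f * g) =
      presented_class X S f \<otimes>\<^bsub>presented_algebra X S\<^esub> presented_class X S g"
    using I.rcoset_mult_add[OF f g]
    by (simp add: presented_class_def presented_algebra_simps FactRing_def)
  show "presented_class X S (f + g) =
      presented_class X S f \<oplus>\<^bsub>presented_algebra X S\<^esub> presented_class X S g"
    using I.a_rcos_sum[OF f g]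
    by (simp add: presented_class_def presented_algebra_simps FactRing_def)
  show "presented_class X S 1 = \<one>\<^bsub>presented_algebra X S\<^esub>"
    by (simp add: presented_class_def presented_algebra_simps FactRing_def)
  show "presented_class X S f = \<zero>\<^bsub>presented_algebra X S\<^esub> \<longleftrightarrow> f \<in> rel_ideal X S"
    using I.a_rcos_const I.a_rcos_self[OF f]
    by (auto simp: presented_class_def presented_algebra_simps FactRing_def)
  have eq: "rel_ideal X S +>\<^bsub>free_algebra X\<^esub> (scal c * h) = rel_ideal X S +>\<^bsub>free_algebra X\<^esub> (scal c * f)"
    if h: "h \<in> rel_ideal X S +>\<^bsub>free_algebra X\<^esub> f" for h
  proof -
    obtain i where i: "i \<in> rel_ideal X S" "h = i + f"
      using h by (auto simp: a_r_coset_def')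
    have ci: "scal c * i \<in> rel_ideal X S"
      using I.I_l_closed[OF i(1) scal_closed[of c X]] by simp
    have "scal c * h = scal c * i + scal c * f"
      by (simp add: i(2) distrib_left)
    then have "scal c * h \<in> rel_ideal X S +>\<^bsub>free_algebra X\<^esub> (scal c * f)"
      using ci by (auto simp: a_r_coset_def')
    then show ?thesis
      using I.a_repr_independence[OF _ _ I.a_subgroup] free_algebra_closed(2)[OF scal_closed f]
      by metis
  qed
  show "presented_class X S (scal c * f) =
      c \<odot>\<^bsub>presented_algebra X S\<^esub> presented_class X S f"
    using eq I.a_rcos_self[OF f]
    unfolding presented_class_def presented_algebra_simps by blast
qed

lemma scal_add: "scal (c + d) = scal c + (scal d :: ('g, 'k::field) free_poly)"
  by (simp add: scal_def single_add)

lemma scal_mult: "scal (c * d) = scal c * (scal d :: ('g, 'k::field) free_poly)"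
  by (simp add: scal_def mult_single)

lemma scal_one: "scal 1 = (1 :: ('g, 'k::field) free_poly)"
  by (simp add: scal_def)

lemma presented_algebra_vectorspace:
  fixes S :: "('g, 'k::field) free_poly set"
  assumes S: "S \<subseteq> carrier (free_algebra X)"
  shows "vectorspace class_ring (presented_algebra X S)"
proof -
  let ?A = "presented_algebra X S" and ?F = "free_algebra X"
  interpret A: ring ?A by (rule presented_algebra_ring[OF S])
  interpret K: field "class_ring :: 'k ring" by (rule class_ring_field)
  note hom = presented_class_hom[OF S]
  have cl: "presented_class X S f \<in> carrier ?A" if "f \<in> carrier ?F" for f
    using that by (simp add: presented_class_surj)
  have sc: "scal c * f \<in> carrier ?F" if "f \<in> carrier ?F" for c and f :: "('g, 'k) free_poly"
    using that free_algebra_closed(2)[OF scal_closed] by blast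
  have "module class_ring ?A"
  proof (rule moduleI)
    show "cring (class_ring :: 'k ring)" ..
    show "abelian_group ?A" ..
  next
    fix c :: 'k and x assume "x \<in> carrier ?A"
    then obtain f where f: "f \<in> carrier ?F" "x = presented_class X S f"
      by (auto simp: presented_class_surj)
    show "c \<odot>\<^bsub>?A\<^esub> x \<in> carrier ?A"
      using f sc[OF f(1), of c] by (simp add: hom(3)[OF f(1) f(1), symmetric] cl)
    show "\<one>\<^bsub>class_ring :: 'k ring\<^esub> \<odot>\<^bsub>?A\<^esub> x = x"
      using f by (simp add: hom(3)[OF f(1) f(1), symmetric] scal_one)
  next
    fix c d :: 'k and x assume "x \<in> carrier ?A"
    then obtain f where f: "f \<in> carrier ?F" "x = presented_class X S f"
      by (auto simp: presented_class_surj)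
    show "(c \<oplus>\<^bsub>class_ring\<^esub> d) \<odot>\<^bsub>?A\<^esub> x = c \<odot>\<^bsub>?A\<^esub> x \<oplus>\<^bsub>?A\<^esub> d \<odot>\<^bsub>?A\<^esub> x"
      using f sc[OF f(1), of c] sc[OF f(1), of d]
      by (simp add: hom(3)[OF f(1) f(1), symmetric] hom(2)[symmetric] scal_add distrib_right)
    show "(c \<otimes>\<^bsub>class_ring\<^esub> d) \<odot>\<^bsub>?A\<^esub> x = c \<odot>\<^bsub>?A\<^esub> (d \<odot>\<^bsub>?A\<^esub> x)"
      using f sc[OF f(1), of d]
      by (simp add: hom(3)[OF f(1) f(1), symmetric] hom(3)[symmetric] scal_mult mult.assoc)
  next
    fix c :: 'k and x y assume "x \<in> carrier ?A" "y \<in> carrier ?A"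
    then obtain f g where f: "f \<in> carrier ?F" "x = presented_class X S f"
      and g: "g \<in> carrier ?F" "y = presented_class X S g"
      by (auto simp: presented_class_surj)
    show "c \<odot>\<^bsub>?A\<^esub> (x \<oplus>\<^bsub>?A\<^esub> y) = c \<odot>\<^bsub>?A\<^esub> x \<oplus>\<^bsub>?A\<^esub> c \<odot>\<^bsub>?A\<^esub> y"
      using f g sc[OF f(1), of c] sc[OF g(1), of c] free_algebra_closed(1)[OF f(1) g(1)]
      by (simp add: hom(3)[symmetric] hom(2)[symmetric] distrib_left)
  qed
  then show ?thesis
    by (simp add: vectorspace_def class_ring_field)
qed

lemma hecke_rels_closed: "hecke_rels n \<subseteq> carrier (free_algebra (hecke_gens n))"
proof -
  have g: "i \<in> {1..<n} \<Longrightarrow> fR i \<in> carrier (free_algebra (hecke_gens n))"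
    "i \<in> {1..n} \<Longrightarrow> fP i \<in> carrier (free_algebra (hecke_gens n))"
    "i \<in> {1..n} \<Longrightarrow> fQ i \<in> carrier (free_algebra (hecke_gens n))" for i
    by (auto intro!: gen_closed simp: hecke_gens_def)
  show ?thesis
    unfolding hecke_rels_def
    by (auto simp: power2_eq_square
        intro!: free_algebra_closed g scal_closed zero_one_closed)
qed

theorem spin_affine_hecke_ring: "ring (spin_affine_hecke n)"
  unfolding spin_affine_hecke_def by (rule presented_algebra_ring[OF hecke_rels_closed])

theorem spin_affine_hecke_vectorspace: "vectorspace class_ring (spin_affine_hecke n)"
  unfolding spin_affine_hecke_def by (rule presented_algebra_vectorspace[OF hecke_rels_closed])

theorem spin_affine_hecke_smult_mult:
  assumes "x \<in> carrier (spin_affine_hecke n)" "y \<in> carrier (spin_affine_hecke n)"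
  shows "c \<odot>\<^bsub>spin_affine_hecke n\<^esub> (x \<otimes>\<^bsub>spin_affine_hecke n\<^esub> y)
       = (c \<odot>\<^bsub>spin_affine_hecke n\<^esub> x) \<otimes>\<^bsub>spin_affine_hecke n\<^esub> y"
    and "c \<odot>\<^bsub>spin_affine_hecke n\<^esub> (x \<otimes>\<^bsub>spin_affine_hecke n\<^esub> y)
       = x \<otimes>\<^bsub>spin_affine_hecke n\<^esub> (c \<odot>\<^bsub>spin_affine_hecke n\<^esub> y)"
proof -
  note hom = presented_class_hom[OF hecke_rels_closed[of n]]
  obtain f g where f: "f \<in> carrier (free_algebra (hecke_gens n))"
      "x = presented_class (hecke_gens n) (hecke_rels n) f"
    and g: "g \<in> carrier (free_algebra (hecke_gens n))"
      "y = presented_class (hecke_gens n) (hecke_rels n) g"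
    using assms by (auto simp: presented_class_surj spin_affine_hecke_def)
  note cl = free_algebra_closed(2)[OF scal_closed[of c] f(1)]
    free_algebra_closed(2)[OF scal_closed[of c] g(1)] free_algebra_closed(2)[OF f(1) g(1)]
  show "c \<odot>\<^bsub>spin_affine_hecke n\<^esub> (x \<otimes>\<^bsub>spin_affine_hecke n\<^esub> y)
       = (c \<odot>\<^bsub>spin_affine_hecke n\<^esub> x) \<otimes>\<^bsub>spin_affine_hecke n\<^esub> y"
    using f g cl by (simp add: spin_affine_hecke_def hom(1,3)[symmetric] mult.assoc)
  have "scal c * (f * g) = f * (scal c * g)"
    by (metis scal_comm mult.assoc)
  then show "c \<odot>\<^bsub>spin_affine_hecke n\<^esub> (x \<otimes>\<^bsub>spin_affine_hecke n\<^esub> y)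
       = x \<otimes>\<^bsub>spin_affine_hecke n\<^esub> (c \<odot>\<^bsub>spin_affine_hecke n\<^esub> y)"
    using f g cl by (simp add: spin_affine_hecke_def hom(1,3)[symmetric])
qed

end

theory Submission
  imports Defs "HOL-Combinatorics.Perm" "HOL-Library.Function_Algebras"
begin

text \<open>
  Spanning is straightening. The generators \<open>p\<^sub>i\<close>, \<open>q\<^sub>i\<close> commute with each other up to
  sign and \<open>q\<^sub>i\<^sup>2 = 1 - p\<^sub>i\<^sup>2\<close>, so words in them reduce to \<open>p\<^sup>k q\<^sup>e\<close> with \<open>e\<close> a vector of
  zeros and ones (\<open>wordsA_normal\<close>). The relations for \<open>R\<^sub>i p\<^sub>i\<close> and \<open>R\<^sub>i q\<^sub>i\<close>, together with
  the relations for \<open>R\<^sub>i p\<^sub>i\<^sub>+\<^sub>1\<close> and \<open>R\<^sub>i q\<^sub>i\<^sub>+\<^sub>1\<close> that they imply (\<open>rel_R_next\<close>), move every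
  \<open>R\<^sub>i\<close> to the right of these (\<open>R_wordsA\<close>). Words in \<open>R\<^sub>1, \<dots>, R\<^sub>m\<close> reduce by
  induction on \<open>m\<close>: the span of the \<open>w R\<^sub>m R\<^sub>m\<^sub>-\<^sub>1 \<dots> R\<^sub>m\<^sub>-\<^sub>a\<^sub>+\<^sub>1\<close>, with \<open>w\<close> a word in
  \<open>R\<^sub>1, \<dots>, R\<^sub>m\<^sub>-\<^sub>1\<close>, is stable under right multiplication by every \<open>R\<^sub>j\<close>
  (\<open>chain_mult_R\<close>), like a decomposition into cosets of the symmetric group on \<open>m\<close> letters.

  Linear independence comes from enough modules. Given distinct scalars \<open>\<lambda>\<^sub>l\<close> and \<open>\<mu>\<^sub>l\<close> with
  \<open>\<lambda>\<^sub>l\<^sup>2 + \<mu>\<^sub>l\<^sup>2 = 1\<close>, take vectors indexed by permutations (words \<open>x\<close> whose letters are all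
  different) with coefficients in the regular module of a Clifford algebra with generators
  \<open>\<kappa>\<^sub>i\<close>. On the component of \<open>x\<close>, let \<open>p\<^sub>i\<close> act by \<open>\<lambda>\<close> of the \<open>i\<close>-th letter and \<open>q\<^sub>i\<close>
  by \<open>\<mu>\<close> of the \<open>i\<close>-th letter times \<open>\<kappa>\<^sub>i\<close>. Put
  \<open>g\<^sub>i\<^sub>j = \<epsilon> (q\<^sub>i - q\<^sub>j) / (p\<^sub>i - p\<^sub>j)\<close>. If \<open>\<phi>\<^sub>i p\<^sub>j = p\<^sub>l \<phi>\<^sub>i\<close> and
  \<open>\<phi>\<^sub>i q\<^sub>j = - q\<^sub>l \<phi>\<^sub>i\<close>, where \<open>l\<close> is \<open>j\<close> with \<open>i\<close> and \<open>i + 1\<close> exchanged, then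
  \<open>R\<^sub>i = \<phi>\<^sub>i + g\<^sub>i\<^sub>,\<^sub>i\<^sub>+\<^sub>1\<close> satisfies the cross relations. The square relation prescribes
  \<open>\<phi>\<^sub>i\<^sup>2\<close>, which a suitable scalar multiple of
  \<open>\<kappa>\<^sub>i - \<kappa>\<^sub>i\<^sub>+\<^sub>1\<close> composed with the place permutation achieves. The braid relation then reduces to
  that of the \<open>\<phi>\<^sub>i\<close> and to the identity
  \<open>g\<^sub>1\<^sub>2 g\<^sub>2\<^sub>3 + g\<^sub>1\<^sub>3 g\<^sub>1\<^sub>2 + g\<^sub>2\<^sub>3 g\<^sub>1\<^sub>3 = - \<epsilon>\<^sup>2\<close>, an instance of Lagrange interpolation
  (\<open>gg_triple\<close>, \<open>braid_from_intertwiners\<close>).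

  Apply a linear relation between the monomials to a vector at the identity word. Each \<open>R\<^sub>i\<close>
  either swaps two neighbouring places or leaves the word alone. So the component at the word
  obtained by always swapping, for the lexicographically largest exponent \<open>a\<close> of the relation,
  comes from that \<open>a\<close> alone (\<open>tail_triangular\<close>); the different \<open>q\<^sup>e\<close> are told apart by the
  Clifford basis (\<open>act_Q_prod\<close>). What remains is a polynomial in the \<open>\<lambda>\<^sub>l\<close>. It vanishes for
  all powers \<open>\<lambda>\<^sub>l = t\<^bsup>E\<^esup>\<close> of natural numbers \<open>t \<ge> 2\<close> with exponents \<open>E\<close> that are powers of a
  large base, hence is zero by Kronecker substitution (\<open>pbw_independent\<close>).
\<close>

section \<open>Evaluating noncommutative polynomials\<close>

text \<open>
  The argument \<open>sc\<close> stands for the structure map of an algebra over the field and \<open>G\<close> for the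
  images of the generators.
\<close>

definition free_eval ::
  "('k::field \<Rightarrow> 'r::{ring, monoid_mult}) \<Rightarrow> ('g \<Rightarrow> 'r) \<Rightarrow> ('g, 'k) free_poly \<Rightarrow> 'r" where
  "free_eval sc G f =
     (\<Sum>w\<in>Poly_Mapping.keys f. sc (Poly_Mapping.lookup f w) * prod_list (map G (letters w)))"

lemma free_poly_sum_single:
  "f = (\<Sum>w\<in>Poly_Mapping.keys f. Poly_Mapping.single w (Poly_Mapping.lookup f w))"
  for f :: "('g, 'k::field) free_poly"
  by (rule poly_mapping_eqI)
    (auto simp: lookup_sum lookup_single when_def in_keys_iff)

locale algebra_point =
  fixes sc :: "'k::field \<Rightarrow> 'r::{ring, monoid_mult}" and G :: "'g \<Rightarrow> 'r"
  assumes sc_add: "sc (c + d) = sc c + sc d"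
    and sc_mult: "sc (c * d) = sc c * sc d"
    and sc_one: "sc 1 = 1"
    and sc_central: "sc c * G x = G x * sc c"
begin

lemma sc_zero: "sc 0 = 0"
  using sc_add[of 0 0] by simp

lemma sc_word: "prod_list (map G xs) * sc c = sc c * prod_list (map G xs)"
proof (induction xs)
  case (Cons x xs)
  then show ?case by (metis list.simps(9) prod_list.Cons mult.assoc sc_central)
qed simp

lemma free_eval_single:
  "free_eval sc G (Poly_Mapping.single w c) = sc c * prod_list (map G (letters w))"
  by (cases "c = 0") (simp_all add: free_eval_def sc_zero)

lemma free_eval_add: "free_eval sc G (f + g) = free_eval sc G f + free_eval sc G g"
proof -
  let ?t = "\<lambda>h w. sc (Poly_Mapping.lookup h w) * prod_list (map G (letters w))"
  let ?K = "Poly_Mapping.keys f \<union> Poly_Mapping.keys g"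
  have ext: "free_eval sc G h = sum (?t h) ?K" if "Poly_Mapping.keys h \<subseteq> ?K" for h
    unfolding free_eval_def using that
    by (intro sum.mono_neutral_left) (auto simp: in_keys_iff sc_zero)
  show ?thesis
    using Poly_Mapping.keys_add[of f g]
    by (simp add: ext lookup_add sc_add distrib_right sum.distrib)
qed

lemma free_eval_zero: "free_eval sc G 0 = 0"
  by (simp add: free_eval_def)

lemma free_eval_uminus: "free_eval sc G (- f) = - free_eval sc G f"
  using free_eval_add[of f "- f"] by (simp add: free_eval_zero eq_neg_iff_add_eq_0 add.commute)

lemma free_eval_diff: "free_eval sc G (f - g) = free_eval sc G f - free_eval sc G g"
  using free_eval_add[of f "- g"] by (simp add: free_eval_uminus)

lemma free_eval_sum: "free_eval sc G (sum h A) = (\<Sum>x\<in>A. free_eval sc G (h x))"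
  by (induction A rule: infinite_finite_induct) (simp_all add: free_eval_zero free_eval_add)

lemma free_eval_mult: "free_eval sc G (f * g) = free_eval sc G f * free_eval sc G g"
proof -
  have single: "free_eval sc G (Poly_Mapping.single u c * Poly_Mapping.single v d) =
      free_eval sc G (Poly_Mapping.single u c) * free_eval sc G (Poly_Mapping.single v d)" for u v c d
  proof -
    have "sc (c * d) * (prod_list (map G (letters u)) * prod_list (map G (letters v))) =
        sc c * (prod_list (map G (letters u)) * sc d) * prod_list (map G (letters v))"
      by (simp only: sc_word sc_mult mult.assoc)
    then show ?thesis
      by (simp add: mult_single free_eval_single plus_free_monoid_def mult.assoc)
  qed
  show ?thesis
    by (subst (1 2) free_poly_sum_single[of f], subst (1 2) free_poly_sum_single[of g])
      (simp only: sum_product free_eval_sum single)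
qed

lemma free_eval_gen: "free_eval sc G (gen x) = G x"
  by (simp add: gen_def free_eval_single sc_one)

lemma free_eval_scal: "free_eval sc G (scal c) = sc c"
  by (simp add: scal_def free_eval_single zero_free_monoid_def)

lemma free_eval_one: "free_eval sc G 1 = 1"
  using free_eval_scal[of 1] by (simp add: scal_one sc_one)

lemma free_eval_power: "free_eval sc G (f ^ k) = free_eval sc G f ^ k"
  by (induction k) (simp_all add: free_eval_one free_eval_mult)

lemma free_eval_prod_list: "free_eval sc G (prod_list fs) = prod_list (map (free_eval sc G) fs)"
  by (induction fs) (simp_all add: free_eval_one free_eval_mult)

lemmas free_eval_simps =
  free_eval_add free_eval_uminus free_eval_diff free_eval_mult free_eval_gen free_eval_scal
  free_eval_one free_eval_zero free_eval_power

text \<open>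
  The universal property of the presented algebra: the polynomials that evaluate to zero form a
  two-sided ideal, and the ideal of relations is the smallest one that contains the relations.
\<close>

lemma free_eval_rel_ideal:
  assumes rels: "\<And>r. r \<in> S \<Longrightarrow> free_eval sc G r = 0"
    and S: "S \<subseteq> carrier (free_algebra X)" and f: "f \<in> rel_ideal X S"
  shows "free_eval sc G f = 0"
proof -
  let ?F = "free_algebra X :: ('k, ('g, 'k) free_poly) module"
  let ?J = "{f \<in> carrier ?F. free_eval sc G f = 0}"
  interpret F: ring ?F by (rule free_algebra_ring)
  have minus: "\<ominus>\<^bsub>?F\<^esub> f = - f" if "f \<in> carrier ?F" for f
    using that free_algebra_closed(3)[OF that that] by (intro F.minus_equality) simp_all
  have "ideal ?J ?F"
  proof (rule idealI)
    show "subgroup ?J (add_monoid ?F)"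
    proof (rule F.add.subgroupI)
      show "?J \<noteq> {}"
        using free_eval_zero by (auto intro: exI[of _ 0])
    qed (auto simp: minus free_algebra_closed free_eval_simps a_inv_def[symmetric])
  qed (auto simp: free_algebra_closed free_eval_simps F.ring_axioms)
  then have "Idl\<^bsub>?F\<^esub> S \<subseteq> ?J"
    by (rule F.genideal_minimal) (use rels S in auto)
  then show ?thesis
    using f unfolding rel_ideal_def by auto
qed

end

section \<open>Endomorphism rings\<close>

text \<open>
  As a type with ring structure, the additive endomorphisms allow the relations between
  operators to be checked by equational reasoning in a noncommutative ring.
\<close>

typedef (overloaded) 'a endo = "{f :: 'a::ab_group_add \<Rightarrow> 'a. \<forall>x y. f (x + y) = f x + f y}"
  morphisms act Endo
  by (rule exI[of _ "\<lambda>x. x"]) simp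

setup_lifting type_definition_endo

lemma endo_eqI: "(\<And>x. act S x = act T x) \<Longrightarrow> S = T"
  by (metis act_inject ext)

instantiation endo :: (ab_group_add) "{ring, monoid_mult}"
begin

lift_definition zero_endo :: "'a endo" is "\<lambda>x. 0" by simp
lift_definition one_endo :: "'a endo" is "\<lambda>x. x" by simp
lift_definition plus_endo :: "'a endo \<Rightarrow> 'a endo \<Rightarrow> 'a endo" is "\<lambda>f g x. f x + g x"
  by (simp add: algebra_simps)
lift_definition uminus_endo :: "'a endo \<Rightarrow> 'a endo" is "\<lambda>f x. - f x"
  by (simp add: algebra_simps)
lift_definition minus_endo :: "'a endo \<Rightarrow> 'a endo \<Rightarrow> 'a endo" is "\<lambda>f g x. f x - g x"
  by (simp add: algebra_simps)
lift_definition times_endo :: "'a endo \<Rightarrow> 'a endo \<Rightarrow> 'a endo" is "\<lambda>f g x. f (g x)"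
  by simp

instance
  by standard (transfer; simp add: fun_eq_iff algebra_simps)+

end

lemmas act_simps =
  zero_endo.rep_eq one_endo.rep_eq plus_endo.rep_eq uminus_endo.rep_eq minus_endo.rep_eq
  times_endo.rep_eq

text \<open>
  Characteristic zero is what makes \<open>2\<close> invertible in the coefficient field and provides
  infinitely many evaluation points.
\<close>

instance fract :: ("{idom, ring_char_0}") ring_char_0
  by standard (auto intro!: injI simp: of_nat_fract eq_fract)

instance fract :: ("{idom, ring_char_0}") field_char_0 ..

section \<open>Words with Clifford coefficients\<close>

text \<open>
  A vector assigns to every permutation \<open>x\<close>, read as the word of letters \<open>x 1, x 2, \<dots>\<close>, an
  element of the regular Clifford module, whose standard basis is indexed by finite sets of
  naturals. Arbitrary functions are allowed, so that operators can be defined pointwise.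
\<close>

type_synonym spin_vec = "nat perm \<Rightarrow> nat set \<Rightarrow> cq"

unbundle permutation_syntax

abbreviation adj :: "nat \<Rightarrow> nat perm" where "adj i \<equiv> \<langle>i \<leftrightarrow> Suc i\<rangle>"

definition diag :: "(nat perm \<Rightarrow> cq) \<Rightarrow> spin_vec endo" where
  "diag h = Endo (\<lambda>v x S. h x * v x S)"

text \<open>
  Left multiplication by the \<open>i\<close>-th Clifford generator in the regular module: it toggles \<open>i\<close> in
  the index set, and the sign counts the generators that it has to pass (the Jordan-Wigner
  form).
\<close>

definition kap_fun :: "nat \<Rightarrow> (nat set \<Rightarrow> cq) \<Rightarrow> nat set \<Rightarrow> cq" where
  "kap_fun i F S = (- 1) ^ card {j \<in> S. j < i} * F (sym_diff S {i})"

definition kap :: "nat \<Rightarrow> spin_vec endo" where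
  "kap i = Endo (\<lambda>v x. kap_fun i (v x))"

definition move :: "nat \<Rightarrow> spin_vec endo" where
  "move i = Endo (\<lambda>v x. v (x * adj i))"

lemma act_diag: "act (diag h) v x S = h x * v x S"
  unfolding diag_def by (subst Endo_inverse) (auto simp: fun_eq_iff algebra_simps)

lemma act_kap: "act (kap i) v x = kap_fun i (v x)"
  unfolding kap_def kap_fun_def by (subst Endo_inverse) (auto simp: fun_eq_iff algebra_simps)

lemma act_move: "act (move i) v x = v (x * adj i)"
  unfolding move_def by (subst Endo_inverse) (auto simp: fun_eq_iff algebra_simps)

lemma spin_endo_eqI:
  "(\<And>v x S. act A v x S = act B v x S) \<Longrightarrow> A = B" for A B :: "spin_vec endo"
  by (rule endo_eqI) (simp add: fun_eq_iff)

lemma diag_mult: "diag h * diag k = diag (\<lambda>x. h x * k x)"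
  by (rule spin_endo_eqI) (simp add: act_simps act_diag)

lemma diag_comm: "diag h * diag k = diag k * diag h"
  by (simp add: diag_mult mult.commute)

lemma diag_add: "diag h + diag k = diag (\<lambda>x. h x + k x)"
  by (rule spin_endo_eqI) (simp add: act_simps act_diag algebra_simps)

lemma diag_uminus: "- diag h = diag (\<lambda>x. - h x)"
  by (rule spin_endo_eqI) (simp add: act_simps act_diag)

lemma diag_diff: "diag h - diag k = diag (\<lambda>x. h x - k x)"
  by (rule spin_endo_eqI) (simp add: act_simps act_diag algebra_simps)

lemma diag_one: "diag (\<lambda>x. 1) = 1"
  by (rule spin_endo_eqI) (simp add: act_simps act_diag)

lemma diag_zero: "diag (\<lambda>x. 0) = 0"
  by (rule spin_endo_eqI) (simp add: act_simps act_diag)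

lemma kap_fun_sq: "kap_fun i (kap_fun i F) = F"
proof
  fix S
  have e: "{j \<in> sym_diff S {i}. j < i} = {j \<in> S. j < i}" by auto
  have "sym_diff (sym_diff S {i}) {i} = S" by auto
  then show "kap_fun i (kap_fun i F) S = F S"
    unfolding kap_fun_def e by (simp flip: mult.assoc power_add)
qed

lemma kap_fun_anti:
  assumes "i < j"
  shows "kap_fun i (kap_fun j F) S = - kap_fun j (kap_fun i F) S"
proof -
  let ?c = "\<lambda>S k. card {l \<in> S. l < k}"
  have e1: "?c (sym_diff S {j}) i = ?c S i"
    using assms by (intro arg_cong[where f = card]) auto
  have e2: "(- 1) ^ ?c (sym_diff S {i}) j = - ((- 1) ^ ?c S j :: cq)"
  proof (cases "i \<in> S")
    case True
    have "{l \<in> S. l < j} = insert i {l \<in> sym_diff S {i}. l < j}" "i \<notin> {l \<in> sym_diff S {i}. l < j}"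
      using True assms by auto
    then show ?thesis by simp
  next
    case False
    have "{l \<in> sym_diff S {i}. l < j} = insert i {l \<in> S. l < j}" "i \<notin> {l \<in> S. l < j}"
      using False assms by auto
    then show ?thesis by simp
  qed
  have e3: "sym_diff (sym_diff S {i}) {j} = sym_diff (sym_diff S {j}) {i}" by auto
  show ?thesis
    unfolding kap_fun_def e1 e2 e3 by (simp add: mult.left_commute)
qed

lemma kap_sq: "kap i * kap i = 1"
  by (rule spin_endo_eqI) (simp add: act_simps act_kap kap_fun_sq)

lemma kap_anti: "i \<noteq> j \<Longrightarrow> kap i * kap j = - (kap j * kap i)"
  by (rule spin_endo_eqI, cases "i < j") (simp_all add: act_simps act_kap kap_fun_anti)

lemma kap_diag: "kap i * diag h = diag h * kap i"
  by (rule spin_endo_eqI) (simp add: act_simps act_kap act_diag kap_fun_def mult.left_commute)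

lemma move_diag: "move i * diag h = diag (\<lambda>x. h (x * adj i)) * move i"
  by (rule spin_endo_eqI) (simp add: act_simps act_move act_diag)

lemma move_kap: "move i * kap j = kap j * move i"
  by (rule spin_endo_eqI) (simp add: act_simps act_move act_kap)

lemma adj_cancel: "x * adj i * adj i = x"
  by (simp add: mult.assoc)

lemma move_sq: "move i * move i = 1"
  by (rule spin_endo_eqI) (simp add: act_simps act_move adj_cancel)

lemma adj_apply: "adj i \<langle>$\<rangle> j = (if j = i then Suc i else if j = Suc i then i else j)"
  by simp

lemma adj_far: "Suc i < j \<Longrightarrow> adj i * adj j = adj j * adj i"
  by (rule perm_eqI) (simp add: apply_times adj_apply)

lemma adj_braid: "adj i * adj (Suc i) * adj i = adj (Suc i) * adj i * adj (Suc i)"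
  by (rule perm_eqI) (simp add: apply_times adj_apply)

lemma move_far: "Suc i < j \<Longrightarrow> move i * move j = move j * move i"
  using arg_cong[OF adj_far, of i j "\<lambda>y. v (x * y)" for x and v :: spin_vec]
  by (intro spin_endo_eqI) (simp add: act_simps act_move mult.assoc)

lemma move_braid: "move i * move (Suc i) * move i = move (Suc i) * move i * move (Suc i)"
  by (rule spin_endo_eqI) (simp add: act_simps act_move mult.assoc adj_braid[simplified mult.assoc])

section \<open>The principal series\<close>

text \<open>
  Conjugation by \<open>\<kappa>\<^sub>i - \<kappa>\<^sub>i\<^sub>+\<^sub>1\<close> exchanges \<open>\<kappa>\<^sub>i\<close> and \<open>\<kappa>\<^sub>i\<^sub>+\<^sub>1\<close> and changes the sign of all
  Clifford generators. Up to scaling, these elements generate a double cover of the symmetric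
  group.
\<close>

definition clif :: "nat \<Rightarrow> spin_vec endo" where
  "clif i = kap i - kap (Suc i)"

abbreviation lett :: "nat perm \<Rightarrow> nat \<Rightarrow> nat" where "lett x i \<equiv> x \<langle>$\<rangle> i"

definition pp :: "(nat \<Rightarrow> cq) \<Rightarrow> nat \<Rightarrow> spin_vec endo" where
  "pp lam i = diag (\<lambda>x. lam (lett x i))"

definition qq :: "(nat \<Rightarrow> cq) \<Rightarrow> nat \<Rightarrow> spin_vec endo" where
  "qq mu i = diag (\<lambda>x. mu (lett x i)) * kap i"

lemma clif_kap: "clif i * kap j = - (kap (adj i \<langle>$\<rangle> j) * clif i)"
proof -
  consider "j = i" | "j = Suc i" | "j \<noteq> i" "j \<noteq> Suc i" by blast
  then show ?thesis
  proof cases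
    case 1
    then show ?thesis by (simp add: clif_def algebra_simps kap_sq)
  next
    case 2
    then show ?thesis by (simp add: clif_def algebra_simps kap_sq)
  next
    case 3
    then show ?thesis by (simp add: clif_def algebra_simps kap_anti[of i j] kap_anti[of "Suc i" j])
  qed
qed

lemma clif_diag: "clif i * diag h = diag h * clif i"
  by (simp add: clif_def algebra_simps kap_diag)

lemma clif_move: "move j * clif i = clif i * move j"
  by (simp add: clif_def algebra_simps move_kap)

lemma clif_sq: "clif i * clif i = diag (\<lambda>_. 2)"
proof -
  have "clif i * clif i = 1 + 1"
    by (simp add: clif_def algebra_simps kap_sq kap_anti[of "Suc i" i])
  also have "\<dots> = diag (\<lambda>_. 2)"
    by (simp add: diag_add flip: diag_one)
  finally show ?thesis .
qed

lemma clif_far: "Suc i < j \<Longrightarrow> clif i * clif j = - (clif j * clif i)"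
  by (simp add: clif_def algebra_simps kap_anti[of i j] kap_anti[of "Suc i" j]
      kap_anti[of i "Suc j"] kap_anti[of "Suc i" "Suc j"])

lemma clif_braid: "clif i * clif (Suc i) * clif i = clif (Suc i) * clif i * clif (Suc i)"
proof -
  let ?a = "kap i" and ?b = "kap (Suc i)" and ?c = "kap (Suc (Suc i))"
  have 1: "x * kap j * kap j = x" for x j
    by (simp add: mult.assoc kap_sq)
  have 2: "?b * ?a = - (?a * ?b)" "?c * ?a = - (?a * ?c)" "?c * ?b = - (?b * ?c)"
    by (rule kap_anti, simp)+
  have 3: "x * ?b * ?a = - (x * ?a * ?b)" "x * ?c * ?a = - (x * ?a * ?c)" "x * ?c * ?b = - (x * ?b * ?c)" for x
    by (simp_all add: mult.assoc 2)
  show ?thesis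
    unfolding clif_def
    by (simp add: left_diff_distrib right_diff_distrib distrib_left distrib_right kap_sq 1 2 3 flip: mult.assoc)
qed

text \<open>
  Collects the coefficients of \<open>a b\<close>, \<open>a c\<close> and \<open>b c\<close> in the sum of
  products met in \<open>gg_triple\<close>: all three share the factor \<open>A - B - C\<close> up to sign.
\<close>

lemma anticommuting_triple:
  fixes a b c :: "'r::ring"
  assumes "b * a = - (a * b)" "c * a = - (a * c)" "c * b = - (b * c)"
  shows "A * ((a - b) * (b - c)) + B * ((a - c) * (a - b)) + C * ((b - c) * (a - c)) =
    (A - B - C) * (a * b - a * c + b * c) + (B * (a * a) - A * (b * b) + C * (c * c))"
  using assms by (simp add: algebra_simps)

text \<open>
  The last assumption says that the square prescribed for the intertwiners does not vanish, so
  that they are invertible.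
\<close>

locale principal_series =
  fixes lam mu :: "nat \<Rightarrow> cq"
  assumes lam_inj: "inj lam"
    and circle: "lam l ^ 2 + mu l ^ 2 = 1"
    and generic: "l \<noteq> m \<Longrightarrow> (lam l - lam m) ^ 2 \<noteq> eps ^ 2 * (lam l * lam m - 1)"
begin

abbreviation P where "P \<equiv> pp lam"
abbreviation Q where "Q \<equiv> qq mu"

text \<open>
  The value of \<open>\<phi>\<^sub>i\<^sup>2\<close> that \<open>R\<^sub>i\<^sup>2 = - \<epsilon>\<^sup>2 - 2\<close> demands at a word with letters \<open>l\<close>, \<open>m\<close> at the places
  \<open>i\<close>, \<open>i + 1\<close>: the operators \<open>\<phi>\<^sub>i\<close> and \<open>g\<^sub>i\<^sub>,\<^sub>i\<^sub>+\<^sub>1\<close> anticommute, so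
  \<open>\<phi>\<^sub>i\<^sup>2 = R\<^sub>i\<^sup>2 - g\<^sub>i\<^sub>,\<^sub>i\<^sub>+\<^sub>1\<^sup>2\<close>.
\<close>

definition phi_square :: "nat \<Rightarrow> nat \<Rightarrow> cq" where
  "phi_square l m = - (eps ^ 2) - 2 - (eps ^ 2) * (mu l ^ 2 + mu m ^ 2) / (lam l - lam m) ^ 2"

text \<open>
  Only the product of the coefficients for \<open>(l, m)\<close> and \<open>(m, l)\<close> is prescribed. Putting the whole
  factor on one of the two orders avoids square roots; the \<open>2\<close> is the square of
  \<open>\<kappa>\<^sub>i - \<kappa>\<^sub>i\<^sub>+\<^sub>1\<close>.
\<close>

definition phi_coeff :: "nat \<Rightarrow> nat \<Rightarrow> cq" where
  "phi_coeff l m = (if l < m then phi_square l m / 2 else 1)"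

definition gg :: "nat \<Rightarrow> nat \<Rightarrow> spin_vec endo" where
  "gg i j = diag (\<lambda>x. eps / (lam (lett x i) - lam (lett x j))) * (Q i - Q j)"

definition phi :: "nat \<Rightarrow> spin_vec endo" where
  "phi i = diag (\<lambda>x. phi_coeff (lett x i) (lett x (Suc i))) * clif i * move i"

definition RR :: "nat \<Rightarrow> spin_vec endo" where
  "RR i = phi i + gg i (Suc i)"

lemma lam_neq: "l \<noteq> m \<Longrightarrow> lam l \<noteq> lam m"
  using lam_inj by (auto dest: injD)

lemma lett_neq: "i \<noteq> j \<Longrightarrow> lett x i \<noteq> lett x j"
  by (simp add: apply_inj)

lemma lam_lett_neq: "i \<noteq> j \<Longrightarrow> lam (lett x i) \<noteq> lam (lett x j)"
  by (simp add: lam_neq lett_neq)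

lemma phi_square_sym: "phi_square l m = phi_square m l"
  by (simp add: phi_square_def power2_commute[of "lam l"] add.commute)

text \<open>
  Multiplied by \<open>(\<lambda>\<^sub>l - \<lambda>\<^sub>m)\<^sup>2\<close>, the value is twice the difference of the two sides of the
  genericity assumption.
\<close>

lemma phi_square_nonzero: assumes "l \<noteq> m" shows "phi_square l m \<noteq> 0"
proof
  assume 0: "phi_square l m = 0"
  have d: "(lam l - lam m) ^ 2 \<noteq> 0" using lam_neq[OF assms] by simp
  have m: "mu l ^ 2 = 1 - lam l ^ 2" "mu m ^ 2 = 1 - lam m ^ 2"
    using circle[of l] circle[of m] by (simp_all add: eq_diff_eq add.commute)
  have "phi_square l m * (lam l - lam m) ^ 2 = 2 * (eps ^ 2 * (lam l * lam m - 1) - (lam l - lam m) ^ 2)"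
    using d unfolding phi_square_def m
    by (simp add: left_diff_distrib power2_eq_square) (simp add: algebra_simps)
  then have "(lam l - lam m) ^ 2 = eps ^ 2 * (lam l * lam m - 1)"
    using 0 by simp
  then show False using generic[OF assms] by simp
qed

lemma phi_coeff_mult: "l \<noteq> m \<Longrightarrow> 2 * (phi_coeff l m * phi_coeff m l) = phi_square l m"
  by (auto simp: phi_coeff_def phi_square_sym[of m l])

lemma phi_coeff_nonzero: "l \<noteq> m \<Longrightarrow> phi_coeff l m \<noteq> 0"
  using phi_square_nonzero[of l m] by (simp add: phi_coeff_def)

lemma P_comm: "P i * P j = P j * P i"
  by (simp add: pp_def diag_mult mult.commute)

lemma Q_diag: "Q i * diag h = diag h * Q i"
  by (metis (no_types) qq_def diag_comm kap_diag mult.assoc)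

lemma Q_mult: "Q i * Q j = diag (\<lambda>x. mu (lett x i) * mu (lett x j)) * (kap i * kap j)"
  unfolding qq_def by (metis (no_types) diag_mult kap_diag mult.assoc)

lemma Q_sq: "Q i * Q i = diag (\<lambda>x. mu (lett x i) ^ 2)"
  by (simp add: Q_mult kap_sq power2_eq_square)

lemma Q_anti: "i \<noteq> j \<Longrightarrow> Q i * Q j = - (Q j * Q i)"
  by (simp add: Q_mult kap_anti[of i j] mult.commute)

lemma PQ_circle: "P i * P i + Q i * Q i = 1"
  using circle by (simp add: Q_sq pp_def diag_mult diag_add power2_eq_square flip: diag_one)

lemma gg_diag: "gg i j * diag h = diag h * gg i j"
  by (metis (no_types, lifting) gg_def diag_comm Q_diag left_diff_distrib right_diff_distrib mult.assoc)

lemma gg_Q_far: assumes "l \<noteq> i" "l \<noteq> j" shows "gg i j * Q l = - (Q l * gg i j)"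
proof -
  have "gg i j * Q l = diag (\<lambda>x. eps / (lam (lett x i) - lam (lett x j))) * ((Q i - Q j) * Q l)"
    by (simp add: gg_def mult.assoc)
  also have "(Q i - Q j) * Q l = - (Q l * (Q i - Q j))"
    using assms by (simp add: algebra_simps Q_anti[of i l] Q_anti[of j l])
  finally show ?thesis
    by (simp add: gg_def flip: mult.assoc Q_diag)
qed

text \<open>
  This is the inhomogeneous part of the relation for \<open>R\<^sub>i q\<^sub>i\<close>: after cancellation of \<open>q\<^sub>j q\<^sub>i\<close> the
  numerator \<open>q\<^sub>i\<^sup>2 - q\<^sub>j\<^sup>2 = p\<^sub>j\<^sup>2 - p\<^sub>i\<^sup>2\<close> is divisible by \<open>p\<^sub>i - p\<^sub>j\<close>.
\<close>

lemma gg_Q_near: assumes "i \<noteq> j"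
  shows "gg i j * Q i + Q j * gg i j = - (diag (\<lambda>_. eps) * (P i + P j))"
proof -
  let ?D = "diag (\<lambda>x. eps / (lam (lett x i) - lam (lett x j)))"
  have "gg i j * Q i + Q j * gg i j = ?D * ((Q i - Q j) * Q i + Q j * (Q i - Q j))"
    by (simp add: gg_def distrib_left mult.assoc) (simp add: Q_diag flip: mult.assoc)
  also have "(Q i - Q j) * Q i + Q j * (Q i - Q j) = Q i * Q i - Q j * Q j"
    by (simp add: algebra_simps)
  also have "?D * \<dots> = - (diag (\<lambda>_. eps) * (P i + P j))"
  proof -
    have "eps / (lam (lett x i) - lam (lett x j)) * (mu (lett x i) ^ 2 - mu (lett x j) ^ 2) =
       - (eps * (lam (lett x i) + lam (lett x j)))" for x
    proof -
      have m: "mu (lett x i) ^ 2 = 1 - lam (lett x i) ^ 2" "mu (lett x j) ^ 2 = 1 - lam (lett x j) ^ 2"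
        using circle[of "lett x i"] circle[of "lett x j"] by (simp_all add: eq_diff_eq add.commute)
      show ?thesis unfolding m
        using lam_lett_neq[OF assms, of x] by (simp add: divide_simps) (simp add: power2_eq_square algebra_simps)
    qed
    then show ?thesis
      by (simp add: Q_sq diag_diff diag_mult diag_uminus diag_add pp_def)
  qed
  finally show ?thesis .
qed

lemma gg_sq: assumes "i \<noteq> j"
  shows "gg i j * gg i j =
    diag (\<lambda>x. eps ^ 2 * (mu (lett x i) ^ 2 + mu (lett x j) ^ 2) / (lam (lett x i) - lam (lett x j)) ^ 2)"
proof -
  let ?D = "diag (\<lambda>x. eps / (lam (lett x i) - lam (lett x j)))"
  have "gg i j * gg i j = ?D * ?D * ((Q i - Q j) * (Q i - Q j))"
    using gg_diag[of i j] unfolding gg_def by (metis (no_types, lifting) mult.assoc)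
  also have "(Q i - Q j) * (Q i - Q j) = Q i * Q i + Q j * Q j"
    using assms by (simp add: algebra_simps Q_anti[of i j])
  finally show ?thesis
    by (simp add: Q_sq diag_mult diag_add power2_eq_square)
qed

lemma gg_far: assumes "i \<noteq> k" "i \<noteq> l" "j \<noteq> k" "j \<noteq> l"
  shows "gg i j * gg k l = - (gg k l * gg i j)"
proof -
  let ?D = "diag (\<lambda>x. eps / (lam (lett x k) - lam (lett x l)))"
  have "gg i j * (Q k - Q l) = - ((Q k - Q l) * gg i j)"
    using assms by (simp add: left_diff_distrib right_diff_distrib gg_Q_far)
  then have "gg i j * (?D * (Q k - Q l)) = - (?D * (Q k - Q l) * gg i j)"
    by (metis (no_types, lifting) gg_diag mult.assoc mult_minus_right)
  then show ?thesis by (simp add: gg_def[of k l])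
qed

text \<open>
  The mixed products of the \<open>q\<close>'s cancel by the partial fraction identity for
  \<open>1 / ((\<lambda>\<^sub>i - \<lambda>\<^sub>j) (\<lambda>\<^sub>j - \<lambda>\<^sub>k))\<close>. The squares \<open>q\<^sup>2 = 1 - p\<^sup>2\<close> leave the second divided
  difference of \<open>1 - \<lambda>\<^sup>2\<close> at three points, which is \<open>-1\<close>.
\<close>

lemma gg_triple:
  assumes "i \<noteq> j" "j \<noteq> k" "i \<noteq> k"
  shows "gg i j * gg j k + gg i k * gg i j + gg j k * gg i k = diag (\<lambda>_. - (eps ^ 2))"
proof -
  let ?d = "\<lambda>i j x. eps / (lam (lett x i) - lam (lett x j))"
  let ?D = "\<lambda>i j. diag (?d i j)"
  have prod: "gg a b * gg c d = ?D a b * ?D c d * ((Q a - Q b) * (Q c - Q d))" for a b c d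
    unfolding gg_def by (metis (no_types, lifting) Q_diag diag_comm mult.assoc left_diff_distrib right_diff_distrib)
  let ?A = "?D i j * ?D j k" and ?B = "?D i k * ?D i j" and ?C = "?D j k * ?D i k"
  have abc: "?A - ?B - ?C = 0"
  proof -
    have "?d i j x * ?d j k x - ?d i k x * ?d i j x - ?d j k x * ?d i k x = 0" for x
      using lam_lett_neq[OF assms(1), of x] lam_lett_neq[OF assms(2), of x] lam_lett_neq[OF assms(3), of x]
      by (simp add: divide_simps) (simp add: algebra_simps)
    then show ?thesis
      by (simp add: diag_mult diag_diff diag_zero)
  qed
  have anti: "Q j * Q i = - (Q i * Q j)" "Q k * Q i = - (Q i * Q k)" "Q k * Q j = - (Q j * Q k)"
    using assms Q_anti by metis+
  have "gg i j * gg j k + gg i k * gg i j + gg j k * gg i k =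
      ?A * ((Q i - Q j) * (Q j - Q k)) + ?B * ((Q i - Q k) * (Q i - Q j)) + ?C * ((Q j - Q k) * (Q i - Q k))"
    by (simp only: prod)
  also have "\<dots> = (?A - ?B - ?C) * (Q i * Q j - Q i * Q k + Q j * Q k)
      + (?B * (Q i * Q i) - ?A * (Q j * Q j) + ?C * (Q k * Q k))"
    by (rule anticommuting_triple[OF anti])
  also have "\<dots> = ?B * (Q i * Q i) - ?A * (Q j * Q j) + ?C * (Q k * Q k)"
    by (simp add: abc)
  also have "\<dots> = diag (\<lambda>_. - (eps ^ 2))"
  proof -
    have "?d i k x * ?d i j x * mu (lett x i) ^ 2 - ?d i j x * ?d j k x * mu (lett x j) ^ 2
        + ?d j k x * ?d i k x * mu (lett x k) ^ 2 = - (eps ^ 2)" for x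
    proof -
      have m: "mu (lett x a) ^ 2 = 1 - lam (lett x a) ^ 2" for a
        using circle[of "lett x a"] by (simp add: eq_diff_eq add.commute)
      show ?thesis unfolding m
        using lam_lett_neq[OF assms(1), of x] lam_lett_neq[OF assms(2), of x] lam_lett_neq[OF assms(3), of x]
        by (simp add: divide_simps) (simp add: power2_eq_square algebra_simps)
    qed
    then show ?thesis
      by (simp add: Q_sq diag_mult diag_diff diag_add)
  qed
  finally show ?thesis .
qed

end

section \<open>Intertwiners and the braid relation\<close>

text \<open>
  Here \<open>f\<close>, \<open>h\<close> are the intertwiners \<open>\<phi>\<^sub>1\<close>, \<open>\<phi>\<^sub>2\<close> and \<open>a\<close>, \<open>b\<close>, \<open>c\<close> are
  \<open>g\<^sub>1\<^sub>2\<close>, \<open>g\<^sub>2\<^sub>3\<close>, \<open>g\<^sub>1\<^sub>3\<close>. Expanding both sides and moving intertwiners to the right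
  sorts the terms by their part in \<open>f\<close>, \<open>h\<close>. The terms with two different intertwiners
  cancel, and the linear ones are the three-term identity times \<open>f\<close> or \<open>h\<close>. The terms with a
  square of an intertwiner become constant by \<open>f f = H - a a\<close> and \<open>h h = H - b b\<close>; together
  with \<open>a b a - b a b\<close> they follow from the three-term identity multiplied by \<open>a\<close> and \<open>b\<close>.
\<close>

lemma braid_from_intertwiners:
  fixes f h a b c H E :: "'r::ring"
  assumes fa: "f * a = - (a * f)" and fb: "f * b = - (c * f)" and fc: "f * c = - (b * f)"
    and ha: "h * a = - (c * h)" and hb: "h * b = - (b * h)"
    and fhf: "f * h * f = h * f * h"
    and ff: "f * f = H - a * a" and hh: "h * h = H - b * b"
    and tri: "a * b + c * a + b * c = - E" and tri': "b * a + c * b + a * c = - E"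
    and E: "E * b = b * E" and hc: "h * c = - (a * h)" and bbc: "b * (b * c) = c * (b * b)"
  shows "(f + a) * (h + b) * (f + a) - (h + b) * (f + a) * (h + b) = E * ((h + b) - (f + a))"
proof -
  have 1: "f * h * a = b * f * h"
    by (simp add: mult.assoc ha) (simp add: fc flip: mult.assoc)
  have 2: "h * f * b = a * h * f"
    by (simp add: mult.assoc fb) (simp add: hc flip: mult.assoc)
  have 3: "f * b * f = - (c * H) + c * (a * a)"
    by (simp add: fb mult.assoc ff right_diff_distrib)
  have 4: "h * a * h = - (c * H) + c * (b * b)"
    by (simp add: ha mult.assoc hh right_diff_distrib)
  have 5: "f * b * a + a * b * f - b * f * b = - (E * f)"
  proof -
    have "f * b * a = c * a * f" "b * f * b = - (b * c * f)"
      by (simp_all add: fb fa mult.assoc)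
    then have "f * b * a + a * b * f - b * f * b = (a * b + c * a + b * c) * f"
      by (simp add: distrib_right)
    then show ?thesis by (simp add: tri)
  qed
  have 6: "a * h * a - h * a * b - b * a * h = E * h"
  proof -
    have "a * h * a = - (a * c * h)" "h * a * b = c * b * h"
      by (simp_all add: ha hb mult.assoc)
    then have "a * h * a - h * a * b - b * a * h = - ((b * a + c * b + a * c) * h)"
      by (simp add: distrib_right)
    then show ?thesis by (simp add: tri')
  qed
  \<comment> \<open>\<open>tri\<close> times \<open>a\<close> from the right minus \<open>b\<close> times \<open>tri\<close>; the term \<open>b c a\<close> drops out\<close>
  have 7: "c * (a * a) - c * (b * b) + a * b * a - b * a * b = E * b - E * a"
  proof -
    have "(a * b + c * a + b * c) * a - b * (a * b + c * a + b * c) = - E * a + b * E"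
      by (simp add: tri)
    moreover have "(a * b + c * a + b * c) * a - b * (a * b + c * a + b * c) =
        a * b * a + c * (a * a) - b * a * b - b * b * c"
      by (simp add: algebra_simps)
    ultimately show ?thesis by (simp add: E bbc algebra_simps)
  qed
  have "(f + a) * (h + b) * (f + a) - (h + b) * (f + a) * (h + b) =
      (f * h * f - h * f * h) + (f * h * a - b * f * h) + (a * h * f - h * f * b)
      + (f * b * a + a * b * f - b * f * b) + (a * h * a - h * a * b - b * a * h)
      + (f * b * f - h * a * h + a * b * a - b * a * b)"
    by (simp add: algebra_simps)
  also have "f * b * f - h * a * h + a * b * a - b * a * b = E * b - E * a"
    using 7 by (simp add: 3 4)
  finally show ?thesis
    unfolding 1 2 5 6 fhf by (simp add: algebra_simps)
qed

context principal_series
begin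

text \<open>
Numerator and denominator both change sign.
\<close>

lemma gg_sym: "gg i j = gg j i"
proof -
  have neg: "eps / (u - v) = - (eps / (v - u))" for u v :: cq
    by (simp add: minus_divide_right)
  have "diag (\<lambda>x. eps / (lam (lett x i) - lam (lett x j))) =
      - diag (\<lambda>x. eps / (lam (lett x j) - lam (lett x i)))"
    unfolding diag_uminus by (intro arg_cong[where f = diag] ext) (rule neg)
  then have "gg i j = - diag (\<lambda>x. eps / (lam (lett x j) - lam (lett x i))) * (- (Q j - Q i))"
    by (simp add: gg_def)
  then show ?thesis
    by (simp only: gg_def minus_mult_minus)
qed

lemma phi_diag: "phi i * diag h = diag (\<lambda>x. h (x * adj i)) * phi i"
proof -
  have "phi i * diag h = diag (\<lambda>x. phi_coeff (lett x i) (lett x (Suc i))) * (clif i * diag (\<lambda>x. h (x * adj i))) * move i"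
    by (simp add: phi_def move_diag mult.assoc)
  also have "\<dots> = diag (\<lambda>x. phi_coeff (lett x i) (lett x (Suc i))) * diag (\<lambda>x. h (x * adj i)) * clif i * move i"
    by (simp add: clif_diag mult.assoc)
  finally show ?thesis
    by (simp add: diag_comm phi_def mult.assoc)
qed

lemma phi_P: "phi i * P j = P (adj i \<langle>$\<rangle> j) * phi i"
  by (simp add: pp_def phi_diag apply_times)

lemma phi_kap: "phi i * kap j = - (kap (adj i \<langle>$\<rangle> j) * phi i)"
proof -
  have "phi i * kap j = diag (\<lambda>x. phi_coeff (lett x i) (lett x (Suc i))) * (clif i * kap j) * move i"
    by (simp add: phi_def move_kap mult.assoc)
  then show ?thesis
    unfolding clif_kap phi_def by (simp add: mult.assoc) (simp only: kap_diag flip: mult.assoc)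
qed

lemma phi_Q: "phi i * Q j = - (Q (adj i \<langle>$\<rangle> j) * phi i)"
proof -
  have "phi i * Q j = diag (\<lambda>x. mu (lett x (adj i \<langle>$\<rangle> j))) * (phi i * kap j)"
    unfolding qq_def by (simp add: phi_diag apply_times flip: mult.assoc)
  then show ?thesis
    by (simp only: phi_kap qq_def mult.assoc mult_minus_right)
qed

lemma phi_gg: "phi i * gg j k = - (gg (adj i \<langle>$\<rangle> j) (adj i \<langle>$\<rangle> k) * phi i)"
proof -
  have "phi i * gg j k = diag (\<lambda>x. eps / (lam (lett x (adj i \<langle>$\<rangle> j)) - lam (lett x (adj i \<langle>$\<rangle> k)))) *
      (phi i * (Q j - Q k))"
    unfolding gg_def by (simp add: phi_diag apply_times del: adj_apply flip: mult.assoc)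
  also have "phi i * (Q j - Q k) = - ((Q (adj i \<langle>$\<rangle> j) - Q (adj i \<langle>$\<rangle> k)) * phi i)"
    by (simp add: right_diff_distrib left_diff_distrib phi_Q)
  finally show ?thesis
    by (simp only: gg_def mult.assoc mult_minus_right)
qed

lemma phi_phi:
  "phi i * phi j = diag (\<lambda>x. phi_coeff (lett x i) (lett x (Suc i)) *
      phi_coeff (lett x (adj i \<langle>$\<rangle> j)) (lett x (adj i \<langle>$\<rangle> (Suc j)))) *
    (clif i * clif j) * (move i * move j)"
proof -
  let ?d = "\<lambda>j. diag (\<lambda>x. phi_coeff (lett x j) (lett x (Suc j)))"
  let ?e = "diag (\<lambda>x. phi_coeff (lett x (adj i \<langle>$\<rangle> j)) (lett x (adj i \<langle>$\<rangle> (Suc j))))"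
  have "phi i * phi j = phi i * ?d j * (clif j * move j)"
    by (simp only: phi_def[of j] mult.assoc)
  also have "phi i * ?d j = ?e * phi i"
    by (simp only: phi_diag apply_times o_apply)
  also have "?e * phi i * (clif j * move j) = ?e * ?d i * (clif i * (move i * clif j) * move j)"
    by (simp only: phi_def[of i] mult.assoc)
  also have "?e * ?d i = ?d i * ?e"
    by (rule diag_comm)
  also have "clif i * (move i * clif j) * move j = (clif i * clif j) * (move i * move j)"
    by (simp only: clif_move mult.assoc)
  finally show ?thesis by (simp only: diag_mult mult.assoc)
qed

lemma phi_sq: "phi i * phi i = diag (\<lambda>x. phi_square (lett x i) (lett x (Suc i)))"
  by (simp add: phi_phi clif_sq move_sq diag_mult mult.commute lett_neq flip: phi_coeff_mult)

lemma phi_far: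
  assumes "Suc i < j" shows "phi i * phi j = - (phi j * phi i)"
proof -
  have "phi_coeff (lett x i) (lett x (Suc i)) *
      phi_coeff (lett x (adj i \<langle>$\<rangle> j)) (lett x (adj i \<langle>$\<rangle> (Suc j))) =
    phi_coeff (lett x j) (lett x (Suc j)) *
      phi_coeff (lett x (adj j \<langle>$\<rangle> i)) (lett x (adj j \<langle>$\<rangle> (Suc i)))" for x
    using assms by (simp add: mult.commute)
  then show ?thesis
    unfolding phi_phi clif_far[OF assms] move_far[OF assms] by (simp only:) simp
qed

text \<open>
  Both sides reverse the three letters and collect the coefficients of the same three
  pairs of letters, in a different order; the Clifford and place parts satisfy the braid relation.
\<close>

lemma phi_braid: "phi i * phi (Suc i) * phi i = phi (Suc i) * phi i * phi (Suc i)"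
proof -
  have cube: "phi a * phi b * phi c = diag (\<lambda>x.
      phi_coeff (lett x (adj a \<langle>$\<rangle> (adj b \<langle>$\<rangle> c))) (lett x (adj a \<langle>$\<rangle> (adj b \<langle>$\<rangle> (Suc c)))) *
      (phi_coeff (lett x a) (lett x (Suc a)) *
       phi_coeff (lett x (adj a \<langle>$\<rangle> b)) (lett x (adj a \<langle>$\<rangle> (Suc b))))) *
      (clif a * clif b * clif c) * (move a * move b * move c)" for a b c
  proof -
    let ?d = "\<lambda>x. phi_coeff (lett x c) (lett x (Suc c))"
    let ?e = "\<lambda>x. phi_coeff (lett x (adj a \<langle>$\<rangle> (adj b \<langle>$\<rangle> c))) (lett x (adj a \<langle>$\<rangle> (adj b \<langle>$\<rangle> (Suc c))))"
    let ?A = "\<lambda>x. phi_coeff (lett x a) (lett x (Suc a)) *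
       phi_coeff (lett x (adj a \<langle>$\<rangle> b)) (lett x (adj a \<langle>$\<rangle> (Suc b)))"
    have "phi a * phi b * phi c = phi a * (phi b * diag ?d) * (clif c * move c)"
      by (simp only: phi_def[of c] mult.assoc)
    also have "phi b * diag ?d = diag (\<lambda>x. ?d (x * adj b)) * phi b"
      by (rule phi_diag)
    also have "phi a * (diag (\<lambda>x. ?d (x * adj b)) * phi b) = diag ?e * (phi a * phi b)"
      by (simp only: phi_diag apply_times o_apply flip: mult.assoc)
    also have "diag ?e * (phi a * phi b) * (clif c * move c) =
        diag ?e * diag ?A * ((clif a * clif b) * (move a * (move b * clif c)) * move c)"
      by (simp only: phi_phi mult.assoc)
    also have "(clif a * clif b) * (move a * (move b * clif c)) * move c =
        (clif a * clif b) * (move a * clif c) * move b * move c"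
      by (simp only: clif_move[of b c] mult.assoc)
    also have "\<dots> = (clif a * clif b * clif c) * (move a * move b * move c)"
      by (simp only: clif_move[of a c] mult.assoc)
    finally show ?thesis by (simp only: diag_mult mult.assoc)
  qed
  show ?thesis
    unfolding cube clif_braid move_braid by (simp add: mult.commute mult.left_commute)
qed

lemma RR_sq: "RR i * RR i = diag (\<lambda>_. - (eps ^ 2) - 2)"
proof -
  have "phi i * gg i (Suc i) = - (gg i (Suc i) * phi i)"
    by (simp add: phi_gg gg_sym[of "Suc i" i])
  then have "RR i * RR i = phi i * phi i + gg i (Suc i) * gg i (Suc i)"
    by (simp add: RR_def algebra_simps)
  then show ?thesis
    by (simp add: phi_sq gg_sq diag_add phi_square_def)
qed

lemma RR_far: assumes "Suc i < j" shows "RR i * RR j = - (RR j * RR i)"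
proof -
  have "phi i * gg j (Suc j) = - (gg j (Suc j) * phi i)" "phi j * gg i (Suc i) = - (gg i (Suc i) * phi j)"
    "gg i (Suc i) * gg j (Suc j) = - (gg j (Suc j) * gg i (Suc i))"
    using assms by (simp_all add: phi_gg gg_far[of i j])
  then show ?thesis
    by (simp add: RR_def algebra_simps phi_far[OF assms])
qed

lemma RR_braid:
  "RR i * RR (Suc i) * RR i - RR (Suc i) * RR i * RR (Suc i) = diag (\<lambda>_. eps ^ 2) * (RR (Suc i) - RR i)"
  unfolding RR_def
proof (rule braid_from_intertwiners)
  let ?j = "Suc i" and ?k = "Suc (Suc i)"
  show "phi i * gg i ?j = - (gg i ?j * phi i)" by (simp add: phi_gg gg_sym[of ?j i])
  show "phi i * gg ?j ?k = - (gg i ?k * phi i)" by (simp add: phi_gg)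
  show "phi i * gg i ?k = - (gg ?j ?k * phi i)" by (simp add: phi_gg)
  show "phi ?j * gg i ?j = - (gg i ?k * phi ?j)" by (simp add: phi_gg)
  show "phi ?j * gg i ?k = - (gg i ?j * phi ?j)" by (simp add: phi_gg)
  show "phi ?j * gg ?j ?k = - (gg ?j ?k * phi ?j)" by (simp add: phi_gg gg_sym[of ?k ?j])
  show "phi i * phi ?j * phi i = phi ?j * phi i * phi ?j" by (rule phi_braid)
  have sq: "phi l * phi l = diag (\<lambda>_. - (eps ^ 2) - 2) - gg l (Suc l) * gg l (Suc l)" for l
    by (simp add: phi_sq gg_sq diag_diff phi_square_def)
  show "phi i * phi i = diag (\<lambda>_. - (eps ^ 2) - 2) - gg i ?j * gg i ?j"
    "phi ?j * phi ?j = diag (\<lambda>_. - (eps ^ 2) - 2) - gg ?j ?k * gg ?j ?k"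
    by (rule sq)+
  show "gg i ?j * gg ?j ?k + gg i ?k * gg i ?j + gg ?j ?k * gg i ?k = - diag (\<lambda>_. eps ^ 2)"
    by (simp add: gg_triple diag_uminus)
  show "gg ?j ?k * gg i ?j + gg i ?k * gg ?j ?k + gg i ?j * gg i ?k = - diag (\<lambda>_. eps ^ 2)"
    using gg_triple[of ?k ?j i]
    by (simp add: diag_uminus gg_sym[of ?k ?j] gg_sym[of ?j i] gg_sym[of ?k i])
  show "diag (\<lambda>_. eps ^ 2) * gg ?j ?k = gg ?j ?k * diag (\<lambda>_. eps ^ 2)"
    by (simp add: gg_diag)
  show "gg ?j ?k * (gg ?j ?k * gg i ?k) = gg i ?k * (gg ?j ?k * gg ?j ?k)"
    by (simp add: gg_sq gg_diag flip: mult.assoc)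
qed

lemma RR_P_far: "j \<noteq> i \<Longrightarrow> j \<noteq> Suc i \<Longrightarrow> RR i * P j = P j * RR i"
  by (simp add: RR_def distrib_left distrib_right phi_P) (simp add: pp_def gg_diag)

lemma RR_Q_far: "j \<noteq> i \<Longrightarrow> j \<noteq> Suc i \<Longrightarrow> RR i * Q j = - (Q j * RR i)"
  by (simp add: RR_def distrib_left distrib_right phi_Q gg_Q_far)

lemma RR_P: "RR i * P i = P (Suc i) * RR i + diag (\<lambda>_. eps) * (Q i - Q (Suc i))"
proof -
  have "gg i (Suc i) * P i - P (Suc i) * gg i (Suc i) = (P i - P (Suc i)) * gg i (Suc i)"
    by (simp add: pp_def gg_diag left_diff_distrib)
  also have "\<dots> = diag (\<lambda>_. eps) * (Q i - Q (Suc i))"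
    by (simp add: gg_def pp_def diag_mult diag_diff lam_lett_neq flip: mult.assoc)
  finally show ?thesis
    by (simp add: RR_def distrib_left distrib_right phi_P algebra_simps)
qed

lemma RR_Q: "RR i * Q i = - (Q (Suc i) * RR i) - diag (\<lambda>_. eps) * (P i + P (Suc i))"
  using gg_Q_near[of i "Suc i"]
  by (simp add: RR_def distrib_left distrib_right phi_Q algebra_simps)

end

section \<open>Leading words\<close>

definition pbw_chain :: "nat \<Rightarrow> nat \<Rightarrow> (hecke_gen, cq) free_poly" where
  "pbw_chain i a = prod_list (map (\<lambda>j. fR (i - j)) [0..<a])"

definition pbw_poly ::
  "nat \<Rightarrow> (nat \<Rightarrow> nat) \<times> (nat \<Rightarrow> nat) \<times> (nat \<Rightarrow> nat) \<Rightarrow> (hecke_gen, cq) free_poly" where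
  "pbw_poly n = (\<lambda>(k, e, a).
     prod_list (map (\<lambda>i. fP i ^ k i) [1..<Suc n]) *
     prod_list (map (\<lambda>i. fQ i ^ e i) [1..<Suc n]) *
     prod_list (map (\<lambda>i. pbw_chain i (a i)) [1..<n]))"

text \<open>
  The place permutation \<open>s\<^sub>m\<^sub>-\<^sub>a\<^sub>+\<^sub>1 \<dots> s\<^sub>m\<^sub>-\<^sub>1 s\<^sub>m\<close>. Multiplied from the right to a word, it moves the
  letter at place \<open>m + 1 - a\<close> to place \<open>m + 1\<close>. It is what \<open>R\<^sub>m R\<^sub>m\<^sub>-\<^sub>1 \<dots> R\<^sub>m\<^sub>-\<^sub>a\<^sub>+\<^sub>1\<close> does to a
  word when every factor swaps; the rightmost factor acts first.
\<close>

fun cyc :: "nat \<Rightarrow> nat \<Rightarrow> nat perm" where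
  "cyc (Suc m) (Suc a) = cyc m a * adj (Suc m)"
| "cyc m a = 1"

text \<open>
  The word reached from the identity by the product \<open>R\<^sub>m\<^sub>,\<^sub>a\<^sub>(\<^sub>m\<^sub>) \<dots> R\<^sub>n\<^sub>-\<^sub>1\<^sub>,\<^sub>a\<^sub>(\<^sub>n\<^sub>-\<^sub>1\<^sub>)\<close> when every
  factor swaps. The order is reversed because operators act from right to left while place
  permutations multiply words from the right.
\<close>

definition top_word :: "(nat \<Rightarrow> nat) \<Rightarrow> nat \<Rightarrow> nat \<Rightarrow> nat perm" where
  "top_word a n m = prod_list (rev (map (\<lambda>i. cyc i (a i)) [m..<n]))"

definition agree :: "nat \<Rightarrow> nat perm \<Rightarrow> nat perm \<Rightarrow> bool" where
  "agree m x y \<longleftrightarrow> (\<forall>i>m. lett x i = lett y i)"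

lemma cyc_fix: "Suc m < i \<Longrightarrow> lett (cyc m a) i = i"
  by (induction m a rule: cyc.induct) (auto simp: apply_times)

lemma cyc_top: "a \<le> m \<Longrightarrow> lett (cyc m a) (Suc m) = Suc m - a"
  by (induction m a rule: cyc.induct) (auto simp: apply_times)

lemma top_word_Suc: "m < n \<Longrightarrow> top_word a n m = top_word a n (Suc m) * cyc m (a m)"
  by (simp add: top_word_def upt_conv_Cons)

lemma kap_fun_zero: "kap_fun i 0 = 0"
  by (simp add: kap_fun_def fun_eq_iff)

context principal_series
begin

definition chainR :: "nat \<Rightarrow> nat \<Rightarrow> spin_vec endo" where
  "chainR i a = prod_list (map (\<lambda>j. RR (i - j)) [0..<a])"

lemma chainR_0: "chainR m 0 = 1"
  by (simp add: chainR_def)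

lemma chainR_Suc: "chainR (Suc m) (Suc a) = RR (Suc m) * chainR m a"
proof -
  have "[0..<Suc a] = 0 # map Suc [0..<a]"
    by (simp add: upt_conv_Cons map_Suc_upt del: upt_Suc)
  then show ?thesis
    by (simp add: chainR_def o_def del: upt_Suc)
qed

lemma act_phi: "act (phi i) v x S = phi_coeff (lett x i) (lett x (Suc i)) *
   (kap_fun i (v (x * adj i)) S - kap_fun (Suc i) (v (x * adj i)) S)"
  by (simp add: phi_def act_simps act_diag clif_def act_kap act_move)

lemma act_gg: "act (gg i j) v x S = eps / (lam (lett x i) - lam (lett x j)) *
   (mu (lett x i) * kap_fun i (v x) S - mu (lett x j) * kap_fun j (v x) S)"
  by (simp add: gg_def qq_def act_simps act_diag act_kap)

lemma RR_local:
  assumes "v x = 0" "v (x * adj i) = 0" shows "act (RR i) v x = 0"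
  by (rule ext) (simp add: RR_def act_simps act_phi act_gg assms kap_fun_zero)

text \<open>
  The operator \<open>U\<close> is, up to a nonzero scalar, left multiplication by \<open>\<kappa>\<^sub>i - \<kappa>\<^sub>i\<^sub>+\<^sub>1\<close>, whose square is
  \<open>2\<close>; hence it is surjective.
\<close>

lemma RR_step:
  "\<exists>U. surj U \<and> U 0 = 0 \<and> (\<forall>v. v x = 0 \<longrightarrow> act (RR i) v x = U (v (x * adj i)))"
proof -
  let ?c = "phi_coeff (lett x i) (lett x (Suc i))"
  let ?U = "\<lambda>F S. ?c * (kap_fun i F S - kap_fun (Suc i) F S)"
  have c: "?c \<noteq> 0" by (rule phi_coeff_nonzero) (simp add: lett_neq)
  have sq: "?U (?U F) = (\<lambda>S. 2 * ?c ^ 2 * F S)" for F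
  proof
    fix S
    have "?U F = (\<lambda>S. ?c * (kap_fun i F S - kap_fun (Suc i) F S))" ..
    have lin: "kap_fun j (\<lambda>S. ?c * (kap_fun i F S - kap_fun (Suc i) F S)) S =
        ?c * (kap_fun j (kap_fun i F) S - kap_fun j (kap_fun (Suc i) F) S)" for j
      by (simp add: kap_fun_def algebra_simps)
    show "?U (?U F) S = 2 * ?c ^ 2 * F S"
      unfolding lin kap_fun_sq by (simp add: kap_fun_anti power2_eq_square algebra_simps)
  qed
  have "surj ?U"
  proof (rule surjI)
    fix F
    show "?U (?U (\<lambda>S. F S / (2 * ?c ^ 2))) = F"
      unfolding sq using c by simp
  qed
  moreover have "?U 0 = 0"
    by (simp add: kap_fun_zero fun_eq_iff)
  moreover have "act (RR i) v x = ?U (v (x * adj i))" if "v x = 0" for v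
    by (rule ext) (simp add: RR_def act_simps act_phi act_gg that kap_fun_zero)
  ultimately show ?thesis by (intro exI[of _ ?U]) auto
qed

text \<open>
  Operators \<open>R\<^sub>i\<close> with \<open>i < m\<close> only move letters at places up to \<open>m\<close>.
\<close>

lemma RR_prod_support:
  assumes "\<And>i. i \<in> set is \<Longrightarrow> i < m" "\<And>y. agree m y x \<Longrightarrow> v y = 0"
  shows "act (prod_list (map RR is)) v x = 0"
  using assms
proof (induction "is" arbitrary: x)
  case Nil
  then show ?case by (simp add: act_simps agree_def)
next
  case (Cons i js)
  have "agree m y x" if "agree m y (x * adj i)" for y
    using that Cons.prems(1)[of i] by (auto simp: agree_def apply_times)
  then have "act (prod_list (map RR js)) v (x * adj i) = 0" "act (prod_list (map RR js)) v x = 0"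
    using Cons by auto
  then show ?case
    by (simp add: act_simps RR_local)
qed

lemma chainR_support:
  assumes "j < m" "\<And>y. agree m y x \<Longrightarrow> v y = 0"
  shows "act (chainR j a) v x = 0"
proof -
  have "act (prod_list (map RR (map (\<lambda>i. j - i) [0..<a]))) v x = 0"
    by (rule RR_prod_support[of _ m]) (use assms in auto)
  then show ?thesis by (simp add: chainR_def o_def)
qed

text \<open>
  After a chain of length \<open>a\<close>, the letter at place \<open>m + 1\<close> is one of the letters that stood at
  the places \<open>m + 1, m, \<dots>, m + 1 - a\<close>, and the last of these only if all factors swapped.
  The case \<open>a < b\<close> says that a shorter chain cannot bring in the letter from place \<open>m + 1 - b\<close>;
  it is part of the statement because the induction peels off the leftmost factor and lowers
  \<open>a\<close> and \<open>b\<close> together.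
\<close>

lemma chainR_top:
  assumes "a \<le> m"
  shows "\<exists>U. surj U \<and> (\<forall>v x b.
    (\<forall>z. agree (Suc m) z y \<longrightarrow> z \<noteq> y \<longrightarrow> v z = 0) \<longrightarrow> agree (Suc m) x y \<longrightarrow>
    a \<le> b \<longrightarrow> b \<le> m \<longrightarrow> lett x (Suc m) = lett y (Suc m - b) \<longrightarrow>
    act (chainR m a) v x = (if a = b \<and> x = y * cyc m a then U (v y) else 0))"
  using assms
proof (induction m a rule: cyc.induct)
  case (1 m a)
  let ?M = "Suc m"
  obtain U where "surj U" and U: "\<And>v x b. (\<forall>z. agree ?M z y \<longrightarrow> z \<noteq> y \<longrightarrow> v z = 0) \<Longrightarrow>
      agree ?M x y \<Longrightarrow> a \<le> b \<Longrightarrow> b \<le> m \<Longrightarrow> lett x ?M = lett y (?M - b) \<Longrightarrow>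
      act (chainR m a) v x = (if a = b \<and> x = y * cyc m a then U (v y) else 0)"
    using 1 by fastforce
  let ?x0 = "y * cyc ?M (Suc a)"
  obtain V where V: "surj V" "V 0 = 0"
      "\<And>v. v ?x0 = 0 \<Longrightarrow> act (RR ?M) v ?x0 = V (v (?x0 * adj ?M))"
    using RR_step[of ?x0 ?M] by blast
  have "act (chainR ?M (Suc a)) v x = (if Suc a = b \<and> x = ?x0 then (V \<circ> U) (v y) else 0)"
    if v: "\<forall>z. agree (Suc ?M) z y \<longrightarrow> z \<noteq> y \<longrightarrow> v z = 0" and x: "agree (Suc ?M) x y"
      and b: "Suc a \<le> b" "b \<le> ?M" "lett x (Suc ?M) = lett y (Suc ?M - b)" for v x b
  proof -
    let ?w = "act (chainR m a) v"
    let ?x' = "x * adj ?M"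
    \<comment> \<open>the factors other than the leftmost one do not touch place \<open>m + 2\<close>\<close>
    have off: "?w z = 0" if "agree (Suc ?M) z y" "lett z (Suc ?M) \<noteq> lett y (Suc ?M)" for z
    proof (rule chainR_support)
      show "m < ?M" by simp
      fix u assume "agree ?M u z"
      then have "agree (Suc ?M) u y" "lett u (Suc ?M) \<noteq> lett y (Suc ?M)"
        using that by (auto simp: agree_def)
      then show "v u = 0" using v by auto
    qed
    have wx: "?w x = 0"
      using off[OF x] b by (simp add: apply_inj)
    have x': "agree (Suc ?M) ?x' y"
      using x by (auto simp: agree_def apply_times)
    have wx': "?w ?x' = (if Suc a = b \<and> x = ?x0 then U (v y) else 0)"
    proof (cases "agree ?M ?x' y")
      case True
      have "?w ?x' = (if a = b - 1 \<and> ?x' = y * cyc m a then U (v y) else 0)"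
      proof (rule U)
        show "\<forall>z. agree ?M z y \<longrightarrow> z \<noteq> y \<longrightarrow> v z = 0"
          using v by (auto simp: agree_def)
        show "lett ?x' ?M = lett y (?M - (b - 1))"
          using b by (cases b) (simp_all add: apply_times)
      qed (use True b in auto)
      moreover have "?x' = y * cyc m a \<longleftrightarrow> x = ?x0"
      proof
        assume "?x' = y * cyc m a"
        then have "?x' * adj ?M = y * cyc m a * adj ?M" by simp
        then show "x = ?x0" unfolding adj_cancel by (simp add: mult.assoc)
      next
        assume "x = ?x0"
        then have "?x' = (y * cyc m a) * adj ?M * adj ?M" by (simp add: mult.assoc)
        then show "?x' = y * cyc m a" unfolding adj_cancel .
      qed
      ultimately show ?thesis using b by auto
    next
      case False
      have "x \<noteq> ?x0"
      proof
        assume "x = ?x0"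
        then have "?x' = (y * cyc m a) * adj ?M * adj ?M" by (simp add: mult.assoc)
        then have "?x' = y * cyc m a" unfolding adj_cancel .
        then show False using False by (auto simp: agree_def apply_times cyc_fix)
      qed
      moreover have "lett ?x' (Suc ?M) \<noteq> lett y (Suc ?M)"
        using False x' unfolding agree_def by (metis Suc_lessI)
      ultimately show ?thesis using off[OF x'] by simp
    qed
    show ?thesis
    proof (cases "x = ?x0")
      case True
      then have "act (RR ?M) ?w x = V (?w ?x')" using V(3)[of ?w] wx by simp
      then show ?thesis unfolding chainR_Suc wx' using V(2) by (simp add: act_simps)
    next
      case False
      then show ?thesis
        unfolding chainR_Suc using RR_local[of ?w x ?M] wx wx' by (simp add: act_simps)
    qed
  qed
  moreover have "surj (V \<circ> U)" using \<open>surj U\<close> V(1) by (rule comp_surj)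
  ultimately show ?case by (intro exI[of _ "V \<circ> U"]) blast
next
  case ("2_1" a)
  then show ?case
    by (intro exI[of _ id]) (auto simp: chainR_0 act_simps)
next
  case ("2_2" m)
  show ?case
  proof (intro exI[of _ id] conjI allI impI)
    fix v :: spin_vec and x b
    assume "\<forall>z. agree (Suc m) z y \<longrightarrow> z \<noteq> y \<longrightarrow> v z = 0" "agree (Suc m) x y" "b \<le> m"
      and x: "lett x (Suc m) = lett y (Suc m - b)"
    moreover have "b = 0" if "x = y"
      using x \<open>b \<le> m\<close> unfolding that apply_inj by simp
    ultimately show "act (chainR m 0) v x = (if 0 = b \<and> x = y * cyc m 0 then id (v y) else 0)"
      by (cases "x = y") (simp_all add: chainR_0 act_simps)
  qed simp
qed

end

text \<open>
  The exponent \<open>b\<close> is smaller than \<open>a\<close> in the lexicographic order in which the highest index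
  counts most, and \<open>j\<close> is the highest index where they differ. High indices come first because the
  corresponding factors act first and fix the last letters for good.
\<close>

definition lower_at :: "(nat \<Rightarrow> nat) \<Rightarrow> (nat \<Rightarrow> nat) \<Rightarrow> nat \<Rightarrow> nat \<Rightarrow> bool" where
  "lower_at b a n j \<longleftrightarrow> j < n \<and> b j < a j \<and> (\<forall>i. j < i \<longrightarrow> i < n \<longrightarrow> b i = a i)"

lemma lex_maximal:
  fixes T :: "(nat \<Rightarrow> nat) set"
  assumes "finite T" "T \<noteq> {}"
  shows "\<exists>a\<in>T. \<forall>b\<in>T. (\<forall>i. 1 \<le> i \<longrightarrow> i < n \<longrightarrow> b i = a i) \<or> (\<exists>j\<ge>1. lower_at b a n j)"
  using assms
proof (induction n arbitrary: T)
  case 0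
  then show ?case by auto
next
  case (Suc n)
  define M where "M = Max ((\<lambda>a. a n) ` T)"
  have le: "b n \<le> M" if "b \<in> T" for b
    using that Suc.prems by (simp add: M_def)
  have "M \<in> (\<lambda>a. a n) ` T"
    unfolding M_def using Suc.prems by (intro Max_in) auto
  then have "{a \<in> T. a n = M} \<noteq> {}" "finite {a \<in> T. a n = M}"
    using Suc.prems by auto
  then obtain a where a: "a \<in> T" "a n = M" and
    max: "\<And>b. b \<in> T \<Longrightarrow> b n = M \<Longrightarrow>
      (\<forall>i. 1 \<le> i \<longrightarrow> i < n \<longrightarrow> b i = a i) \<or> (\<exists>j\<ge>1. lower_at b a n j)"
    using Suc.IH[of "{a \<in> T. a n = M}"] by auto
  show ?case
  proof (intro bexI[OF _ a(1)] ballI)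
    fix b assume b: "b \<in> T"
    consider "n = 0" | "b n = M" "n > 0" | "b n < M" "n > 0" using le[OF b] by force
    then show "(\<forall>i. 1 \<le> i \<longrightarrow> i < Suc n \<longrightarrow> b i = a i) \<or> (\<exists>j\<ge>1. lower_at b a (Suc n) j)"
    proof cases
      case 2
      then show ?thesis
        using max[OF b] a by (auto simp: lower_at_def less_Suc_eq)
    next
      case 3
      then have "lower_at b a (Suc n) n" using a by (simp add: lower_at_def)
      then show ?thesis using 3 by (intro disjI2 exI[of _ n]) auto
    qed auto
  qed
qed

context principal_series
begin

definition tail_prod :: "(nat \<Rightarrow> nat) \<Rightarrow> nat \<Rightarrow> nat \<Rightarrow> spin_vec endo" where
  "tail_prod a n m = prod_list (map (\<lambda>i. chainR i (a i)) [m..<n])"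

definition start :: "(nat set \<Rightarrow> cq) \<Rightarrow> spin_vec" where
  "start F x = (if x = 1 then F else 0)"

lemma tail_prod_Suc: "m < n \<Longrightarrow> tail_prod a n m = chainR m (a m) * tail_prod a n (Suc m)"
  by (simp add: tail_prod_def upt_conv_Cons)

text \<open>
  Triangularity. Only the behaviour at words \<open>z\<close> that agree with the leading word
  beyond place \<open>m\<close> matters, since later factors cannot change those places.
  The operator \<open>U\<close> does not depend on \<open>F\<close>, and its surjectivity allows the start vector
  to be chosen so that the leading component is any given Clifford element.
\<close>

lemma tail_triangular:
  assumes "m \<le> n" "\<forall>i. m \<le> i \<longrightarrow> i < n \<longrightarrow> a i \<le> i"
  shows "\<exists>U. surj U \<and> (\<forall>F b z. agree m z (top_word a n m) \<longrightarrow>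
    ((\<forall>i. m \<le> i \<longrightarrow> i < n \<longrightarrow> b i = a i) \<longrightarrow>
      act (tail_prod b n m) (start F) z = (if z = top_word a n m then U F else 0)) \<and>
    ((\<exists>j\<ge>m. lower_at b a n j) \<longrightarrow> act (tail_prod b n m) (start F) z = 0))"
  using assms
proof (induction m rule: inc_induct)
  case base
  show ?case
    by (intro exI[of _ id]) (auto simp: tail_prod_def top_word_def act_simps start_def lower_at_def)
next
  case (step m)
  let ?X = "top_word a n m" and ?Y = "top_word a n (Suc m)"
  obtain U where "surj U" and U: "\<forall>F b z. agree (Suc m) z ?Y \<longrightarrow>
      ((\<forall>i. Suc m \<le> i \<longrightarrow> i < n \<longrightarrow> b i = a i) \<longrightarrow>
        act (tail_prod b n (Suc m)) (start F) z = (if z = ?Y then U F else 0)) \<and>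
      ((\<exists>j\<ge>Suc m. lower_at b a n j) \<longrightarrow> act (tail_prod b n (Suc m)) (start F) z = 0)"
  proof -
    have "\<forall>i. Suc m \<le> i \<longrightarrow> i < n \<longrightarrow> a i \<le> i" using step.prems by simp
    from step.IH[OF this] show ?thesis using that by blast
  qed
  have eq: "act (tail_prod b n (Suc m)) (start F) z = (if z = ?Y then U F else 0)"
    if "agree (Suc m) z ?Y" "\<forall>i. Suc m \<le> i \<longrightarrow> i < n \<longrightarrow> b i = a i" for F b z
    using U that by blast
  have low: "act (tail_prod b n (Suc m)) (start F) z = 0"
    if "agree (Suc m) z ?Y" "\<exists>j\<ge>Suc m. lower_at b a n j" for F b z
    using U that by blast
  have am: "a m \<le> m" using step by simp
  have X: "?X = ?Y * cyc m (a m)" using step by (simp add: top_word_Suc)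
  obtain V where "surj V" and V: "\<forall>v x b.
    (\<forall>z. agree (Suc m) z ?Y \<longrightarrow> z \<noteq> ?Y \<longrightarrow> v z = 0) \<longrightarrow> agree (Suc m) x ?Y \<longrightarrow>
    a m \<le> b \<longrightarrow> b \<le> m \<longrightarrow> lett x (Suc m) = lett ?Y (Suc m - b) \<longrightarrow>
    act (chainR m (a m)) v x = (if a m = b \<and> x = ?X then V (v ?Y) else 0)"
    using chainR_top[OF am, of ?Y] unfolding X by blast
  have agree: "agree (Suc m) z ?Y" "lett z (Suc m) = lett ?Y (Suc m - a m)" if "agree m z ?X" for z
    using that am unfolding X by (auto simp: agree_def apply_times cyc_fix cyc_top)
  have "act (tail_prod b n m) (start F) z = (if z = ?X then (V \<circ> U) F else 0)"
    if z: "agree m z ?X" and b: "\<forall>i. m \<le> i \<longrightarrow> i < n \<longrightarrow> b i = a i" for F b z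
  proof -
    let ?v = "act (tail_prod b n (Suc m)) (start F)"
    have v: "?v u = (if u = ?Y then U F else 0)" if "agree (Suc m) u ?Y" for u
      using eq[OF that] b by auto
    have "act (chainR m (a m)) ?v z = (if a m = a m \<and> z = ?X then V (?v ?Y) else 0)"
      by (rule V[rule_format]) (use agree[OF z] am v in auto)
    moreover have "?v ?Y = U F" using v[of ?Y] by (simp add: agree_def)
    ultimately show ?thesis
      using b step by (simp add: tail_prod_Suc act_simps)
  qed
  moreover have "act (tail_prod b n m) (start F) z = 0"
    if z: "agree m z ?X" and b: "\<exists>j\<ge>m. lower_at b a n j" for F b z
  proof -
    let ?v = "act (tail_prod b n (Suc m)) (start F)"
    obtain j where j: "j \<ge> m" "lower_at b a n j" using b by blast
    have "act (chainR m (b m)) ?v z = 0"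
    proof (cases "j = m")
      case False
      then have "\<exists>j\<ge>Suc m. lower_at b a n j" using j by (intro exI[of _ j]) auto
      then have "?v u = 0" if "agree (Suc m) u z" for u
        using that agree(1)[OF z] by (intro low) (auto simp: agree_def)
      then show ?thesis by (intro chainR_support) auto
    next
      case True
      then have bm: "b m < a m" and b_eq: "\<forall>i. Suc m \<le> i \<longrightarrow> i < n \<longrightarrow> b i = a i"
        using j by (auto simp: lower_at_def)
      have v: "?v u = (if u = ?Y then U F else 0)" if "agree (Suc m) u ?Y" for u
        using eq[OF that b_eq] .
      have "b m \<le> m" using bm am by simp
      from chainR_top[OF this, of ?Y] obtain W where W: "\<forall>v x c.
        (\<forall>z. agree (Suc m) z ?Y \<longrightarrow> z \<noteq> ?Y \<longrightarrow> v z = 0) \<longrightarrow> agree (Suc m) x ?Y \<longrightarrow>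
        b m \<le> c \<longrightarrow> c \<le> m \<longrightarrow> lett x (Suc m) = lett ?Y (Suc m - c) \<longrightarrow>
        act (chainR m (b m)) v x = (if b m = c \<and> x = ?Y * cyc m (b m) then W (v ?Y) else 0)"
        by blast
      have "act (chainR m (b m)) ?v z = (if b m = a m \<and> z = ?Y * cyc m (b m) then W (?v ?Y) else 0)"
        by (rule W[rule_format]) (use agree[OF z] am bm v in auto)
      then show ?thesis using bm by simp
    qed
    then show ?thesis
      using step by (simp add: tail_prod_Suc act_simps)
  qed
  moreover have "surj (V \<circ> U)" using \<open>surj U\<close> \<open>surj V\<close> by (rule comp_surj)
  ultimately show ?case by (intro exI[of _ "V \<circ> U"] conjI allI impI) simp_all
qed

lemma act_P_prod:
  "act (prod_list (map (\<lambda>i. P i ^ k i) is)) v x S =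
    prod_list (map (\<lambda>i. lam (lett x i) ^ k i) is) * v x S"
proof -
  have pow: "P i ^ l = diag (\<lambda>x. lam (lett x i) ^ l)" for i l
    by (induction l) (simp_all add: diag_one pp_def diag_mult)
  show ?thesis
    by (induction "is" arbitrary: v) (simp_all add: act_simps pow act_diag)
qed

text \<open>
The unit of the Clifford algebra, as an element of the regular module.
\<close>

definition vacuum :: "nat set \<Rightarrow> cq" where
  "vacuum S = (if S = {} then 1 else 0)"

lemma act_Q: "act (Q i) v x S = mu (lett x i) * kap_fun i (v x) S"
  by (simp add: qq_def act_simps act_diag act_kap)

text \<open>
  Applied to the unit, \<open>q\<^sup>e\<close> gives a nonzero multiple of the Clifford basis element indexed by the
  support of \<open>e\<close>, so different \<open>e\<close> are separated.
\<close>

lemma act_Q_prod: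
  assumes "distinct is" "\<And>i. i \<in> set is \<Longrightarrow> e i \<in> {0, 1::nat}" "\<And>l. mu l \<noteq> 0"
  shows "\<exists>c\<noteq>0. \<forall>v. v x = vacuum \<longrightarrow> (\<forall>S. act (prod_list (map (\<lambda>i. Q i ^ e i) is)) v x S =
    (if S = {i \<in> set is. e i = 1} then c else 0))"
  using assms
proof (induction "is")
  case Nil
  then show ?case by (intro exI[of _ 1]) (auto simp: act_simps vacuum_def)
next
  case (Cons i js)
  let ?T = "{i \<in> set js. e i = 1}"
  obtain c where c: "c \<noteq> 0" and IH: "\<And>v S. v x = vacuum \<Longrightarrow>
      act (prod_list (map (\<lambda>i. Q i ^ e i) js)) v x S = (if S = ?T then c else 0)"
    using Cons by auto
  have i: "i \<notin> ?T" using Cons.prems(1) by auto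
  consider "e i = 0" | "e i = 1" using Cons.prems(2)[of i] by auto
  then show ?case
  proof cases
    case 1
    then have "{j \<in> set (i # js). e j = 1} = ?T" by auto
    then show ?thesis using 1 c IH by (intro exI[of _ c]) (simp add: act_simps)
  next
    case 2
    have T: "{j \<in> set (i # js). e j = 1} = insert i ?T" using 2 by auto
    have diff: "sym_diff S {i} = ?T \<longleftrightarrow> S = insert i ?T" for S using i by auto
    let ?c = "mu (lett x i) * ((- 1) ^ card {j \<in> insert i ?T. j < i} * c)"
    have "act (prod_list (map (\<lambda>i. Q i ^ e i) (i # js))) v x S = (if S = insert i ?T then ?c else 0)"
      if "v x = vacuum" for v S
    proof -
      let ?w = "act (prod_list (map (\<lambda>i. Q i ^ e i) js)) v"
      have "act (prod_list (map (\<lambda>i. Q i ^ e i) (i # js))) v x S = mu (lett x i) * kap_fun i (?w x) S"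
        by (simp add: 2 act_simps act_Q)
      then show ?thesis
        by (simp only: kap_fun_def IH[of v, OF that] diff) simp
    qed
    moreover have "?c \<noteq> 0" using c Cons.prems(3) by simp
    ultimately show ?thesis unfolding T by blast
  qed
qed

definition scE :: "cq \<Rightarrow> spin_vec endo" where "scE c = diag (\<lambda>_. c)"

definition genE :: "hecke_gen \<Rightarrow> spin_vec endo" where
  "genE g = (case g of GR i \<Rightarrow> RR i | GP i \<Rightarrow> P i | GQ i \<Rightarrow> Q i)"

sublocale algebra_point scE genE
proof
  show "scE c * genE x = genE x * scE c" for c x
    by (cases x)
      (simp_all add: scE_def genE_def pp_def diag_comm Q_diag RR_def distrib_left distrib_right phi_diag gg_diag)
qed (simp_all add: scE_def diag_add diag_mult diag_one)

abbreviation ev where "ev \<equiv> free_eval scE genE"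

lemma genE_simps: "genE (GR i) = RR i" "genE (GP i) = P i" "genE (GQ i) = Q i"
  by (simp_all add: genE_def)

text \<open>
The principal series is a module over the spin affine Hecke algebra.
\<close>

lemma ev_rels:
  assumes "r \<in> hecke_rels n" shows "ev r = 0"
proof -
  have sq: "RR i * RR i = scE (- (eps * eps) - 2)" for i
    by (simp add: RR_sq scE_def power2_eq_square)
  have far: "RR i * RR j + RR j * RR i = 0" if "\<bar>int i - int j\<bar> > 1" for i j
    using RR_far[of i j] RR_far[of j i] that by (cases "Suc i < j") auto
  have braid: "RR i * RR (Suc i) * RR i - RR (Suc i) * RR i * RR (Suc i) =
      scE (eps * eps) * (RR (Suc i) - RR i)" for i
    using RR_braid by (simp add: scE_def power2_eq_square)
  have QQ: "Q i * Q j + Q j * Q i = 0" if "i \<noteq> j" for i j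
    using Q_anti[OF that] by simp
  have PQ: "P i * Q j = Q j * P i" for i j
    by (simp add: pp_def Q_diag)
  have RQ: "RR i * Q j + Q j * RR i = 0" if "j \<noteq> i" "j \<noteq> Suc i" for i j
    using RR_Q_far[OF that] by simp
  have RP1: "RR i * P i = P (Suc i) * RR i + scE eps * (Q i - Q (Suc i))" for i
    by (simp add: RR_P scE_def)
  have RQ1: "RR i * Q i = - (Q (Suc i) * RR i) - scE eps * (P i + P (Suc i))" for i
    by (simp add: RR_Q scE_def)
  note ev = free_eval_simps genE_simps
  from assms show ?thesis
    unfolding hecke_rels_def
  proof (elim UnE CollectE exE conjE)
  qed (simp_all add: ev power2_eq_square sq far braid P_comm[of _ _] QQ PQ_circle PQ RR_P_far RQ RP1 RQ1)
qed

lemma ev_rel_ideal: "f \<in> rel_ideal (hecke_gens n) (hecke_rels n) \<Longrightarrow> ev f = 0"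
  by (rule free_eval_rel_ideal[OF ev_rels hecke_rels_closed])

lemma ev_pbw_poly: "ev (pbw_poly n (k, e, a)) =
  prod_list (map (\<lambda>i. P i ^ k i) [1..<Suc n]) * prod_list (map (\<lambda>i. Q i ^ e i) [1..<Suc n]) * tail_prod a n 1"
  by (simp add: pbw_poly_def pbw_chain_def tail_prod_def chainR_def free_eval_simps free_eval_prod_list
      genE_simps o_def del: upt_Suc)

end

section \<open>Linear independence\<close>

text \<open>
The constants inside the field of rational functions in \<open>q\<close>.
\<close>

definition emb :: "complex \<Rightarrow> cq" where "emb z = Fract [:z:] 1"

lemma emb_simps: "emb (x + y) = emb x + emb y" "emb (x - y) = emb x - emb y"
    "emb (x * y) = emb x * emb y" "emb 1 = 1" "emb x = emb y \<longleftrightarrow> x = y" "emb x = 0 \<longleftrightarrow> x = 0"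
  by (simp_all add: emb_def eq_fract One_fract_def Zero_fract_def one_pCons)

lemma emb_of_nat: "emb (of_nat k) = of_nat k"
  by (simp add: emb_def of_nat_fract of_nat_poly)

text \<open>
  At \<open>q = 1\<close> the parameter \<open>\<epsilon>\<close> vanishes, while the left-hand side is a nonzero constant.
\<close>

lemma eps_generic:
  assumes "x \<noteq> y" shows "(emb x - emb y) ^ 2 \<noteq> eps ^ 2 * (emb x * emb y - 1)"
proof
  assume eq: "(emb x - emb y) ^ 2 = eps ^ 2 * (emb x * emb y - 1)"
  have eps: "eps = Fract ([:0, 1:] ^ 2 - 1) [:0, 1:]"
    by (simp add: eps_def qpar_def power2_eq_square)
  have "(emb x - emb y) ^ 2 = Fract [:(x - y) ^ 2:] 1"
    by (simp add: emb_def power2_eq_square)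
  moreover have "emb x * emb y - 1 = Fract [:x * y - 1:] 1"
    using emb_simps by (metis emb_def)
  moreover have "eps ^ 2 * Fract [:x * y - 1:] 1 = Fract (([:0, 1:] ^ 2 - 1) ^ 2 * [:x * y - 1:]) ([:0, 1:] ^ 2)"
    unfolding eps power2_eq_square by (simp only: mult_fract mult_1_right)
  ultimately have "Fract [:(x - y) ^ 2:] 1 = Fract (([:0, 1:] ^ 2 - 1) ^ 2 * [:x * y - 1:]) ([:0, 1:] ^ 2)"
    using eq by simp
  then have "[:(x - y) ^ 2:] * [:0, 1:] ^ 2 = ([:0, 1:] ^ 2 - 1) ^ 2 * [:x * y - 1:]"
    by (subst (asm) eq_fract) (auto simp del: mult_pCons_left mult_pCons_right)
  then have "poly ([:(x - y) ^ 2:] * [:0, 1:] ^ 2) 1 = poly (([:0, 1:] ^ 2 - 1) ^ 2 * [:x * y - 1:]) 1"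
    by (rule arg_cong)
  then show False using assms by simp
qed

text \<open>
  Natural numbers \<open>\<ge> 2\<close> serve as values of \<open>\<lambda>\<close>: complex square roots supply \<open>\<mu>\<close>, and excluding
  \<open>1\<close> makes \<open>\<mu>\<close> nonzero.
\<close>

lemma principal_series_nat:
  assumes "inj r" "\<And>l. r l \<ge> (2::nat)"
  shows "\<exists>mu. principal_series (\<lambda>l. of_nat (r l)) mu \<and> (\<forall>l. mu l \<noteq> 0)"
proof -
  define mu where "mu l = emb (csqrt (1 - of_nat (r l) ^ 2))" for l
  have "principal_series (\<lambda>l. of_nat (r l)) mu"
  proof
    show "inj (\<lambda>l. of_nat (r l) :: cq)"
      by (rule injI) (use assms(1) in \<open>simp add: inj_eq\<close>)
    have "mu l ^ 2 = emb (1 - of_nat (r l) ^ 2)" for l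
      unfolding mu_def power2_eq_square[of "emb x" for x] emb_simps(3)[symmetric]
      by (metis power2_csqrt power2_eq_square)
    then show "(of_nat (r l)) ^ 2 + mu l ^ 2 = 1" for l
      by (simp add: emb_simps power2_eq_square emb_of_nat)
    show "(of_nat (r l) - of_nat (r m)) ^ 2 \<noteq> eps ^ 2 * (of_nat (r l) * of_nat (r m) - 1)"
      if "l \<noteq> m" for l m
    proof -
      have "r l \<noteq> r m" using that assms(1) by (simp add: inj_eq)
      then show ?thesis
        using eps_generic[of "of_nat (r l)" "of_nat (r m)"] by (simp only: emb_of_nat of_nat_eq_iff not_False_eq_True)
    qed
  qed
  moreover have "mu l \<noteq> 0" for l
  proof -
    have "(of_nat (r l) ^ 2 :: complex) \<noteq> 1"
    proof
      assume "(of_nat (r l) ^ 2 :: complex) = 1"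
      then have "r l ^ 2 = 1" by (metis of_nat_1 of_nat_eq_iff of_nat_power)
      then show False using assms(2)[of l] by simp
    qed
    then show ?thesis by (simp add: mu_def emb_simps)
  qed
  ultimately show ?thesis by blast
qed

lemma last_digit_unique:
  fixes a b x y N :: nat
  assumes "a + N * x = b + N * y" "a < N" "b < N"
  shows "a = b" "x = y"
proof -
  have "(a + N * x) mod N = a" "(b + N * y) mod N = b" "(a + N * x) div N = x" "(b + N * y) div N = y"
    using assms(2,3) by simp_all
  with assms(1) show "a = b" "x = y" by metis+
qed

lemma digits_unique:
  fixes k l :: "nat \<Rightarrow> nat"
  assumes "\<And>i. i < n \<Longrightarrow> k i < N" "\<And>i. i < n \<Longrightarrow> l i < N"
    and "(\<Sum>i<n. k i * N ^ i) = (\<Sum>i<n. l i * N ^ i)" "i < n"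
  shows "k i = l i"
  using assms
proof (induction n arbitrary: k l i)
  case (Suc n)
  have split: "(\<Sum>i<Suc n. k i * N ^ i) = k 0 + N * (\<Sum>i<n. k (Suc i) * N ^ i)" for k :: "nat \<Rightarrow> nat"
    unfolding sum.lessThan_Suc_shift by (simp add: sum_distrib_left mult.left_commute)
  have eq: "k 0 + N * (\<Sum>i<n. k (Suc i) * N ^ i) = l 0 + N * (\<Sum>i<n. l (Suc i) * N ^ i)"
    using Suc.prems(3) unfolding split .
  have lt: "k 0 < N" "l 0 < N" using Suc.prems by auto
  note digit = last_digit_unique[OF eq lt]
  have "k (Suc i) = l (Suc i)" if "i < n" for i
    by (rule Suc.IH[of "\<lambda>i. k (Suc i)" "\<lambda>i. l (Suc i)"]) (use Suc.prems(1,2) that digit(2) in auto)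
  then show ?case using digit(1) Suc.prems(4) by (cases i) auto
qed simp

text \<open>
A polynomial with infinitely many roots is zero, and its monomials are distinct.
\<close>

lemma sparse_poly_zero:
  fixes c :: "'a \<Rightarrow> 'k::field_char_0"
  assumes "finite K" "inj_on E K" and zero: "\<And>t. t \<ge> 2 \<Longrightarrow> (\<Sum>k\<in>K. c k * of_nat t ^ E k) = 0"
    and "k \<in> K"
  shows "c k = 0"
proof -
  define p where "p = (\<Sum>k\<in>K. monom (c k) (E k))"
  have "(of_nat ` {2::nat..} :: 'k set) \<subseteq> {x. poly p x = 0}"
    using zero by (auto simp: p_def poly_sum poly_monom)
  moreover have "infinite (of_nat ` {2::nat..} :: 'k set)"
    by (subst finite_image_iff) (auto simp: inj_on_def infinite_Ici)
  ultimately have "p = 0"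
    using poly_roots_finite[of p] finite_subset by blast
  then have "0 = coeff p (E k)" by simp
  also have "\<dots> = (\<Sum>j\<in>K. if j = k then c k else 0)"
    unfolding p_def coeff_sum using \<open>k \<in> K\<close> assms(2)
    by (intro sum.cong) (auto dest: inj_onD)
  also have "\<dots> = c k" using assms by simp
  finally show ?thesis by simp
qed

lemma (in principal_series) Q_local: "w x = 0 \<Longrightarrow> act (Q i) w x = 0"
  by (rule ext) (simp only: act_Q kap_fun_zero zero_fun_apply mult_zero_right)

lemma (in principal_series) Q_prod_local:
  assumes "v x = 0" shows "act (prod_list (map (\<lambda>i. Q i ^ e i) is)) v x = 0"
proof (induction "is")
  case Nil
  then show ?case using assms by (simp only: list.map prod_list.Nil act_simps)
next
  case (Cons i js)
  have "act (Q i ^ m) w x = 0" if "w x = 0" for m w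
  proof (induction m)
    case 0
    then show ?case using that by (simp only: power_0 act_simps)
  next
    case (Suc m)
    then show ?case unfolding power_Suc act_simps by (rule Q_local)
  qed
  then show ?case using Cons by (simp only: list.map prod_list.Cons act_simps)
qed

text \<open>
  Reads off one component of a linear relation: the word is the leading word of \<open>a\<close>, the Clifford
  basis element is the support of \<open>e\<close>. By maximality of \<open>a\<close> every other \<open>b\<close> with a
  nonzero coefficient is lower and does not contribute, and every other \<open>e'\<close> lands on another basis
  element.
\<close>

lemma (in principal_series) evaluation:
  fixes I :: "((nat \<Rightarrow> nat) \<times> (nat \<Rightarrow> nat) \<times> (nat \<Rightarrow> nat)) set" and c :: "_ \<Rightarrow> cq"
  assumes I: "finite I" "I \<subseteq> pbw_index n"
    and zero: "(\<Sum>idx\<in>I. scal (c idx) * pbw_poly n idx) \<in> rel_ideal (hecke_gens n) (hecke_rels n)"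
    and mu: "\<And>l. mu l \<noteq> 0"
    and a: "\<And>i. i \<in> {1..<n} \<Longrightarrow> a i \<le> i" and e: "e \<in> {1..n} \<rightarrow>\<^sub>E {0, 1}"
    and max: "\<And>k' e' b. (k', e', b) \<in> I \<Longrightarrow> c (k', e', b) \<noteq> 0 \<Longrightarrow> b = a \<or> (\<exists>j\<ge>1. lower_at b a n j)"
    and n: "n \<ge> 1"
  shows "(\<Sum>k\<in>{k. (k, e, a) \<in> I}. c (k, e, a) * (\<Prod>i\<in>{1..n}. lam (lett (top_word a n 1) i) ^ k i)) = 0"
proof -
  let ?X = "top_word a n 1"
  let ?S = "{i \<in> {1..n}. e i = 1}"
  have fin: "finite {k. (k, e, a) \<in> I}"
    by (rule finite_subset[OF _ finite_imageI[OF I(1), of fst]]) force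
  have set: "set [1..<Suc n] = {1..n}" by auto
  have "\<exists>U. surj U \<and> (\<forall>F b z. agree 1 z ?X \<longrightarrow>
    ((\<forall>i. 1 \<le> i \<longrightarrow> i < n \<longrightarrow> b i = a i) \<longrightarrow>
      act (tail_prod b n 1) (start F) z = (if z = ?X then U F else 0)) \<and>
    ((\<exists>j\<ge>1. lower_at b a n j) \<longrightarrow> act (tail_prod b n 1) (start F) z = 0))"
    by (rule tail_triangular) (use n a in auto)
  then obtain U where U: "surj U" "\<forall>F b z. agree 1 z ?X \<longrightarrow>
    ((\<forall>i. 1 \<le> i \<longrightarrow> i < n \<longrightarrow> b i = a i) \<longrightarrow>
      act (tail_prod b n 1) (start F) z = (if z = ?X then U F else 0)) \<and>
    ((\<exists>j\<ge>1. lower_at b a n j) \<longrightarrow> act (tail_prod b n 1) (start F) z = 0)"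
    by blast
  obtain F where F: "U F = vacuum" using U(1) by (metis surjD)
  have self: "agree 1 ?X ?X" by (simp add: agree_def)
  have top: "act (tail_prod a n 1) (start F) ?X = vacuum"
    using U(2) self F by auto
  have low: "act (tail_prod b n 1) (start F) ?X = 0" if "\<exists>j\<ge>1. lower_at b a n j" for b
    using U(2) self that by blast
  let ?q = "\<lambda>e'. act (prod_list (map (\<lambda>i. Q i ^ e' i) [1..<Suc n]))"
  let ?l = "\<lambda>k. \<Prod>i\<in>{1..n}. lam (lett ?X i) ^ k i"
  have l: "prod_list (map (\<lambda>i. lam (lett ?X i) ^ k i) [1..<Suc n]) = ?l k" for k
    using prod.distinct_set_conv_list[of "[1..<Suc n]" "\<lambda>i. lam (lett ?X i) ^ k i"]
    by (simp only: set distinct_upt)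
  have val: "act (ev (pbw_poly n (k', e', b))) (start F) ?X ?S =
      ?l k' * ?q e' (act (tail_prod b n 1) (start F)) ?X ?S" for k' e' b
    unfolding ev_pbw_poly by (simp only: act_simps act_P_prod l)
  have q: "\<exists>d\<noteq>0. \<forall>v. v ?X = vacuum \<longrightarrow> (\<forall>S. ?q e' v ?X S = (if S = {i \<in> {1..n}. e' i = 1} then d else 0))"
    if "e' \<in> {1..n} \<rightarrow>\<^sub>E {0, 1}" for e'
    unfolding set[symmetric] by (rule act_Q_prod) (use that mu in \<open>auto simp: PiE_iff\<close>)
  have q0: "?q e' v ?X S = 0" if "v ?X = 0" for e' v S
    using Q_prod_local[where e = e' and v = v, OF that] by (simp only: zero_fun_apply)
  obtain d where d: "d \<noteq> 0" "\<And>S. ?q e (act (tail_prod a n 1) (start F)) ?X S = (if S = ?S then d else 0)"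
    using q[OF e] top by blast
  have other: "?q e' (act (tail_prod a n 1) (start F)) ?X ?S = 0"
    if e': "e' \<in> {1..n} \<rightarrow>\<^sub>E {0, 1}" "e' \<noteq> e" for e'
  proof -
    have "?S \<noteq> {i \<in> {1..n}. e' i = 1}"
    proof
      assume eq: "?S = {i \<in> {1..n}. e' i = 1}"
      have "e' i = e i" if "i \<in> {1..n}" for i
      proof -
        have "e i \<in> {0, 1}" "e' i \<in> {0, 1}" using that e e'(1) by (simp_all only: PiE_iff)
        moreover have "e i = 1 \<longleftrightarrow> e' i = 1" using eq that by blast
        ultimately show ?thesis by auto
      qed
      then show False using e'(2) PiE_ext[OF e'(1) e] by blast
    qed
    moreover obtain d' where "\<forall>S. ?q e' (act (tail_prod a n 1) (start F)) ?X S =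
        (if S = {i \<in> {1..n}. e' i = 1} then d' else 0)"
      using q[OF e'(1)] top by blast
    ultimately show ?thesis by (simp only: if_False)
  qed
  have "0 = act (ev (\<Sum>idx\<in>I. scal (c idx) * pbw_poly n idx)) (start F) ?X ?S"
    using ev_rel_ideal[OF zero] by (simp add: act_simps)
  also have "\<dots> = (\<Sum>idx\<in>I. c idx * act (ev (pbw_poly n idx)) (start F) ?X ?S)"
  proof -
    have sum: "act (\<Sum>idx\<in>A. T idx) v x S = (\<Sum>idx\<in>A. act (T idx) v x S)" for A and T :: "_ \<Rightarrow> spin_vec endo" and v x S
      by (induction A rule: infinite_finite_induct) (simp_all add: act_simps)
    show ?thesis
      by (simp only: free_eval_sum sum free_eval_mult free_eval_scal scE_def act_simps act_diag)
  qed
  also have "\<dots> = (\<Sum>idx\<in>I. if fst (snd idx) = e \<and> snd (snd idx) = a then c idx * ?l (fst idx) * d else 0)"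
  proof (rule sum.cong[OF refl])
    fix idx assume idx: "idx \<in> I"
    obtain k' e' b where k: "idx = (k', e', b)" by (cases idx)
    have e': "e' \<in> {1..n} \<rightarrow>\<^sub>E {0, 1}" using idx I(2) unfolding k pbw_index_def by blast
    consider "c idx = 0" | "\<exists>j\<ge>1. lower_at b a n j" "c idx \<noteq> 0" | "b = a"
      using max idx unfolding k by blast
    then show "c idx * act (ev (pbw_poly n idx)) (start F) ?X ?S =
      (if fst (snd idx) = e \<and> snd (snd idx) = a then c idx * ?l (fst idx) * d else 0)"
    proof cases
      case 2
      then have "b \<noteq> a" by (auto simp: lower_at_def)
      moreover have "act (ev (pbw_poly n idx)) (start F) ?X ?S = 0"
        unfolding k val q0[where e' = e' and v = "act (tail_prod b n 1) (start F)", OF low[OF 2(1)]]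
        by (rule mult_zero_right)
      ultimately show ?thesis by (simp only: k snd_conv) simp
    next
      case 3
      have "?q e' (act (tail_prod a n 1) (start F)) ?X ?S = (if e' = e then d else 0)"
      proof (cases "e' = e")
        case True
        then show ?thesis using d(2)[of ?S] by (simp only: refl if_True)
      next
        case False
        then show ?thesis using other[OF e' False] by (simp only: if_False)
      qed
      then have "act (ev (pbw_poly n idx)) (start F) ?X ?S = ?l k' * (if e' = e then d else 0)"
        unfolding k val 3 by (simp only:)
      then show ?thesis by (simp only: k fst_conv snd_conv 3) simp
    qed simp
  qed
  also have "\<dots> = (\<Sum>idx\<in>(\<lambda>k. (k, e, a)) ` {k. (k, e, a) \<in> I}. c idx * ?l (fst idx) * d)"
    by (rule sum.mono_neutral_cong_right[OF I(1)]) auto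
  also have "\<dots> = (\<Sum>k\<in>{k. (k, e, a) \<in> I}. c (k, e, a) * ?l k) * d"
    by (subst sum.reindex) (auto simp: inj_on_def sum_distrib_right)
  finally show ?thesis using d(1) by simp
qed

text \<open>
  For a lexicographically maximal \<open>a\<close> with a nonzero coefficient, the preceding lemma gives a
  polynomial equation in the values of \<open>\<lambda>\<close>. Since \<open>\<lambda>\<close> is at our disposal, it may be chosen
  depending on \<open>a\<close>: the letter at place \<open>i\<close> of the leading word gets the value
  \<open>t\<^bsup>N^i\<^esup>\<close>. If \<open>N\<close> exceeds all exponents \<open>k\<^sub>i\<close>, then the monomials become different powers of
  \<open>t\<close>.
\<close>

lemma pbw_independent:
  assumes n: "n \<ge> 1" and I: "finite I" "I \<subseteq> pbw_index n"
    and zero: "(\<Sum>idx\<in>I. scal (c idx) * pbw_poly n idx) \<in> rel_ideal (hecke_gens n) (hecke_rels n)"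
  shows "\<forall>idx\<in>I. c idx = 0"
proof (rule ccontr)
  assume nonzero: "\<not> (\<forall>idx\<in>I. c idx = 0)"
  let ?T = "(\<lambda>idx. snd (snd idx)) ` {idx \<in> I. c idx \<noteq> 0}"
  have "finite ?T" "?T \<noteq> {}" using I nonzero by auto
  from lex_maximal[OF this, of n] obtain k0 e a where nz: "(k0, e, a) \<in> I" "c (k0, e, a) \<noteq> 0" and
    lex: "\<And>k' e' b. (k', e', b) \<in> I \<Longrightarrow> c (k', e', b) \<noteq> 0 \<Longrightarrow>
      (\<forall>i. 1 \<le> i \<longrightarrow> i < n \<longrightarrow> b i = a i) \<or> (\<exists>j\<ge>1. lower_at b a n j)"
    by force
  have idx: "k \<in> {1..n} \<rightarrow>\<^sub>E UNIV" "e' \<in> {1..n} \<rightarrow>\<^sub>E {0, 1}" "b \<in> (\<Pi>\<^sub>E i\<in>{1..<n}. {0..i})"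
    if "(k, e', b) \<in> I" for k e' b
    using I(2) that unfolding pbw_index_def by blast+
  have max: "b = a \<or> (\<exists>j\<ge>1. lower_at b a n j)" if "(k', e', b) \<in> I" "c (k', e', b) \<noteq> 0" for k' e' b
    using lex[OF that] PiE_ext[OF idx(3)[OF that(1)] idx(3)[OF nz(1)]] by auto
  have a: "a i \<le> i" if "i \<in> {1..<n}" for i
    using idx(3)[OF nz(1)] that by (auto simp: PiE_iff)
  let ?K = "{k. (k, e, a) \<in> I}"
  let ?X = "top_word a n 1"
  have K: "finite ?K"
    by (rule finite_subset[OF _ finite_imageI[OF I(1), of fst]]) force
  \<comment> \<open>the summand \<open>2\<close> also makes \<open>i \<mapsto> t^(N^i)\<close> injective\<close>
  define N where "N = 2 + Max ((\<lambda>(k, i). k i) ` (?K \<times> {1..n}))"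
  have N: "k i < N" if "k \<in> ?K" "i \<in> {1..n}" for k i
  proof -
    have "k i \<in> (\<lambda>(k, i). k i) ` (?K \<times> {1..n})" using that by force
    then have "k i \<le> Max ((\<lambda>(k, i). k i) ` (?K \<times> {1..n}))" using K by (intro Max_ge) auto
    then show ?thesis by (simp add: N_def)
  qed
  define E where "E k = (\<Sum>i\<in>{1..n}. k i * N ^ i)" for k :: "nat \<Rightarrow> nat"
  have "inj_on E ?K"
  proof (rule inj_onI)
    fix k l assume k: "k \<in> ?K" and l: "l \<in> ?K" and eq: "E k = E l"
    let ?k = "\<lambda>k i. if i = 0 then 0 else k i :: nat"
    have E: "E k = (\<Sum>i<Suc n. ?k k i * N ^ i)" for k
      unfolding E_def by (rule sum.mono_neutral_cong_left) auto
    have "k i = l i" if i: "i \<in> {1..n}" for i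
    proof -
      have "N > 0" by (simp add: N_def)
      then have lt: "?k m j < N" if "m \<in> ?K" "j < Suc n" for m j
        using N[OF that(1), of j] that(2) by (cases "j = 0") simp_all
      have "?k k i = ?k l i"
      proof (rule digits_unique[of "Suc n" "?k k" N "?k l"])
        show "(\<Sum>i<Suc n. ?k k i * N ^ i) = (\<Sum>i<Suc n. ?k l i * N ^ i)"
          using eq unfolding E .
      qed (rule lt[OF k] lt[OF l] | use i in simp)+
      then show ?thesis using i by simp
    qed
    then show "k = l" using PiE_ext[OF idx(1) idx(1)] k l by blast
  qed
  moreover have "(\<Sum>k\<in>?K. c (k, e, a) * of_nat t ^ E k) = 0" if t: "t \<ge> 2" for t
  proof -
    let ?r = "\<lambda>l. t ^ (N ^ (lett (inverse ?X) l))"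
    have "inj ?r"
      using t by (intro injI) (simp add: N_def apply_inj)
    moreover have "?r l \<ge> 2" for l
    proof -
      have "t ^ 1 \<le> ?r l" using t by (intro power_increasing) (auto simp: N_def)
      then show ?thesis using t by simp
    qed
    ultimately obtain mu where "principal_series (\<lambda>l. of_nat (?r l)) mu" and mu: "\<And>l. mu l \<noteq> 0"
      using principal_series_nat[of ?r] by blast
    then interpret principal_series "\<lambda>l. of_nat (?r l)" mu by simp
    have inv: "lett (inverse ?X) (lett ?X i) = i" for i
      by (simp add: apply_inverse bij_is_inj)
    have "(\<Prod>i\<in>{1..n}. of_nat (?r (lett ?X i)) ^ k i) = (of_nat t :: cq) ^ E k" for k
      unfolding inv E_def power_sum by (intro prod.cong) (simp_all add: mult.commute flip: power_mult)
    then show ?thesis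
      using evaluation[OF I zero mu a idx(2)[OF nz(1)] max n] by simp
  qed
  ultimately have "c (k0, e, a) = 0"
    using sparse_poly_zero[of ?K E "\<lambda>k. c (k, e, a)" k0] K nz(1) by simp
  then show False using nz(2) by simp
qed

section \<open>Spans modulo the relations\<close>

abbreviation hcarrier :: "nat \<Rightarrow> (hecke_gen, cq) free_poly set" where
  "hcarrier n \<equiv> carrier (free_algebra (hecke_gens n))"

abbreviation hideal :: "nat \<Rightarrow> (hecke_gen, cq) free_poly set" where
  "hideal n \<equiv> rel_ideal (hecke_gens n) (hecke_rels n)"

text \<open>
  The preimage in the free algebra of the span of the classes of \<open>B\<close>. Working with
  representatives keeps the calculations in a type with ring structure.
\<close>

inductive_set span_mod ::
  "nat \<Rightarrow> (hecke_gen, cq) free_poly set \<Rightarrow> (hecke_gen, cq) free_poly set"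
  for n B where
  ideal: "x \<in> hideal n \<Longrightarrow> x \<in> span_mod n B"
| base: "b \<in> B \<Longrightarrow> scal c * b \<in> span_mod n B"
| add: "x \<in> span_mod n B \<Longrightarrow> y \<in> span_mod n B \<Longrightarrow> x + y \<in> span_mod n B"

definition words :: "'r::monoid_mult set \<Rightarrow> 'r set" where
  "words S = {prod_list xs |xs. set xs \<subseteq> S}"

lemma words_one: "1 \<in> words S"
  by (auto simp: words_def intro: exI[of _ "[]"])

lemma words_gen: "g \<in> S \<Longrightarrow> g \<in> words S"
  by (auto simp: words_def intro!: exI[of _ "[g]"])

lemma words_mult: "x \<in> words S \<Longrightarrow> y \<in> words S \<Longrightarrow> x * y \<in> words S"
  unfolding words_def by (auto simp flip: prod_list.append) (metis Un_subset_iff prod_list.append set_append)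

lemma words_prod_list: "set xs \<subseteq> S \<Longrightarrow> prod_list xs \<in> words S"
  by (auto simp: words_def)

lemma words_prod_list': "(\<And>x. x \<in> set xs \<Longrightarrow> x \<in> words S) \<Longrightarrow> prod_list xs \<in> words S"
  by (induction xs) (auto simp: words_one words_mult)

lemma words_power: "g \<in> words S \<Longrightarrow> g ^ k \<in> words S"
  by (induction k) (auto intro: words_one words_mult)

lemma words_induct [consumes 1, case_names one step]:
  assumes "x \<in> words S" "P 1" "\<And>g x. g \<in> S \<Longrightarrow> x \<in> words S \<Longrightarrow> P x \<Longrightarrow> P (g * x)"
  shows "P x"
proof -
  obtain xs where "x = prod_list xs" "set xs \<subseteq> S" using assms(1) by (auto simp: words_def)
  moreover have "set xs \<subseteq> S \<Longrightarrow> P (prod_list xs)" for xs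
    by (induction xs) (auto intro: assms words_prod_list)
  ultimately show ?thesis by simp
qed

lemma words_rev_induct [consumes 1, case_names one step]:
  assumes "x \<in> words S" "P 1" "\<And>g x. g \<in> S \<Longrightarrow> x \<in> words S \<Longrightarrow> P x \<Longrightarrow> P (x * g)"
  shows "P x"
proof -
  obtain xs where "x = prod_list xs" "set xs \<subseteq> S" using assms(1) by (auto simp: words_def)
  moreover have "set xs \<subseteq> S \<Longrightarrow> P (prod_list xs)" for xs
    by (induction xs rule: rev_induct) (auto intro: assms words_prod_list)
  ultimately show ?thesis by simp
qed

lemma scal_left: "x * (scal c * y) = scal c * (x * y)" for x :: "('g, 'k::field) free_poly"
  by (metis mult.assoc scal_comm)

lemma scal_minus_one: "scal (- 1) * x = - x" for x :: "('g, 'k::field) free_poly"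
proof -
  have "scal (- 1) + scal 1 = (0 :: ('g, 'k) free_poly)"
    by (metis add.left_inverse scal_add scal_def single_zero)
  then have "scal (- 1) = (- 1 :: ('g, 'k) free_poly)"
    by (simp add: scal_one eq_neg_iff_add_eq_0)
  then show ?thesis by simp
qed

locale hecke_span =
  fixes n :: nat
begin

abbreviation "C \<equiv> hcarrier n"
abbreviation "J \<equiv> hideal n"
abbreviation "Sp \<equiv> span_mod n"

lemma J_ideal: "ideal J (free_algebra (hecke_gens n))"
  by (rule rel_ideal_ideal[OF hecke_rels_closed])

lemma J_carrier: "x \<in> J \<Longrightarrow> x \<in> C"
  using J_ideal by (meson additive_subgroup.a_Hcarr ideal.axioms(1))

lemma J_zero: "0 \<in> J"
  using additive_subgroup.zero_closed[OF ideal.axioms(1)[OF J_ideal]] by simp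

lemma J_add: "x \<in> J \<Longrightarrow> y \<in> J \<Longrightarrow> x + y \<in> J"
  using additive_subgroup.a_closed[OF ideal.axioms(1)[OF J_ideal]] by simp

lemma J_left: "x \<in> J \<Longrightarrow> l \<in> C \<Longrightarrow> l * x \<in> J"
  using ideal.I_l_closed[OF J_ideal] by simp

lemma J_right: "x \<in> J \<Longrightarrow> r \<in> C \<Longrightarrow> x * r \<in> J"
  using ideal.I_r_closed[OF J_ideal] by simp

lemma J_scal: "x \<in> J \<Longrightarrow> scal c * x \<in> J"
  by (rule J_left) simp_all

lemma J_uminus: "x \<in> J \<Longrightarrow> - x \<in> J"
  using J_scal[of x "- 1"] by (simp add: scal_minus_one)

lemma J_diff: "x \<in> J \<Longrightarrow> y \<in> J \<Longrightarrow> x - y \<in> J"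
  using J_add[of x "- y"] J_uminus[of y] by simp

lemma J_rel: "x \<in> hecke_rels n \<Longrightarrow> x \<in> J"
  unfolding rel_ideal_def
  using ring.genideal_self[OF free_algebra_ring hecke_rels_closed] by blast

lemmas C_closed = free_algebra_closed[of _ "hecke_gens n"]

lemma C_R: "1 \<le> i \<Longrightarrow> i < n \<Longrightarrow> fR i \<in> C"
  and C_P: "1 \<le> i \<Longrightarrow> i \<le> n \<Longrightarrow> fP i \<in> C"
  and C_Q: "1 \<le> i \<Longrightarrow> i \<le> n \<Longrightarrow> fQ i \<in> C"
  by (auto intro!: gen_closed simp: hecke_gens_def)

lemma C_prod_list: "(\<And>x. x \<in> set xs \<Longrightarrow> x \<in> C) \<Longrightarrow> prod_list xs \<in> C"
  by (induction xs) (auto intro: C_closed)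

lemma C_words: "S \<subseteq> C \<Longrightarrow> words S \<subseteq> C"
  by (auto simp: words_def intro!: C_prod_list)

lemma C_power: "x \<in> C \<Longrightarrow> x ^ k \<in> C"
  by (induction k) (auto intro: C_closed)

lemma Sp_base: "b \<in> B \<Longrightarrow> b \<in> Sp B"
  using span_mod.base[where n = n and b = b and B = B and c = 1] by (simp add: scal_one)

lemma Sp_scal: "x \<in> Sp B \<Longrightarrow> scal c * x \<in> Sp B"
proof (induction rule: span_mod.induct)
  case (base b d)
  then show ?case using span_mod.base[where n = n and b = b and B = B and c = "c * d"] by (simp add: scal_mult mult.assoc)
qed (auto intro: span_mod.intros J_scal simp: distrib_left)

lemma Sp_uminus: "x \<in> Sp B \<Longrightarrow> - x \<in> Sp B"
  using Sp_scal[of x B "- 1"] by (simp add: scal_minus_one)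

lemma Sp_diff: "x \<in> Sp B \<Longrightarrow> y \<in> Sp B \<Longrightarrow> x - y \<in> Sp B"
  using span_mod.add[of x n B "- y"] Sp_uminus[of y] by simp

lemma Sp_cong: "x \<in> Sp B \<Longrightarrow> y - x \<in> J \<Longrightarrow> y \<in> Sp B"
  using span_mod.add[OF _ span_mod.ideal, of x n B "y - x"] by simp

lemma Sp_subset: "x \<in> Sp B \<Longrightarrow> B \<subseteq> Sp D \<Longrightarrow> x \<in> Sp D"
  by (induction rule: span_mod.induct) (auto intro: span_mod.intros Sp_scal)

lemma Sp_carrier: "x \<in> Sp B \<Longrightarrow> B \<subseteq> C \<Longrightarrow> x \<in> C"
  by (induction rule: span_mod.induct) (auto intro: J_carrier C_closed)

lemma Sp_left:
  assumes "x \<in> Sp B" "l \<in> C" "\<And>b. b \<in> B \<Longrightarrow> l * b \<in> Sp D"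
  shows "l * x \<in> Sp D"
  using assms(1)
  by (induction rule: span_mod.induct)
    (auto intro: span_mod.intros J_left assms(2) Sp_scal simp: distrib_left scal_left assms)

lemma Sp_right:
  assumes "x \<in> Sp B" "r \<in> C" "\<And>b. b \<in> B \<Longrightarrow> b * r \<in> Sp D"
  shows "x * r \<in> Sp D"
  using assms(1)
  by (induction rule: span_mod.induct)
    (auto intro: span_mod.intros J_right assms(2) Sp_scal simp: distrib_right mult.assoc assms)

lemma Sp_mult:
  assumes "x \<in> Sp A" "y \<in> Sp B" "A \<subseteq> C" "B \<subseteq> C" "\<And>a b. a \<in> A \<Longrightarrow> b \<in> B \<Longrightarrow> a * b \<in> Sp D"
  shows "x * y \<in> Sp D"
  using assms(1) Sp_carrier[OF assms(2,4)]
proof (rule Sp_right)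
  fix a assume "a \<in> A"
  then show "a * y \<in> Sp D"
    using assms by (intro Sp_left[OF assms(2)]) auto
qed

text \<open>
  Signs are absorbed by spans, so it suffices to know that two elements commute up to sign.
\<close>

definition sgn_comm :: "(hecke_gen, cq) free_poly \<Rightarrow> (hecke_gen, cq) free_poly \<Rightarrow> bool" where
  "sgn_comm x y \<longleftrightarrow> x * y - y * x \<in> J \<or> x * y + y * x \<in> J"

lemma sgn_comm_sym: "sgn_comm x y \<Longrightarrow> sgn_comm y x"
  unfolding sgn_comm_def using J_uminus[of "x * y - y * x"] by (auto simp: add.commute)

lemma sgn_comm_one: "sgn_comm x 1"
  by (simp add: sgn_comm_def J_zero)

lemma sgn_comm_refl: "sgn_comm x x"
  by (simp add: sgn_comm_def J_zero)

lemma sgn_comm_mult: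
  assumes "sgn_comm x y" "sgn_comm x z" "y \<in> C" "z \<in> C"
  shows "sgn_comm x (y * z)"
proof -
  have 1: "(x * y - y * x) * z + y * (x * z - z * x) = x * (y * z) - y * z * x"
    "(x * y - y * x) * z + y * (x * z + z * x) = x * (y * z) + y * z * x"
    "(x * y + y * x) * z - y * (x * z - z * x) = x * (y * z) + y * z * x"
    "(x * y + y * x) * z - y * (x * z + z * x) = x * (y * z) - y * z * x"
    by (simp_all add: algebra_simps)
  have l: "y * u \<in> J" "u * z \<in> J" if "u \<in> J" for u
    using that assms(3,4) by (auto intro: J_left J_right)
  from assms(1,2) show ?thesis
    unfolding sgn_comm_def by (elim disjE) (metis 1 l J_add J_diff)+
qed

lemma sgn_comm_prod_list:
  "(\<And>y. y \<in> set ys \<Longrightarrow> sgn_comm x y \<and> y \<in> C) \<Longrightarrow> sgn_comm x (prod_list ys)"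
  by (induction ys) (auto simp: sgn_comm_one intro!: sgn_comm_mult C_prod_list)

lemma Sp_swap:
  assumes "sgn_comm x y" "l \<in> C" "r \<in> C" and mem: "l * (y * x) * r \<in> Sp B"
  shows "l * (x * y) * r \<in> Sp B"
  using assms(1) unfolding sgn_comm_def
proof
  assume "x * y - y * x \<in> J"
  then have "l * (x * y - y * x) * r \<in> J" using assms by (intro J_right J_left)
  then show ?thesis by (intro Sp_cong[OF mem]) (simp add: algebra_simps)
next
  assume "x * y + y * x \<in> J"
  then have "l * (x * y + y * x) * r \<in> J" using assms by (intro J_right J_left)
  then show ?thesis by (intro Sp_cong[OF Sp_uminus[OF mem]]) (simp add: algebra_simps)
qed

lemma words_in_Sp:
  assumes "S \<subseteq> C" "1 \<in> Sp B" "\<And>g b. g \<in> S \<Longrightarrow> b \<in> B \<Longrightarrow> g * b \<in> Sp B"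
  shows "words S \<subseteq> Sp B"
proof
  fix x assume "x \<in> words S"
  then show "x \<in> Sp B"
    by (induction rule: words_induct) (use assms in \<open>auto intro: Sp_left\<close>)
qed

lemma words_in_Sp_right:
  assumes "S \<subseteq> C" "1 \<in> Sp B" "\<And>g b. g \<in> S \<Longrightarrow> b \<in> B \<Longrightarrow> b * g \<in> Sp B"
  shows "words S \<subseteq> Sp B"
proof
  fix x assume "x \<in> words S"
  then show "x \<in> Sp B"
    by (induction rule: words_rev_induct) (use assms in \<open>auto intro: Sp_right\<close>)
qed

end

section \<open>Derived relations\<close>

text \<open>
  The elements \<open>\<rho>\<close>, \<open>\<tau>\<close>, \<open>\<sigma>\<close> are the defining relations for \<open>R\<^sub>i p\<^sub>i\<close>, \<open>R\<^sub>i q\<^sub>i\<close> and \<open>R\<^sub>i\<^sup>2\<close>, written as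
  differences, and \<open>\<rho>'\<close>, \<open>\<tau>'\<close> are those expected for \<open>R\<^sub>i p\<^sub>i\<^sub>+\<^sub>1\<close> and \<open>R\<^sub>i q\<^sub>i\<^sub>+\<^sub>1\<close>. Multiplying the given
  relations by \<open>R\<^sub>i\<close> on both sides and eliminating \<open>R\<^sub>i\<^sup>2 = c\<close> yields
  \<open>(- c - \<epsilon>\<^sup>2) \<rho>' = 2 \<rho>'\<close> and then \<open>c \<tau>'\<close> as explicit elements of the ideal; both factors are
  invertible scalars.
\<close>

lemma cross_relation_certificate:
  fixes R p q p' q' E c :: "'r::ring_1"
  defines "\<rho> \<equiv> R * p - (p' * R + E * (q - q'))" and "\<tau> \<equiv> R * q - (- (q' * R) - E * (p + p'))"
    and "\<sigma> \<equiv> R * R - c"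
    and "\<rho>' \<equiv> R * p' - (p * R - E * (q - q'))" and "\<tau>' \<equiv> R * q' - (- (q * R) - E * (p + p'))"
  assumes E: "\<And>x. x * E = E * x" and c: "c = - (E * E) - 2"
  shows "\<rho>' + \<rho>' = R * \<rho> * R - \<sigma> * p * R + R * p' * \<sigma>
      + E * (\<tau> * R - q' * \<sigma> - R * \<tau> + \<sigma> * q) + E * E * \<rho>"
    and "c * \<tau>' = R * \<tau> * R - \<sigma> * q * R - R * q' * \<sigma> - E * (p + p') * \<sigma> - E * (\<rho> + \<rho>') * R"
proof -
  have El: "x * (E * y) = E * (x * y)" for x y
    by (metis E mult.assoc)
  note E' = El[of R] El[of p] El[of p'] El[of q] El[of q'] E[of R] E[of p] E[of p'] E[of q] E[of q']
  have two: "x * 2 = x + x" "2 * x = x + x" for x :: 'r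
    by (simp_all add: mult_2 mult_2_right)
  have c2: "x * c = - (E * (E * x)) - (x + x)" "c * x = - (E * (E * x)) - (x + x)" for x
  proof -
    have "x * (E * E) = E * (E * x)" by (metis E mult.assoc)
    then show "x * c = - (E * (E * x)) - (x + x)"
      unfolding c by (simp only: right_diff_distrib two mult_minus_right)
    show "c * x = - (E * (E * x)) - (x + x)"
      unfolding c by (simp only: left_diff_distrib two mult_minus_left mult.assoc)
  qed
  have c3: "x * (c * y) = - (E * (E * (x * y))) - (x * y + x * y)" for x y
    unfolding c2(2)[of y] by (simp only: right_diff_distrib distrib_left mult_minus_right El[of x])
  show "\<rho>' + \<rho>' = R * \<rho> * R - \<sigma> * p * R + R * p' * \<sigma>
      + E * (\<tau> * R - q' * \<sigma> - R * \<tau> + \<sigma> * q) + E * E * \<rho>"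
    unfolding \<rho>_def \<rho>'_def \<tau>_def \<sigma>_def
    by (simp add: left_diff_distrib right_diff_distrib distrib_left distrib_right mult.assoc E' c2 c3)
  show "c * \<tau>' = R * \<tau> * R - \<sigma> * q * R - R * q' * \<sigma> - E * (p + p') * \<sigma> - E * (\<rho> + \<rho>') * R"
    unfolding \<rho>_def \<rho>'_def \<tau>_def \<tau>'_def \<sigma>_def
    by (simp add: left_diff_distrib right_diff_distrib distrib_left distrib_right mult.assoc E' c2 c3)
qed

text \<open>
  The instance \<open>x = 1\<close>, \<open>y = -1\<close> of \<open>eps_generic\<close> reads \<open>4 \<noteq> -2 \<epsilon>\<^sup>2\<close>.
\<close>

lemma eps_nonzero: "- (eps ^ 2) - 2 \<noteq> 0"
proof
  assume "- (eps ^ 2) - 2 = 0"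
  then have eps: "eps ^ 2 = - 2" by (metis eq_iff_diff_eq_0 minus_minus)
  have "emb (- 1) = - 1"
    using emb_simps(2)[of 0 1] emb_simps(4) emb_simps(6)[of 0] by simp
  then show False
    using eps_generic[of 1 "- 1"] by (simp add: emb_simps(4) eps)
qed

context hecke_span
begin

definition gensA where "gensA = fP ` {1..n} \<union> fQ ` {1..n}"
definition gensR where "gensR m = fR ` {1..m}"

lemma gensA_C: "gensA \<subseteq> C"
  by (auto simp: gensA_def C_P C_Q)

lemma gensR_C: "m < n \<Longrightarrow> gensR m \<subseteq> C"
  by (auto simp: gensR_def C_R)

lemma rel_R: assumes "1 \<le> i" "i < n" shows "fR i * fR i - scal (- (eps ^ 2) - 2) \<in> J"
proof -
  have "i \<in> {1..<n}" using assms by simp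
  then have "fR i ^ 2 - scal (- (eps ^ 2) - 2) \<in> hecke_rels n"
    unfolding hecke_rels_def by blast
  from J_rel[OF this] show ?thesis by (simp only: power2_eq_square[of "fR i"])
qed

lemma rel_PQ: assumes "1 \<le> i" "i \<le> n" shows "fQ i * fQ i - (1 - fP i * fP i) \<in> J"
proof -
  have "i \<in> {1..n}" using assms by simp
  then have "(fP i ^ 2 + fQ i ^ 2) - 1 \<in> hecke_rels n"
    unfolding hecke_rels_def by blast
  moreover have "fQ i * fQ i - (1 - fP i * fP i) = (fP i ^ 2 + fQ i ^ 2) - 1"
    by (simp add: power2_eq_square)
  ultimately show ?thesis using J_rel by (simp only:)
qed

lemma rel_RP:
  assumes "1 \<le> i" "i < n"
  shows "fR i * fP i - (fP (Suc i) * fR i + scal eps * (fQ i - fQ (Suc i))) \<in> J"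
proof -
  have "i \<in> {1..<n}" using assms by simp
  then have "fR i * fP i - (fP (i+1) * fR i + scal eps * (fQ i - fQ (i+1))) \<in> hecke_rels n"
    unfolding hecke_rels_def by blast
  from J_rel[OF this] show ?thesis by (simp only: Suc_eq_plus1)
qed

lemma rel_RQ:
  assumes "1 \<le> i" "i < n"
  shows "fR i * fQ i - (- (fQ (Suc i) * fR i) - scal eps * (fP i + fP (Suc i))) \<in> J"
proof -
  have "i \<in> {1..<n}" using assms by simp
  then have "fR i * fQ i - (- (fQ (i+1) * fR i) - scal eps * (fP i + fP (i+1))) \<in> hecke_rels n"
    unfolding hecke_rels_def by blast
  from J_rel[OF this] show ?thesis by (simp only: Suc_eq_plus1)
qed

lemma rel_braid:
  assumes "1 \<le> i" "Suc i < n"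
  shows "(fR i * fR (Suc i) * fR i - fR (Suc i) * fR i * fR (Suc i))
    - scal (eps ^ 2) * (fR (Suc i) - fR i) \<in> J"
proof -
  have "i \<in> {1..<n}" "i + 1 \<in> {1..<n}" using assms by simp_all
  then have "(fR i * fR (i+1) * fR i - fR (i+1) * fR i * fR (i+1))
    - scal (eps ^ 2) * (fR (i+1) - fR i) \<in> hecke_rels n"
    unfolding hecke_rels_def by blast
  from J_rel[OF this] show ?thesis by (simp only: Suc_eq_plus1)
qed

lemma rel_R_far:
  assumes "1 \<le> i" "i < n" "1 \<le> j" "j \<le> n" "j \<noteq> i" "j \<noteq> Suc i"
  shows "sgn_comm (fR i) (fP j)" "sgn_comm (fR i) (fQ j)"
proof -
  have "i \<in> {1..<n}" "j \<in> {1..n}" "j \<noteq> i" "j \<noteq> i + 1" using assms by simp_all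
  then have "fR i * fP j - fP j * fR i \<in> hecke_rels n" "fR i * fQ j - (- (fQ j * fR i)) \<in> hecke_rels n"
    unfolding hecke_rels_def by blast+
  from this[THEN J_rel] show "sgn_comm (fR i) (fP j)" "sgn_comm (fR i) (fQ j)"
    by (simp_all add: sgn_comm_def)
qed

lemma comm_R:
  assumes "1 \<le> i" "i < n" "1 \<le> j" "j < n" "Suc i < j \<or> Suc j < i"
  shows "sgn_comm (fR i) (fR j)"
proof -
  have "i \<in> {1..<n}" "j \<in> {1..<n}" "\<bar>int i - int j\<bar> > 1" using assms by auto
  then have "fR i * fR j - (- (fR j * fR i)) \<in> hecke_rels n"
    unfolding hecke_rels_def by blast
  from J_rel[OF this] show ?thesis by (simp add: sgn_comm_def)
qed

lemma comm_A:
  assumes "x \<in> gensA" "y \<in> gensA" shows "sgn_comm x y"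
proof -
  have PP: "sgn_comm (fP i) (fP j)" if "i \<in> {1..n}" "j \<in> {1..n}" for i j
  proof (cases "i = j")
    case False
    then have "fP i * fP j - fP j * fP i \<in> J"
      using that by (intro J_rel, unfold hecke_rels_def) blast
    then show ?thesis by (simp add: sgn_comm_def)
  qed (simp add: sgn_comm_refl)
  have QQ: "sgn_comm (fQ i) (fQ j)" if "i \<in> {1..n}" "j \<in> {1..n}" for i j
  proof (cases "i = j")
    case False
    then have "fQ i * fQ j - (- (fQ j * fQ i)) \<in> J"
      using that by (intro J_rel, unfold hecke_rels_def) blast
    then show ?thesis by (simp add: sgn_comm_def)
  qed (simp add: sgn_comm_refl)
  have PQ: "sgn_comm (fP i) (fQ j)" if "i \<in> {1..n}" "j \<in> {1..n}" for i j
  proof -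
    have "fP i * fQ j - fQ j * fP i \<in> J"
      using that by (intro J_rel, unfold hecke_rels_def) blast
    then show ?thesis by (simp add: sgn_comm_def)
  qed
  show ?thesis
    using assms PP QQ PQ sgn_comm_sym[OF PQ] unfolding gensA_def by blast
qed

lemma rel_R_next: assumes i: "1 \<le> i" "i < n"
  shows "fR i * fP (Suc i) - (fP i * fR i - scal eps * (fQ i - fQ (Suc i))) \<in> J"
    and "fR i * fQ (Suc i) - (- (fQ i * fR i) - scal eps * (fP i + fP (Suc i))) \<in> J"
proof -
  let ?R = "fR i" and ?p = "fP i" and ?q = "fQ i" and ?p' = "fP (Suc i)" and ?q' = "fQ (Suc i)"
  let ?E = "scal eps :: (hecke_gen, cq) free_poly" and ?c = "scal (- (eps ^ 2) - 2) :: (hecke_gen, cq) free_poly"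
  let ?\<rho> = "?R * ?p - (?p' * ?R + ?E * (?q - ?q'))"
  let ?\<tau> = "?R * ?q - (- (?q' * ?R) - ?E * (?p + ?p'))"
  let ?\<sigma> = "?R * ?R - ?c"
  let ?\<rho>' = "?R * ?p' - (?p * ?R - ?E * (?q - ?q'))"
  let ?\<tau>' = "?R * ?q' - (- (?q * ?R) - ?E * (?p + ?p'))"
  have C: "?R \<in> C" "?p \<in> C" "?q \<in> C" "?p' \<in> C" "?q' \<in> C" "?E \<in> C"
    using i by (simp_all add: C_R C_P C_Q)
  have two: "scal (2::cq) = (2 :: (hecke_gen, cq) free_poly)"
    using scal_add[of "1::cq" 1, where 'g = hecke_gen] by (simp add: scal_one)
  have c: "?c = - (?E * ?E) - 2"
  proof -
    have "?c + ?E * ?E + 2 = scal ((- (eps ^ 2) - 2) + eps * eps + 2)"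
      by (simp only: scal_add scal_mult two)
    then show ?thesis
      by (simp add: power2_eq_square scal_def algebra_simps eq_neg_iff_add_eq_0)
  qed
  note cert = cross_relation_certificate[OF scal_comm[symmetric] c,
      where R = ?R and p = ?p and q = ?q and p' = ?p' and q' = ?q']
  have J: "?\<rho> \<in> J" "?\<tau> \<in> J" "?\<sigma> \<in> J"
    using rel_RP[OF i] rel_RQ[OF i] rel_R[OF i] by simp_all
  have "?\<rho>' + ?\<rho>' \<in> J"
    unfolding cert(1)
    by (intro J_add J_diff J_right[OF J_left[OF J(1)]] J_right[OF J_right[OF J(3)]] J_left[OF J(1)]
        J_left[OF J(2)] J_left[OF J(3)] J_right[OF J(2)] J_right[OF J(3)] J_left[where l = ?E] C_closed C)
  then have "scal (1 / 2) * (?\<rho>' + ?\<rho>') \<in> J" by (rule J_scal)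
  also have "scal (1 / 2) * (x + x) = x" for x :: "(hecke_gen, cq) free_poly"
  proof -
    have "scal (1 / 2) * (x + x) = scal (1 / 2 + 1 / 2) * x"
      by (simp only: scal_add distrib_left distrib_right)
    then show ?thesis by (simp add: scal_one)
  qed
  finally show \<rho>': "?\<rho>' \<in> J" .
  have "?c * ?\<tau>' \<in> J"
    unfolding cert(2)
    by (intro J_diff J_right[OF J_left[OF J(2)]] J_right[OF J_right[OF J(3)]] J_left[OF J(3)]
        J_right[OF J_left[OF J_add[OF J(1) \<rho>']]] C_closed C)
  then have "scal (1 / (- (eps ^ 2) - 2)) * (?c * ?\<tau>') \<in> J" by (rule J_scal)
  also have "scal (1 / (- (eps ^ 2) - 2)) * (?c * ?\<tau>') = ?\<tau>'"
    using eps_nonzero by (simp add: scal_one flip: mult.assoc scal_mult)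
  finally show "?\<tau>' \<in> J" .
qed

end

section \<open>Normal forms\<close>

lemma prod_list_split:
  assumes "1 \<le> i" "i \<le> n"
  shows "prod_list (map f [1..<Suc n]) = prod_list (map f [1..<i]) * (f i * prod_list (map f [Suc i..<Suc n]))"
proof -
  have "[1..<Suc n] = [1..<i] @ i # [Suc i..<Suc n]"
  proof -
    obtain d where "Suc n = i + Suc d" using assms(2) by (metis add_Suc_right le_Suc_ex)
    then show ?thesis
      using upt_add_eq_append[OF assms(1), of "Suc d"] by (simp add: upt_conv_Cons del: upt_Suc)
  qed
  then show ?thesis by (simp del: upt_Suc)
qed

lemma pbw_chain_0: "pbw_chain m 0 = 1"
  by (simp add: pbw_chain_def)

lemma pbw_chain_add: "pbw_chain m (a + b) = pbw_chain m a * pbw_chain (m - a) b"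
proof -
  have "[0..<a + b] = [0..<a] @ map (\<lambda>j. a + j) [0..<b]"
    using upt_add_eq_append[of 0 a b] map_add_upt[of a b] by (simp add: add.commute)
  then show ?thesis by (simp add: pbw_chain_def o_def)
qed

lemma pbw_chain_Suc: "pbw_chain m (Suc a) = pbw_chain m a * fR (m - a)"
  using pbw_chain_add[of m a 1] by (simp add: pbw_chain_def)

context hecke_span
begin

definition prodP :: "(nat \<Rightarrow> nat) \<Rightarrow> (hecke_gen, cq) free_poly" where
  "prodP k = prod_list (map (\<lambda>i. fP i ^ k i) [1..<Suc n])"

definition prodQ :: "(nat \<Rightarrow> nat) \<Rightarrow> (hecke_gen, cq) free_poly" where
  "prodQ e = prod_list (map (\<lambda>i. fQ i ^ e i) [1..<Suc n])"

definition normalA :: "(hecke_gen, cq) free_poly set" where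
  "normalA = {prodP k * prodQ e |k e. \<forall>i. e i \<in> {0, 1}}"

lemma gensA_intros: "1 \<le> i \<Longrightarrow> i \<le> n \<Longrightarrow> fP i \<in> gensA" "1 \<le> i \<Longrightarrow> i \<le> n \<Longrightarrow> fQ i \<in> gensA"
  by (simp_all add: gensA_def)

lemma comm_words:
  assumes "S \<subseteq> C" "\<And>s. s \<in> S \<Longrightarrow> sgn_comm x s" "w \<in> words S"
  shows "sgn_comm x w"
  using assms by (auto simp: words_def intro!: sgn_comm_prod_list)

lemma pow_words:
  "set is \<subseteq> {1..n} \<Longrightarrow> prod_list (map (\<lambda>i. fP i ^ k i) is) \<in> words gensA"
  "set is \<subseteq> {1..n} \<Longrightarrow> prod_list (map (\<lambda>i. fQ i ^ k i) is) \<in> words gensA"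
  by (intro words_prod_list'; force intro: words_power words_gen gensA_intros)+

lemma prod_words: "prodP k \<in> words gensA" "prodQ e \<in> words gensA"
  unfolding prodP_def prodQ_def by (rule pow_words; force)+

lemma normalA_words: "normalA \<subseteq> words gensA"
  by (auto simp: normalA_def intro: words_mult prod_words)

lemma wordsA_C: "words gensA \<subseteq> C"
  by (rule C_words[OF gensA_C])

lemma comm_wordsA: "x \<in> gensA \<Longrightarrow> w \<in> words gensA \<Longrightarrow> sgn_comm x w"
  by (rule comm_words[OF gensA_C comm_A])

text \<open>
  Isolates the factor with index \<open>i\<close> of an ordered product of powers, with the same neighbours
  \<open>L\<close> and \<open>R\<close> for every exponent \<open>l\<close> of that factor.
\<close>

lemma prod_list_isolate:
  fixes f :: "nat \<Rightarrow> (hecke_gen, cq) free_poly"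
  assumes i: "1 \<le> i" "i \<le> n" and f: "\<And>is. set is \<subseteq> {1..n} \<Longrightarrow> prod_list (map (\<lambda>j. f j ^ k j) is) \<in> words gensA"
  shows "\<exists>L\<in>words gensA. \<exists>R\<in>words gensA. \<forall>l.
    prod_list (map (\<lambda>j. f j ^ (k(i := l)) j) [1..<Suc n]) = L * (f i ^ l * R)"
proof (intro bexI allI)
  fix l
  have "map (\<lambda>j. f j ^ (k(i := l)) j) [1..<i] = map (\<lambda>j. f j ^ k j) [1..<i]"
    "map (\<lambda>j. f j ^ (k(i := l)) j) [Suc i..<Suc n] = map (\<lambda>j. f j ^ k j) [Suc i..<Suc n]"
    by auto
  then show "prod_list (map (\<lambda>j. f j ^ (k(i := l)) j) [1..<Suc n]) =
      prod_list (map (\<lambda>j. f j ^ k j) [1..<i]) *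
      (f i ^ l * prod_list (map (\<lambda>j. f j ^ k j) [Suc i..<Suc n]))"
    unfolding prod_list_split[OF i] by (simp only: fun_upd_same)
qed (rule f; use i in auto)+

lemma prodP_isolate:
  assumes "1 \<le> i" "i \<le> n"
  obtains L R where "L \<in> words gensA" "R \<in> words gensA" "\<And>l. prodP (k(i := l)) = L * (fP i ^ l * R)"
  using prod_list_isolate[of i fP k, OF assms pow_words(1)] unfolding prodP_def by blast

lemma prodQ_isolate:
  assumes "1 \<le> i" "i \<le> n"
  obtains L R where "L \<in> words gensA" "R \<in> words gensA" "\<And>l. prodQ (k(i := l)) = L * (fQ i ^ l * R)"
  using prod_list_isolate[of i fQ k, OF assms pow_words(2)] unfolding prodQ_def by blast

lemma P_normalA:
  assumes i: "1 \<le> i" "i \<le> n" and b: "b \<in> normalA"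
  shows "fP i * b \<in> Sp normalA"
proof -
  obtain k e where b: "b = prodP k * prodQ e" and e: "\<forall>i. e i \<in> {0, 1}"
    using b by (auto simp: normalA_def)
  obtain L R where w: "L \<in> words gensA" "R \<in> words gensA"
    and k: "\<And>l. prodP (k(i := l)) = L * (fP i ^ l * R)"
    using prodP_isolate[OF i, where k = k] by blast
  have C: "L \<in> C" "fP i ^ k i * R * prodQ e \<in> C"
    using w prod_words wordsA_C i by (auto intro!: C_closed C_power C_P)
  have "1 * (L * fP i) * (fP i ^ k i * R * prodQ e) = prodP (k(i := Suc (k i))) * prodQ e"
    unfolding k by (simp add: mult.assoc)
  then have "1 * (L * fP i) * (fP i ^ k i * R * prodQ e) \<in> Sp normalA"
    using e by (auto intro!: Sp_base simp: normalA_def)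
  then have "1 * (fP i * L) * (fP i ^ k i * R * prodQ e) \<in> Sp normalA"
    by (rule Sp_swap[OF comm_wordsA[OF gensA_intros(1)[OF i] w(1)] _ C(2), rotated]) simp
  moreover have "b = L * (fP i ^ k i * R) * prodQ e"
    using k[of "k i"] by (simp add: b)
  ultimately show ?thesis by (simp add: mult.assoc)
qed

lemma P_Sp_normalA: "1 \<le> i \<Longrightarrow> i \<le> n \<Longrightarrow> x \<in> Sp normalA \<Longrightarrow> fP i * x \<in> Sp normalA"
  by (rule Sp_left) (auto intro: P_normalA C_P)

lemma Q_normalA:
  assumes i: "1 \<le> i" "i \<le> n" and b: "b \<in> normalA"
  shows "fQ i * b \<in> Sp normalA"
proof -
  obtain k e where b: "b = prodP k * prodQ e" and e: "\<forall>i. e i \<in> {0, 1}"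
    using b by (auto simp: normalA_def)
  obtain L R where L: "L \<in> words gensA" and R: "R \<in> words gensA"
    and e_eq: "\<And>l. prodQ (e(i := l)) = L * (fQ i ^ l * R)"
    using prodQ_isolate[OF i, where k = e] by blast
  define W where "W = prodP k * L"
  have W: "W \<in> words gensA" using L by (simp add: W_def words_mult prod_words)
  have C: "W \<in> C" "R \<in> C" "fP i \<in> C" "fQ i \<in> C" "fQ i ^ e i * R \<in> C"
    using W R wordsA_C i by (auto intro!: C_closed C_power C_P C_Q)
  have N: "W * (fQ i ^ l * R) \<in> normalA" if "l \<in> {0, 1}" for l
  proof -
    have "W * (fQ i ^ l * R) = prodP k * prodQ (e(i := l))"
      unfolding e_eq by (simp only: W_def mult.assoc)
    moreover have "\<forall>j. (e(i := l)) j \<in> {0, 1}" using e that by simp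
    ultimately show ?thesis unfolding normalA_def by blast
  qed
  have "W * fQ i * (fQ i ^ e i * R) \<in> Sp normalA"
  proof (cases "e i = 0")
    case True
    then show ?thesis using Sp_base[OF N[of 1]] by (simp add: mult.assoc)
  next
    case False
    moreover have "e i \<in> {0, 1}" using e by blast
    ultimately have ei: "e i = 1" by simp
    \<comment> \<open>\<open>q\<^sub>i\<^sup>2 = 1 - p\<^sub>i\<^sup>2\<close>, and the factors \<open>p\<^sub>i\<close> travel back to the left\<close>
    have swap: "sgn_comm W (fP i)"
      by (rule sgn_comm_sym[OF comm_wordsA[OF gensA_intros(1)[OF i] W]])
    have WR: "W * R \<in> normalA" using N[of 0] by simp
    have "1 * (fP i * W) * R \<in> Sp normalA"
      using P_normalA[OF i WR] by (simp add: mult.assoc)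
    then have "1 * (W * fP i) * R \<in> Sp normalA"
      by (rule Sp_swap[OF swap _ C(2), rotated]) simp
    then have "1 * (fP i * W) * (fP i * R) \<in> Sp normalA"
      using P_Sp_normalA[OF i] by (simp add: mult.assoc)
    then have PP: "1 * (W * fP i) * (fP i * R) \<in> Sp normalA"
      by (rule Sp_swap[OF swap, rotated -1]) (auto intro: C_closed C)
    have "W * (1 - fP i * fP i) * R = W * R - 1 * (W * fP i) * (fP i * R)"
      by (simp add: left_diff_distrib right_diff_distrib mult.assoc)
    then have red: "W * (1 - fP i * fP i) * R \<in> Sp normalA"
      using Sp_diff[OF Sp_base[OF WR] PP] by (simp only:)
    have "W * (fQ i * fQ i - (1 - fP i * fP i)) * R \<in> J"
      by (intro J_right J_left rel_PQ i C)
    moreover have "W * (fQ i * fQ i - (1 - fP i * fP i)) * R =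
        W * fQ i * (fQ i ^ e i * R) - W * (1 - fP i * fP i) * R"
      by (simp add: ei left_diff_distrib right_diff_distrib mult.assoc)
    ultimately show ?thesis by (intro Sp_cong[OF red]) simp
  qed
  then have "1 * (W * fQ i) * (fQ i ^ e i * R) \<in> Sp normalA"
    by simp
  then have "1 * (fQ i * W) * (fQ i ^ e i * R) \<in> Sp normalA"
    by (rule Sp_swap[OF comm_wordsA[OF gensA_intros(2)[OF i] W] _ C(5), rotated]) simp
  moreover have "b = prodP k * (L * (fQ i ^ e i * R))"
    using e_eq[of "e i"] by (simp add: b)
  ultimately show ?thesis by (simp add: W_def mult.assoc)
qed

text \<open>
  The generator is moved to its place in the ordered product. There it raises the exponent,
  unless it is \<open>q\<^sub>i\<close> and meets \<open>q\<^sub>i\<close>.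
\<close>

lemma wordsA_normal: "words gensA \<subseteq> Sp normalA"
proof (rule words_in_Sp[OF gensA_C])
  have "prodP (\<lambda>_. 0) * prodQ (\<lambda>_. 0) = 1"
    by (simp add: prodP_def prodQ_def map_replicate_const prod_list_replicate del: upt_Suc)
  then show "1 \<in> Sp normalA"
    by (intro Sp_base) (auto simp: normalA_def intro!: exI[of _ "\<lambda>_. 0"])
next
  fix g b assume "g \<in> gensA" "b \<in> normalA"
  then show "g * b \<in> Sp normalA"
    by (auto simp: gensA_def P_normalA Q_normalA)
qed

definition shiftA :: "nat \<Rightarrow> (hecke_gen, cq) free_poly set" where
  "shiftA i = words gensA \<union> (\<lambda>w. w * fR i) ` words gensA"

lemma R_gensA:
  assumes i: "1 \<le> i" "i < n" and g: "g \<in> gensA"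
  shows "fR i * g \<in> Sp (shiftA i)"
proof -
  have w: "x * fR i \<in> Sp (shiftA i)" "x \<in> Sp (shiftA i)" if "x \<in> gensA" for x
    using words_gen[OF that] unfolding shiftA_def by (blast intro: Sp_base)+
  have A: "fP i \<in> gensA" "fP (Suc i) \<in> gensA" "fQ i \<in> gensA" "fQ (Suc i) \<in> gensA"
    using i by (auto intro: gensA_intros)
  obtain j where j: "1 \<le> j" "j \<le> n" "g = fP j \<or> g = fQ j" using g by (auto simp: gensA_def)
  consider "j = i" | "j = Suc i" | "j \<noteq> i" "j \<noteq> Suc i" by blast
  then show ?thesis
  proof cases
    case 1
    show ?thesis using j(3) unfolding 1
    proof
      assume "g = fP i"
      then show ?thesis
        by (simp only:) (intro Sp_cong[OF _ rel_RP[OF i]] span_mod.add Sp_diff Sp_scal w(1)[OF A(1)] w(1)[OF A(2)] w(2)[OF A(3)] w(2)[OF A(4)])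
    next
      assume "g = fQ i"
      then show ?thesis
        by (simp only:) (intro Sp_cong[OF _ rel_RQ[OF i]] Sp_diff Sp_uminus Sp_scal span_mod.add w(1)[OF A(3)] w(1)[OF A(4)] w(2)[OF A(1)] w(2)[OF A(2)])
    qed
  next
    case 2
    show ?thesis using j(3) unfolding 2
    proof
      assume "g = fP (Suc i)"
      then show ?thesis
        by (simp only:) (intro Sp_cong[OF _ rel_R_next(1)[OF i]] span_mod.add Sp_diff Sp_scal w(1)[OF A(1)] w(1)[OF A(2)] w(2)[OF A(3)] w(2)[OF A(4)])
    next
      assume "g = fQ (Suc i)"
      then show ?thesis
        by (simp only:) (intro Sp_cong[OF _ rel_R_next(2)[OF i]] Sp_diff Sp_uminus Sp_scal span_mod.add w(1)[OF A(3)] w(1)[OF A(4)] w(2)[OF A(1)] w(2)[OF A(2)])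
    qed
  next
    case 3
    have comm: "sgn_comm (fR i) g" using rel_R_far[OF i j(1,2) 3] j(3) by blast
    have "1 * (g * fR i) * 1 \<in> Sp (shiftA i)" using w(1)[OF g] by simp
    then have "1 * (fR i * g) * 1 \<in> Sp (shiftA i)" by (rule Sp_swap[OF comm, rotated -1]) simp_all
    then show ?thesis by simp
  qed
qed

lemma R_wordsA:
  assumes i: "1 \<le> i" "i < n" and w: "w \<in> words gensA"
  shows "fR i * w \<in> Sp (shiftA i)"
  using w
proof (induction rule: words_induct)
  case one
  have "1 * fR i \<in> shiftA i" unfolding shiftA_def using words_one by blast
  then show ?case by (simp add: Sp_base)
next
  case (step g w)
  have left: "u * (fR i * w) \<in> Sp (shiftA i)" if u: "u \<in> words gensA" for u
  proof (rule Sp_left[OF step.IH])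
    show "u \<in> C" using u wordsA_C by blast
    fix b assume "b \<in> shiftA i"
    then show "u * b \<in> Sp (shiftA i)"
      by (auto simp: shiftA_def intro!: Sp_base words_mult u simp flip: mult.assoc)
  qed
  have "(fR i * g) * w \<in> Sp (shiftA i)"
  proof (rule Sp_right[OF R_gensA[OF i step(1)]])
    show "w \<in> C" using step(2) wordsA_C by blast
    fix b assume "b \<in> shiftA i"
    then consider "b \<in> words gensA" | u where "u \<in> words gensA" "b = u * fR i"
      unfolding shiftA_def by blast
    then show "b * w \<in> Sp (shiftA i)"
    proof cases
      case 1
      then have "b * w \<in> shiftA i" using step(2) by (simp add: shiftA_def words_mult)
      then show ?thesis by (rule Sp_base)
    next
      case 2
      then show ?thesis using left[of u] by (simp add: mult.assoc)
    qed
  qed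
  then show ?case by (simp add: mult.assoc)
qed

lemma fR_gensR: "1 \<le> i \<Longrightarrow> i \<le> m \<Longrightarrow> fR i \<in> gensR m"
  by (simp add: gensR_def)

lemma chain_words:
  assumes "a \<le> i" "i \<le> m" shows "pbw_chain i a \<in> words (gensR m)"
  unfolding pbw_chain_def using assms
  by (intro words_prod_list) (auto intro!: fR_gensR)

lemma chain_C: "a \<le> i \<Longrightarrow> i < n \<Longrightarrow> pbw_chain i a \<in> C"
  using chain_words[of a i i] C_words[OF gensR_C[of i]] by blast

lemma comm_chain:
  assumes "m < n" "a \<le> m" "1 \<le> j" "j < n" "Suc m < j \<or> Suc j \<le> m - a"
  shows "sgn_comm (fR j) (pbw_chain m a)"
  unfolding pbw_chain_def
proof (rule sgn_comm_prod_list)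
  fix y assume "y \<in> set (map (\<lambda>l. fR (m - l)) [0..<a])"
  then obtain l where l: "l < a" "y = fR (m - l)" by auto
  then show "sgn_comm (fR j) y \<and> y \<in> C"
    using assms by (auto intro!: comm_R C_R)
qed

definition cosetR :: "nat \<Rightarrow> (hecke_gen, cq) free_poly set" where
  "cosetR m = {w * pbw_chain m b |w b. w \<in> words (gensR (m - 1)) \<and> b \<le> m}"

lemma cosetR_I: "w \<in> words (gensR (m - 1)) \<Longrightarrow> b \<le> m \<Longrightarrow> w * pbw_chain m b \<in> Sp (cosetR m)"
  by (intro Sp_base) (auto simp: cosetR_def)

text \<open>
  In \<open>R\<^sub>m R\<^sub>m\<^sub>-\<^sub>1 \<dots> R\<^sub>m\<^sub>-\<^sub>a\<^sub>+\<^sub>1 R\<^sub>j\<close> the last factor passes through the chain (small \<open>j\<close>), extends it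
  (\<open>j = m - a\<close>), cancels its last factor (\<open>j = m - a + 1\<close>), or moves left until it meets
  \<open>R\<^sub>j R\<^sub>j\<^sub>-\<^sub>1\<close>. There the braid relation applies. Its leading term turns into
  \<open>R\<^sub>j\<^sub>-\<^sub>1\<close> times the whole chain; in the two correction terms the chain is broken, and
  its lower part commutes to the left up to sign.
\<close>

lemma chain_mult_R:
  assumes m: "m < n" and a: "a \<le> m" and j: "1 \<le> j" "j \<le> m"
  shows "pbw_chain m a * fR j \<in> Sp (cosetR m)"
proof -
  have jn: "j < n" using j m by simp
  consider "j + a < m" | "j + a = m" | "j + a = Suc m" | "Suc m < j + a" by linarith
  then show ?thesis
  proof cases
    case 1
    have comm: "sgn_comm (pbw_chain m a) (fR j)"
      by (rule sgn_comm_sym[OF comm_chain]) (use 1 m a j in auto)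
    have "fR j \<in> gensR (m - 1)" by (rule fR_gensR) (use 1 j in auto)
    then have "1 * (fR j * pbw_chain m a) * 1 \<in> Sp (cosetR m)"
      using cosetR_I[OF words_gen a] by simp
    then have "1 * (pbw_chain m a * fR j) * 1 \<in> Sp (cosetR m)"
      by (rule Sp_swap[OF comm, rotated -1]) simp_all
    then show ?thesis by simp
  next
    case 2
    then have "m - a = j" by simp
    then have "pbw_chain m a * fR j = pbw_chain m (Suc a)" by (simp add: pbw_chain_Suc)
    then show ?thesis using cosetR_I[OF words_one, of "Suc a" m] 2 j by simp
  next
    case 3
    then obtain a' where a': "a = Suc a'" "m - a' = j" using j by (cases a) auto
    have C: "pbw_chain m a' \<in> C" using a a' m by (intro chain_C) auto
    have "scal (- (eps ^ 2) - 2) * pbw_chain m a' \<in> Sp (cosetR m)"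
      using cosetR_I[OF words_one, of a' m] a a' by (intro Sp_scal) simp
    moreover have "pbw_chain m a' * (fR j * fR j - scal (- (eps ^ 2) - 2)) \<in> J"
      by (intro J_left rel_R j jn C)
    ultimately show ?thesis
      by (elim Sp_cong) (simp add: a' pbw_chain_Suc mult.assoc right_diff_distrib scal_comm)
  next
    case 4
    define u v where "u = m - j" and "v = a + j - m - 2"
    have av: "a = u + (2 + v)" "u \<le> m" "m - u = j" using 4 j a by (auto simp: u_def v_def)
    have vj: "v \<le> j - 2" "2 \<le> j" using 4 a j by (auto simp: v_def)
    obtain i where i: "j = Suc i" "1 \<le> i" using vj by (cases j) auto
    have "i < n" "i < m" using i jn j by simp_all
    let ?X = "pbw_chain m u" and ?Y = "pbw_chain (j - 2) v"
    have C: "?X \<in> C" "?Y \<in> C" "fR j \<in> C" "fR i \<in> C"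
      using av vj m j i by (auto intro!: chain_C C_R)
    have "pbw_chain m a = ?X * (pbw_chain j 2 * ?Y)"
      using av by (simp only: pbw_chain_add)
    moreover have "pbw_chain j 2 = fR j * fR i"
      using i by (simp add: pbw_chain_def numeral_2_eq_2)
    ultimately have a_eq: "pbw_chain m a = ?X * fR j * fR i * ?Y"
      by (simp only: mult.assoc)
    have Yw: "?Y \<in> words (gensR (m - 1))"
      by (rule chain_words) (use vj j in auto)
    have iw: "fR i \<in> words (gensR (m - 1))"
      by (rule words_gen, rule fR_gensR) (use i j in auto)
    have commYj: "sgn_comm ?Y (fR j)"
      by (rule sgn_comm_sym[OF comm_chain]) (use vj j m jn in auto)
    have commXi: "sgn_comm ?X (fR i)"
      by (rule sgn_comm_sym[OF comm_chain]) (use av i m \<open>i < n\<close> in auto)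
    have commXY: "sgn_comm ?X y" if "y = fR l" "1 \<le> l" "l \<le> i" for y l
      unfolding that(1) by (rule sgn_comm_sym[OF comm_chain]) (use av i m that \<open>i < n\<close> in auto)
    have YX: "sgn_comm ?X ?Y"
      unfolding pbw_chain_def[of "j - 2"]
    proof (rule sgn_comm_prod_list)
      fix y assume "y \<in> set (map (\<lambda>l. fR (j - 2 - l)) [0..<v])"
      then obtain l where "l < v" "y = fR (j - 2 - l)" by auto
      then show "sgn_comm ?X y \<and> y \<in> C"
        using vj i \<open>i < n\<close> by (auto intro!: commXY C_R)
    qed
    have XjY: "sgn_comm (?X * fR j) ?Y"
      by (intro sgn_comm_sym[OF sgn_comm_mult] sgn_comm_sym[OF YX] commYj C)
    have XiY: "sgn_comm ?X (fR i * ?Y)"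
      by (intro sgn_comm_mult commXi YX C)
    \<comment> \<open>the three terms of the braid relation\<close>
    have "1 * (fR i * ?X) * (fR j * fR i * ?Y) \<in> Sp (cosetR m)"
      using cosetR_I[OF iw a] by (simp add: a_eq mult.assoc)
    then have t1: "1 * (?X * fR i) * (fR j * fR i * ?Y) \<in> Sp (cosetR m)"
      by (rule Sp_swap[OF commXi, rotated -1]) (auto intro: C_closed C)
    have "1 * (?Y * (?X * fR j)) * 1 \<in> Sp (cosetR m)"
      using cosetR_I[OF Yw, of "Suc u"] av j by (simp add: pbw_chain_Suc)
    then have t2: "1 * (?X * fR j * ?Y) * 1 \<in> Sp (cosetR m)"
      by (rule Sp_swap[OF XjY, rotated -1]) simp_all
    have "1 * (fR i * ?Y * ?X) * 1 \<in> Sp (cosetR m)"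
      using cosetR_I[OF words_mult[OF iw Yw] av(2)] by simp
    then have t3: "1 * (?X * (fR i * ?Y)) * 1 \<in> Sp (cosetR m)"
      by (rule Sp_swap[OF XiY, rotated -1]) simp_all
    let ?B = "fR i * fR j * fR i - fR j * fR i * fR j - scal (eps ^ 2) * (fR j - fR i)"
    have B: "?X * ?B * ?Y \<in> J"
      using rel_braid[of i] i jn by (intro J_right J_left C) simp
    let ?T = "1 * (?X * fR i) * (fR j * fR i * ?Y)
       - scal (eps ^ 2) * (1 * (?X * fR j * ?Y) * 1 - 1 * (?X * (fR i * ?Y)) * 1)"
    have T: "?T \<in> Sp (cosetR m)"
      by (intro Sp_diff Sp_scal t1 t2 t3)
    have "?X * fR j * fR i * (fR j * ?Y) * 1 - ?T = - (?X * ?B * ?Y)"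
      by (simp add: left_diff_distrib right_diff_distrib mult.assoc scal_left)
    then have "?X * fR j * fR i * (fR j * ?Y) * 1 \<in> Sp (cosetR m)"
      using Sp_cong[OF T] J_uminus[OF B] by simp
    then have "?X * fR j * fR i * (?Y * fR j) * 1 \<in> Sp (cosetR m)"
      by (rule Sp_swap[OF commYj, rotated -1]) (auto intro: C_closed C)
    then show ?thesis by (simp add: a_eq mult.assoc)
  qed
qed

definition normalR :: "nat \<Rightarrow> (hecke_gen, cq) free_poly set" where
  "normalR m = {prod_list (map (\<lambda>i. pbw_chain i (a i)) [1..<Suc m]) |a. \<forall>i. a i \<le> i}"

lemma normalR_words: "normalR m \<subseteq> words (gensR m)"
  by (auto simp: normalR_def simp del: upt_Suc intro!: words_prod_list' chain_words)

lemma normalR_Suc: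
  assumes "b \<in> normalR m" "a \<le> Suc m" shows "b * pbw_chain (Suc m) a \<in> normalR (Suc m)"
proof -
  obtain f where f: "b = prod_list (map (\<lambda>i. pbw_chain i (f i)) [1..<Suc m])" "\<forall>i. f i \<le> i"
    using assms(1) by (auto simp: normalR_def)
  have "map (\<lambda>i. pbw_chain i ((f(Suc m := a)) i)) [1..<Suc m] = map (\<lambda>i. pbw_chain i (f i)) [1..<Suc m]"
    by auto
  moreover have "[1..<Suc (Suc m)] = [1..<Suc m] @ [Suc m]" by simp
  ultimately have "b * pbw_chain (Suc m) a =
      prod_list (map (\<lambda>i. pbw_chain i ((f(Suc m := a)) i)) [1..<Suc (Suc m)])"
    by (simp only: f(1) map_append list.map prod_list.append prod_list.Cons prod_list.Nil
        fun_upd_same mult_1_right)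
  moreover have "\<forall>i. (f(Suc m := a)) i \<le> i" using f(2) assms(2) by simp
  ultimately show ?thesis unfolding normalR_def by blast
qed

text \<open>
  As for coset representatives, the last letter is multiplied from the right into the factor
  with the highest index, and the lower indices are treated by induction.
\<close>

lemma wordsR_normal: "m < n \<Longrightarrow> words (gensR m) \<subseteq> Sp (normalR m)"
proof (induction m)
  case 0
  have "1 \<in> normalR 0" by (auto simp: normalR_def)
  then show ?case by (auto simp: words_def gensR_def intro: Sp_base)
next
  case (Suc m)
  have IH: "words (gensR m) \<subseteq> Sp (normalR m)" using Suc by simp
  have C: "words (gensR m) \<subseteq> C" "normalR m \<subseteq> C"
    using C_words[OF gensR_C, of m] Suc.prems normalR_words[of m] by auto
  have coset: "w * pbw_chain (Suc m) a \<in> Sp (normalR (Suc m))"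
    if "w \<in> words (gensR m)" "a \<le> Suc m" for w a
    by (rule Sp_right[OF subsetD[OF IH that(1)]])
      (use that Suc.prems in \<open>auto intro!: chain_C Sp_base normalR_Suc\<close>)
  show ?case
  proof (rule words_in_Sp_right[OF gensR_C[OF Suc.prems]])
    have "1 * pbw_chain (Suc m) 0 \<in> Sp (normalR (Suc m))"
      by (rule coset[OF words_one]) simp
    then show "1 \<in> Sp (normalR (Suc m))" by (simp add: pbw_chain_0)
  next
    fix g b assume "g \<in> gensR (Suc m)" "b \<in> normalR (Suc m)"
    then obtain j f where j: "g = fR j" "1 \<le> j" "j \<le> Suc m"
      and f: "b = prod_list (map (\<lambda>i. pbw_chain i (f i)) [1..<Suc (Suc m)])" "\<forall>i. f i \<le> i"
      by (auto simp: gensR_def normalR_def simp del: upt_Suc)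
    define b' where "b' = prod_list (map (\<lambda>i. pbw_chain i (f i)) [1..<Suc m])"
    have b: "b = b' * pbw_chain (Suc m) (f (Suc m))"
      by (simp add: f(1) b'_def)
    have "b' \<in> normalR m" using f(2) unfolding b'_def normalR_def by blast
    then have b'w: "b' \<in> words (gensR m)" using normalR_words by blast
    have "b' * (pbw_chain (Suc m) (f (Suc m)) * fR j) \<in> Sp (normalR (Suc m))"
    proof (rule Sp_left[OF chain_mult_R])
      fix c assume "c \<in> cosetR (Suc m)"
      then obtain w a where c: "c = w * pbw_chain (Suc m) a" "w \<in> words (gensR m)" "a \<le> Suc m"
        by (auto simp: cosetR_def)
      show "b' * c \<in> Sp (normalR (Suc m))"
        using coset[OF words_mult[OF b'w c(2)] c(3)] by (simp add: c(1) mult.assoc)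
    qed (use Suc.prems f(2) j b'w C in auto)
    then show "b * g \<in> Sp (normalR (Suc m))"
      by (simp add: b j(1) mult.assoc)
  qed
qed

lemma C_Sp_words: "f \<in> C \<Longrightarrow> f \<in> Sp (words (gen ` hecke_gens n))"
proof -
  assume f: "f \<in> C"
  have single: "Poly_Mapping.single w c = scal c * prod_list (map gen (letters w))"
    for w :: "hecke_gen free_monoid" and c :: cq
  proof -
    have "prod_list (map gen xs) = Poly_Mapping.single (Word xs) (1::cq)" for xs :: "hecke_gen list"
      by (induction xs)
        (simp_all add: gen_def mult_single plus_free_monoid_def single_one zero_free_monoid_def flip: single_one)
    then show ?thesis by (simp add: scal_def mult_single)
  qed
  have "(\<Sum>w\<in>A. Poly_Mapping.single w (Poly_Mapping.lookup f w)) \<in> Sp (words (gen ` hecke_gens n))"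
    if "finite A" "A \<subseteq> Poly_Mapping.keys f" for A
    using that
  proof (induction A rule: finite_induct)
    case empty
    then show ?case using Sp_diff[OF Sp_base[OF words_one] Sp_base[OF words_one]] by simp
  next
    case (insert w A)
    have "set (letters w) \<subseteq> hecke_gens n"
      using f insert.prems by (auto simp: free_algebra_carrier)
    then have "prod_list (map gen (letters w)) \<in> words (gen ` hecke_gens n)"
      by (intro words_prod_list) auto
    then show ?case
      using insert unfolding sum.insert[OF insert.hyps] single by (intro span_mod.add span_mod.base) auto
  qed
  then show ?thesis
    using free_poly_sum_single[of f] by (metis finite_keys subset_refl)
qed

lemma pbw_spanning:
  assumes n: "n \<ge> 1" and f: "f \<in> C"
  shows "f \<in> Sp (pbw_poly n ` pbw_index n)"
proof -
  let ?G = "gen ` hecke_gens n :: (hecke_gen, cq) free_poly set"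
  define N where "N = {x * y |x y. x \<in> words gensA \<and> y \<in> words (gensR (n - 1))}"
  have G: "?G = gensA \<union> gensR (n - 1)"
    using n by (force simp: hecke_gens_def gensA_def gensR_def)
  have RC: "words (gensR (n - 1)) \<subseteq> C"
    using n by (intro C_words gensR_C) simp
  have N_I: "x * y \<in> Sp N" if "x \<in> words gensA" "y \<in> words (gensR (n - 1))" for x y
    using that by (intro Sp_base) (auto simp: N_def)
  have "words ?G \<subseteq> Sp N"
  proof (rule words_in_Sp)
    show "?G \<subseteq> C" by (auto intro: gen_closed)
    show "1 \<in> Sp N" using N_I[OF words_one words_one] by simp
    fix g b assume "g \<in> ?G" "b \<in> N"
    then obtain x y where b: "b = x * y" and x: "x \<in> words gensA" and y: "y \<in> words (gensR (n - 1))"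
      by (auto simp: N_def)
    from \<open>g \<in> ?G\<close> consider "g \<in> gensA" | "g \<in> gensR (n - 1)" unfolding G by blast
    then show "g * b \<in> Sp N"
    proof cases
      case 1
      then show ?thesis
        using N_I[OF words_mult[OF words_gen x] y] by (simp add: b mult.assoc)
    next
      case 2
      then obtain i where i: "g = fR i" "1 \<le> i" "i < n" using n by (auto simp: gensR_def)
      have "(fR i * x) * y \<in> Sp N"
      proof (rule Sp_right[OF R_wordsA[OF i(2,3) x]])
        show "y \<in> C" using y RC by blast
        fix s assume "s \<in> shiftA i"
        then consider "s \<in> words gensA" | u where "u \<in> words gensA" "s = u * fR i"
          unfolding shiftA_def by blast
        then show "s * y \<in> Sp N"
        proof cases
          case 1
          then show ?thesis using N_I y by blast
        next
          case (2 u)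
          have "fR i * y \<in> words (gensR (n - 1))"
            using i by (intro words_mult words_gen fR_gensR y) auto
          then show ?thesis using N_I[OF 2(1)] by (simp add: 2(2) mult.assoc)
        qed
      qed
      then show ?thesis by (simp add: b i(1) mult.assoc)
    qed
  qed
  moreover have "N \<subseteq> Sp (pbw_poly n ` pbw_index n)"
  proof
    fix z assume "z \<in> N"
    then obtain x y where z: "z = x * y" and x: "x \<in> Sp normalA" and y: "y \<in> Sp (normalR (n - 1))"
      using wordsA_normal wordsR_normal[of "n - 1"] n by (auto simp: N_def)
    show "z \<in> Sp (pbw_poly n ` pbw_index n)"
      unfolding z
    proof (rule Sp_mult[OF x y])
      show "normalA \<subseteq> C" using normalA_words wordsA_C by blast
      show "normalR (n - 1) \<subseteq> C" using normalR_words RC by blast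
      fix s t assume "s \<in> normalA" "t \<in> normalR (n - 1)"
      then obtain k e a where s: "s = prodP k * prodQ e" "\<forall>i. e i \<in> {0, 1}"
        and t: "t = prod_list (map (\<lambda>i. pbw_chain i (a i)) [1..<n])" "\<forall>i. a i \<le> i"
        using n by (auto simp: normalA_def normalR_def simp del: upt_Suc)
      let ?idx = "(restrict k {1..n}, restrict e {1..n}, restrict a {1..<n})"
      have "?idx \<in> pbw_index n"
        using s(2) t(2) by (simp add: pbw_index_def)
      moreover have "map (\<lambda>i. fP i ^ restrict k {1..n} i) [1..<Suc n] = map (\<lambda>i. fP i ^ k i) [1..<Suc n]"
        "map (\<lambda>i. fQ i ^ restrict e {1..n} i) [1..<Suc n] = map (\<lambda>i. fQ i ^ e i) [1..<Suc n]"
        "map (\<lambda>i. pbw_chain i (restrict a {1..<n} i)) [1..<n] = map (\<lambda>i. pbw_chain i (a i)) [1..<n]"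
        by auto
      then have "pbw_poly n ?idx = s * t"
        unfolding pbw_poly_def s(1) t(1) prodP_def prodQ_def by (simp only: prod.case)
      ultimately show "s * t \<in> Sp (pbw_poly n ` pbw_index n)"
        by (metis Sp_base imageI)
    qed
  qed
  ultimately show ?thesis
    using C_Sp_words[OF f] by (meson Sp_subset subset_iff)
qed

section \<open>The basis theorem\<close>

abbreviation "H \<equiv> spin_affine_hecke n"
abbreviation "cls \<equiv> presented_class (hecke_gens n) (hecke_rels n)"

lemma cls_mult: "f \<in> C \<Longrightarrow> g \<in> C \<Longrightarrow> cls (f * g) = cls f \<otimes>\<^bsub>H\<^esub> cls g"
  and cls_add: "f \<in> C \<Longrightarrow> g \<in> C \<Longrightarrow> cls (f + g) = cls f \<oplus>\<^bsub>H\<^esub> cls g"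
  and cls_scal: "f \<in> C \<Longrightarrow> cls (scal c * f) = c \<odot>\<^bsub>H\<^esub> cls f"
  using presented_class_hom(1,2)[OF hecke_rels_closed, of f n g]
    presented_class_hom(3)[OF hecke_rels_closed, of f n f c]
  by (simp_all only: spin_affine_hecke_def)

lemma cls_one: "cls 1 = \<one>\<^bsub>H\<^esub>"
  using presented_class_hom(4)[OF hecke_rels_closed, of 0 n 0] by (simp add: spin_affine_hecke_def)

lemma cls_zero_iff: "f \<in> C \<Longrightarrow> cls f = \<zero>\<^bsub>H\<^esub> \<longleftrightarrow> f \<in> J"
  using presented_class_hom(5)[OF hecke_rels_closed, of f n f] by (simp add: spin_affine_hecke_def)

lemma carrier_H: "carrier H = cls ` C"
  by (simp add: spin_affine_hecke_def presented_class_surj)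

lemma cls_list_prod: "set fs \<subseteq> C \<Longrightarrow> list_prod H (map cls fs) = cls (prod_list fs)"
  by (induction fs) (simp_all add: list_prod_def cls_one cls_mult C_prod_list subset_iff)

lemma cls_power:
  assumes "f \<in> C" shows "cls f [^]\<^bsub>H\<^esub> (k::nat) = cls (f ^ k)"
proof -
  interpret H: ring H by (rule spin_affine_hecke_ring)
  show ?thesis
    by (induction k) (simp_all only: H.nat_pow_0 H.nat_pow_Suc power_0 cls_one power_Suc2 cls_mult C_power assms)
qed

lemma pbw_poly_C: "idx \<in> pbw_index n \<Longrightarrow> pbw_poly n idx \<in> C"
  and pbw_monomial_cls: "idx \<in> pbw_index n \<Longrightarrow> pbw_monomial n idx = cls (pbw_poly n idx)"
proof -
  assume "idx \<in> pbw_index n"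
  then obtain k e a where idx: "idx = (k, e, a)" and "a \<in> (\<Pi>\<^sub>E i\<in>{1..<n}. {0..i})"
    by (auto simp: pbw_index_def)
  then have a: "a i \<le> i" if "1 \<le> i" "i < n" for i
    using that by (auto simp: PiE_iff)
  have chain: "hR_chain n i (a i) = cls (pbw_chain i (a i))" if "1 \<le> i" "i < n" for i
    unfolding hR_chain_def pbw_chain_def
    using a[OF that] that
    by (subst cls_list_prod[symmetric]) (auto simp: o_def hR_def intro!: C_R)
  have P: "set (map (\<lambda>i. fP i ^ k i) [1..<Suc n]) \<subseteq> C"
    by (auto intro!: C_power C_P)
  have Q: "set (map (\<lambda>i. fQ i ^ e i) [1..<Suc n]) \<subseteq> C"
    by (auto intro!: C_power C_Q)
  have R: "set (map (\<lambda>i. pbw_chain i (a i)) [1..<n]) \<subseteq> C"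
    by (auto intro!: chain_C a)
  have PQR: "prod_list (map (\<lambda>i. fP i ^ k i) [1..<Suc n]) \<in> C"
    "prod_list (map (\<lambda>i. fQ i ^ e i) [1..<Suc n]) \<in> C"
    "prod_list (map (\<lambda>i. pbw_chain i (a i)) [1..<n]) \<in> C"
    using P Q R by (intro C_prod_list, blast)+
  show "pbw_poly n idx \<in> C"
    unfolding idx pbw_poly_def prod.case by (intro C_closed PQR)
  have "map (\<lambda>i. hP n i [^]\<^bsub>H\<^esub> k i) [1..<Suc n] = map cls (map (\<lambda>i. fP i ^ k i) [1..<Suc n])"
    "map (\<lambda>i. hQ n i [^]\<^bsub>H\<^esub> e i) [1..<Suc n] = map cls (map (\<lambda>i. fQ i ^ e i) [1..<Suc n])"
    "map (\<lambda>i. hR_chain n i (a i)) [1..<n] = map cls (map (\<lambda>i. pbw_chain i (a i)) [1..<n])"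
    by (auto simp: hP_def hQ_def chain cls_power C_P C_Q simp del: upt_Suc)
  then show "pbw_monomial n idx = cls (pbw_poly n idx)"
    unfolding idx pbw_monomial_def pbw_poly_def prod.case
    by (simp only: cls_list_prod[OF P] cls_list_prod[OF Q] cls_list_prod[OF R] cls_mult C_closed(2) PQR)
qed

lemma sum_C: "(\<And>i. i \<in> A \<Longrightarrow> f i \<in> C) \<Longrightarrow> sum f A \<in> C"
  by (induction A rule: infinite_finite_induct) (auto intro: C_closed)

sublocale H: vectorspace class_ring H
  by (rule spin_affine_hecke_vectorspace)

text \<open>
  Turns linear combinations in the quotient into noncommutative polynomials.
\<close>

lemma finsum_cls:
  assumes "finite I" "I \<subseteq> pbw_index n"
  shows "(\<Oplus>\<^bsub>H\<^esub>idx\<in>I. c idx \<odot>\<^bsub>H\<^esub> pbw_monomial n idx) = cls (\<Sum>idx\<in>I. scal (c idx) * pbw_poly n idx)"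
  using assms
proof (induction I rule: finite_induct)
  case empty
  have "cls 0 = \<zero>\<^bsub>H\<^esub>"
    using cls_zero_iff[of 0] J_zero by simp
  then show ?case by simp
next
  case (insert idx I)
  have C: "scal (c i) * pbw_poly n i \<in> C" if "i \<in> insert idx I" for i
    using that insert.prems by (auto intro!: C_closed pbw_poly_C)
  have summand: "c i \<odot>\<^bsub>H\<^esub> pbw_monomial n i = cls (scal (c i) * pbw_poly n i)" if "i \<in> insert idx I" for i
  proof -
    have "i \<in> pbw_index n" using that insert.prems by blast
    then show ?thesis by (simp only: pbw_monomial_cls cls_scal pbw_poly_C)
  qed
  have car: "c i \<odot>\<^bsub>H\<^esub> pbw_monomial n i \<in> carrier H" if "i \<in> insert idx I" for i
    unfolding summand[OF that] carrier_H using C[OF that] by blast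
  have "(\<Oplus>\<^bsub>H\<^esub>i\<in>insert idx I. c i \<odot>\<^bsub>H\<^esub> pbw_monomial n i) =
      c idx \<odot>\<^bsub>H\<^esub> pbw_monomial n idx \<oplus>\<^bsub>H\<^esub> (\<Oplus>\<^bsub>H\<^esub>i\<in>I. c i \<odot>\<^bsub>H\<^esub> pbw_monomial n i)"
    by (rule H.M.finsum_insert[OF insert.hyps]) (use car in blast)+
  also have "\<dots> = cls (scal (c idx) * pbw_poly n idx) \<oplus>\<^bsub>H\<^esub> cls (\<Sum>i\<in>I. scal (c i) * pbw_poly n i)"
    using insert.IH insert.prems summand by simp
  also have "\<dots> = cls (\<Sum>i\<in>insert idx I. scal (c i) * pbw_poly n i)"
    unfolding sum.insert[OF insert.hyps] by (rule cls_add[symmetric]) (use C in \<open>auto intro: sum_C\<close>)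
  finally show ?case .
qed

lemma pbw_coeffs_zero:
  assumes n: "n \<ge> 1" and "finite I" "I \<subseteq> pbw_index n"
    and "(\<Oplus>\<^bsub>H\<^esub>idx\<in>I. c idx \<odot>\<^bsub>H\<^esub> pbw_monomial n idx) = \<zero>\<^bsub>H\<^esub>" "idx \<in> I"
  shows "c idx = 0"
proof -
  have "(\<Sum>idx\<in>I. scal (c idx) * pbw_poly n idx) \<in> C"
    using assms by (auto intro!: sum_C C_closed pbw_poly_C)
  then have "(\<Sum>idx\<in>I. scal (c idx) * pbw_poly n idx) \<in> J"
    using assms by (simp add: finsum_cls cls_zero_iff)
  then show ?thesis using pbw_independent[OF n assms(2,3)] assms(5) by blast
qed

lemma pbw_carrier: "idx \<in> pbw_index n \<Longrightarrow> pbw_monomial n idx \<in> carrier H"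
  by (simp add: pbw_monomial_cls carrier_H pbw_poly_C)

text \<open>
  If two exponents gave the same monomial, then its difference with itself would be a linear
  relation with coefficients \<open>1\<close> and \<open>-1\<close>.
\<close>

lemma pbw_inj:
  assumes n: "n \<ge> 1" shows "inj_on (pbw_monomial n) (pbw_index n)"
proof (rule inj_onI, rule ccontr)
  fix x y assume xy: "x \<in> pbw_index n" "y \<in> pbw_index n" "pbw_monomial n x = pbw_monomial n y" "x \<noteq> y"
  let ?c = "\<lambda>i. if i = x then 1 else - 1 :: cq"
  have C: "pbw_poly n x \<in> C" "pbw_poly n y \<in> C" "scal (- 1) * pbw_poly n x \<in> C" "scal (- 1) * pbw_poly n y \<in> C"
    using xy by (auto intro!: C_closed pbw_poly_C)
  have eq: "cls (pbw_poly n x) = cls (pbw_poly n y)"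
    using xy by (simp only: pbw_monomial_cls)
  have "(\<Oplus>\<^bsub>H\<^esub>i\<in>{x, y}. ?c i \<odot>\<^bsub>H\<^esub> pbw_monomial n i) = cls (\<Sum>i\<in>{x, y}. scal (?c i) * pbw_poly n i)"
    by (rule finsum_cls) (use xy in auto)
  also have "(\<Sum>i\<in>{x, y}. scal (?c i) * pbw_poly n i) = pbw_poly n x + scal (- 1) * pbw_poly n y"
    using xy(4) by (simp add: scal_one)
  also have "cls \<dots> = cls (pbw_poly n x + scal (- 1) * pbw_poly n x)"
    by (simp only: cls_add cls_scal C eq)
  also have "\<dots> = \<zero>\<^bsub>H\<^esub>"
    by (subst cls_zero_iff)
      (simp_all add: scal_minus_one J_zero)
  finally have "?c x = 0"
    by (intro pbw_coeffs_zero[OF n, of "{x, y}" ?c]) (use xy in auto)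
  then show False by simp
qed

lemma pbw_span:
  assumes n: "n \<ge> 1" shows "carrier H \<subseteq> H.span (pbw_monomial n ` pbw_index n)"
proof
  let ?B = "pbw_monomial n ` pbw_index n"
  have B: "?B \<subseteq> carrier H" using pbw_carrier by blast
  note sub = H.span_is_submodule[OF B]
  fix x assume "x \<in> carrier H"
  then obtain f where f: "f \<in> C" "x = cls f" by (auto simp: carrier_H)
  have P: "pbw_poly n ` pbw_index n \<subseteq> C" using pbw_poly_C by blast
  have "cls f \<in> H.span ?B" if "f \<in> Sp (pbw_poly n ` pbw_index n)" for f
    using that
  proof (induction rule: span_mod.induct)
    case (ideal g)
    then have "cls g = \<zero>\<^bsub>H\<^esub>" using cls_zero_iff J_carrier by blast
    then show ?case using LinearCombinations.submodule.zero_closed[OF sub] by simp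
  next
    case (base b c)
    then obtain idx where idx: "idx \<in> pbw_index n" "b = pbw_poly n idx" by blast
    then have "cls (scal c * b) = c \<odot>\<^bsub>H\<^esub> pbw_monomial n idx"
      by (simp only: cls_scal pbw_monomial_cls pbw_poly_C)
    moreover have "pbw_monomial n idx \<in> H.span ?B"
      using H.in_own_span[OF B] idx(1) by blast
    ultimately show ?case using LinearCombinations.submodule.smult_closed[OF sub] by simp
  next
    case (add x y)
    then show ?case
      using LinearCombinations.submodule.m_closed[OF sub] by (simp only: cls_add Sp_carrier[OF _ P])
  qed
  then show "x \<in> H.span ?B" using pbw_spanning[OF n f(1)] f(2) by blast
qed

end

theorem theorem5p5:
  fixes n :: nat
  assumes "n \<ge> 1"
  shows "inj_on (pbw_monomial n) (pbw_index n) \<and>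
         vectorspace.basis class_ring (spin_affine_hecke n) (pbw_monomial n ` pbw_index n)"
proof
  interpret hecke_span n .
  let ?B = "pbw_monomial n ` pbw_index n"
  show inj: "inj_on (pbw_monomial n) (pbw_index n)" by (rule pbw_inj[OF assms])
  have B: "?B \<subseteq> carrier H" using pbw_carrier by blast
  have "H.lin_indpt ?B"
  proof
    assume "H.lin_dep ?B"
    then obtain A a v where A: "finite A" "A \<subseteq> ?B" "H.lincomb a A = \<zero>\<^bsub>H\<^esub>" "v \<in> A" "a v \<noteq> (0::cq)"
      unfolding H.lin_dep_def by auto
    then obtain I where I: "I \<subseteq> pbw_index n" "A = pbw_monomial n ` I"
      by (meson subset_imageE)
    have injI: "inj_on (pbw_monomial n) I" using inj I(1) inj_on_subset by blast
    have fin: "finite I" using A(1) I(2) injI finite_image_iff by blast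
    obtain idx where idx: "idx \<in> I" "v = pbw_monomial n idx" using A(4) I(2) by blast
    have "(\<Oplus>\<^bsub>H\<^esub>idx\<in>I. a (pbw_monomial n idx) \<odot>\<^bsub>H\<^esub> pbw_monomial n idx) = H.lincomb a A"
      unfolding H.lincomb_def I(2)
      by (rule H.M.finsum_reindex[symmetric, OF _ injI]) (use I(1) B in \<open>auto intro!: H.smult_closed\<close>)
    then have "(\<Oplus>\<^bsub>H\<^esub>idx\<in>I. a (pbw_monomial n idx) \<odot>\<^bsub>H\<^esub> pbw_monomial n idx) = \<zero>\<^bsub>H\<^esub>"
      by (simp only: A(3))
    from pbw_coeffs_zero[OF assms fin I(1) this idx(1)] have "a (pbw_monomial n idx) = 0" .
    then show False using A(5) unfolding idx(2) by (rule notE[rotated])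
  qed
  moreover have "H.gen_set ?B"
    using pbw_span[OF assms] H.span_is_subset2[OF B] by blast
  ultimately show "vectorspace.basis class_ring (spin_affine_hecke n) ?B"
    unfolding H.basis_def using B by blast
qed

end
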